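(* Every maximal clique of the graph $\Gamma$ has size three, where $\Gamma$ is the graph whose vertices are the elliptic ovoids of the symplectic subquadrangles of the Hermitian surface $\mathcal{H}(3,4)$ of $\mathrm{PG}(3,4)$, two vertices being adjacent whenever they meet in exactly one point and their symplectic subquadrangles meet in exactly six points.
   Context: A maximal clique is a set of pairwise adjacent vertices that is not properly contained in a larger set of pairwise adjacent vertices. Let $\perp$ be a non-degenerate unitary polarity of $\mathrm{PG}(3,4)$ and let $\mathcal{H}(3,4)$ be the Hermitian surface it defines, i.e. the incidence structure of the points and lines of $\mathrm{PG}(3,4)$ that are totally isotropic with respect to $\perp$ (it has $45$ points and $27$ lines, and is a generalized quadrangle of order $(4,2)$). Symplectic subquadrangles: let $\Sigma$ be a Baer subgeometry of $\mathrm{PG}(3,4)$, i.e. a subgeometry isomorphic to $\mathrm{PG}(3,2)$, and let $\mathcal{W}=\mathcal{W}(3,2)$ be the incidence structure of all points of $\Sigma$ (there are $15$) and of the $15$ lines of $\Sigma$ (called generators of $\mathcal{W}$) that are totally isotropic with respect to a non-degenerate symplectic polarity of $\Sigma$. This polarity extends uniquely to a symplectic polarity $\tilde{\perp}$ of $\mathrm{PG}(3,4)$. $\mathcal{W}$ is called a symplectic subquadrangle of $\mathcal{H}(3,4)$ if $\tilde{\perp}\perp=\perp\tilde{\perp}=\sigma$, where $\sigma$ is a semilinear involution whose set of fixed points is $\Sigma$ (so all points of $\Sigma$ lie on $\mathcal{H}(3,4)$ and $\perp$, $\tilde{\perp}$ induce the same polarity on $\Sigma$). For two symplectic subquadrangles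 $\mathcal{W},\mathcal{W}'$, the intersection $\mathcal{W}\cap\mathcal{W}'$ denotes the set of their common points; "meeting in $n$ points" means $|\mathcal{W}\cap\mathcal{W}'|=n$. Elliptic ovoids: an elliptic ovoid of $\mathcal{W}$ is an elliptic quadric $\mathcal{Q}^-(3,2)$ of $\Sigma$ (a set of $5$ points) such that the lines of $\Sigma$ tangent to it (meeting it in exactly one point) are precisely the $15$ generators of $\mathcal{W}$. An elliptic quadric of $\Sigma$ determines a unique symplectic quadrangle $\mathcal{W}$ of $\Sigma$ in this way, called the symplectic subquadrangle of the elliptic ovoid. *)

theory Defs
  imports "HOL-Analysis.Cartesian_Space" "HOL-Library.Z2"
begin

text \<open>
  The subspaces of a projective space are represented by the linear subspaces of the underlying
  vector space; incidence is inclusion. A polarity is the map on subspaces given by taking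
  perpendiculars with respect to a form.
\<close>

definition pg_points :: "('f::field ^ 'n) set set" where
  "pg_points = {P. vec.subspace P \<and> vec.dim P = 1}"

definition pg_lines :: "('f::field ^ 'n) set set" where
  "pg_lines = {L. vec.subspace L \<and> vec.dim L = 2}"

definition perp :: "('f::field ^ 'n \<Rightarrow> 'f ^ 'n \<Rightarrow> 'f) \<Rightarrow> ('f ^ 'n) set \<Rightarrow> ('f ^ 'n) set" where
  "perp f U = {v. \<forall>u\<in>U. f u v = 0}"

definition nondegenerate_form :: "('f::field ^ 'n \<Rightarrow> 'f ^ 'n \<Rightarrow> 'f) \<Rightarrow> bool" where
  "nondegenerate_form f \<longleftrightarrow> (\<forall>v. (\<forall>u. f u v = 0) \<longrightarrow> v = 0)"

definition bilinear_form :: "('f::field ^ 'n \<Rightarrow> 'f ^ 'n \<Rightarrow> 'f) \<Rightarrow> bool" where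
  "bilinear_form f \<longleftrightarrow>
     (\<forall>v. Vector_Spaces.linear (*s) (*) (\<lambda>u. f u v)) \<and>
     (\<forall>u. Vector_Spaces.linear (*s) (*) (\<lambda>v. f u v))"

definition alternating_form :: "('f::field ^ 'n \<Rightarrow> 'f ^ 'n \<Rightarrow> 'f) \<Rightarrow> bool" where
  "alternating_form f \<longleftrightarrow> bilinear_form f \<and> (\<forall>v. f v v = 0)"

definition symplectic_polarity :: "(('f::field ^ 'n) set \<Rightarrow> ('f ^ 'n) set) \<Rightarrow> bool" where
  "symplectic_polarity p \<longleftrightarrow> (\<exists>f. alternating_form f \<and> nondegenerate_form f \<and> p = perp f)"

text \<open>
  The following two definitions are meant for fields of order four only, where squaring is the
  automorphism of order two. Semilinearity in the second argument is a consequence.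
\<close>

definition hermitian_form_4 :: "('f::field ^ 'n \<Rightarrow> 'f ^ 'n \<Rightarrow> 'f) \<Rightarrow> bool" where
  "hermitian_form_4 h \<longleftrightarrow>
     (\<forall>v. Vector_Spaces.linear (*s) (*) (\<lambda>u. h u v)) \<and> (\<forall>u v. h u v = (h v u)\<^sup>2)"

definition unitary_polarity_4 :: "(('f::field ^ 'n) set \<Rightarrow> ('f ^ 'n) set) \<Rightarrow> bool" where
  "unitary_polarity_4 p \<longleftrightarrow> (\<exists>h. hermitian_form_4 h \<and> nondegenerate_form h \<and> p = perp h)"

definition totally_isotropic :: "(('f::field ^ 'n) set \<Rightarrow> ('f ^ 'n) set) \<Rightarrow> ('f ^ 'n) set \<Rightarrow> bool" where
  "totally_isotropic p U \<longleftrightarrow> U \<subseteq> p U"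

text \<open>An incidence structure of points and lines, with inclusion as incidence.\<close>

type_synonym 'v geometry = "'v set set \<times> 'v set set"

abbreviation points_of :: "'v geometry \<Rightarrow> 'v set set" where "points_of \<equiv> fst"
abbreviation lines_of :: "'v geometry \<Rightarrow> 'v set set" where "lines_of \<equiv> snd"

definition isotropic_geometry :: "(('f::field ^ 'n) set \<Rightarrow> ('f ^ 'n) set) \<Rightarrow> ('f ^ 'n) geometry" where
  "isotropic_geometry p =
     ({P \<in> pg_points. totally_isotropic p P}, {L \<in> pg_lines. totally_isotropic p L})"

definition semilinear_involution :: "(('f::field ^ 'n) set \<Rightarrow> ('f ^ 'n) set) \<Rightarrow> bool" where
  "semilinear_involution \<sigma> \<longleftrightarrow>
     (\<exists>s \<theta>. bij s \<and> (\<forall>u v. s (u + v) = s u + s v) \<and> (\<forall>c v. s (c *s v) = \<theta> c *s s v) \<and>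
        bij \<theta> \<and> (\<forall>a b. \<theta> (a + b) = \<theta> a + \<theta> b) \<and> (\<forall>a b. \<theta> (a * b) = \<theta> a * \<theta> b) \<and>
        \<sigma> = image s) \<and>
     (\<forall>U. vec.subspace U \<longrightarrow> \<sigma> (\<sigma> U) = U) \<and> (\<exists>P\<in>pg_points. \<sigma> P \<noteq> P)"

text \<open>
  A Baer subgeometry is the image of PG(3,2) under a map \<open>baer_embedding M\<close>: the subspaces with
  coordinates in the prime field \<open>{0, 1}\<close> with respect to the basis formed by the columns of \<open>M\<close>.
  The subspaces of the subgeometry are represented by their extensions to the large space.
\<close>

definition baer_embedding :: "'f::field ^ 4 ^ 4 \<Rightarrow> (bit ^ 4) set \<Rightarrow> ('f ^ 4) set" where
  "baer_embedding M U = vec.span ((\<lambda>x. M *v (\<chi> i. if x $ i = 0 then 0 else 1)) ` U)"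

definition baer_points :: "'f::field ^ 4 ^ 4 \<Rightarrow> ('f ^ 4) set set" where
  "baer_points M = baer_embedding M ` pg_points"

definition baer_lines :: "'f::field ^ 4 ^ 4 \<Rightarrow> ('f ^ 4) set set" where
  "baer_lines M = baer_embedding M ` pg_lines"

text \<open>The image of W(3,2), where \<open>\<rho>\<close> is a symplectic polarity of PG(3,2).\<close>

definition symplectic_quadrangle ::
    "'f::field ^ 4 ^ 4 \<Rightarrow> ((bit ^ 4) set \<Rightarrow> (bit ^ 4) set) \<Rightarrow> ('f ^ 4) geometry" where
  "symplectic_quadrangle M \<rho> =
     (baer_points M, baer_embedding M ` lines_of (isotropic_geometry \<rho>))"

definition extends_polarity ::
    "'f::field ^ 4 ^ 4 \<Rightarrow> ((bit ^ 4) set \<Rightarrow> (bit ^ 4) set) \<Rightarrow> (('f ^ 4) set \<Rightarrow> ('f ^ 4) set) \<Rightarrow> bool" where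
  "extends_polarity M \<rho> p \<longleftrightarrow>
     (\<forall>U. vec.subspace U \<longrightarrow> p (baer_embedding M U) = baer_embedding M (\<rho> U))"

text \<open>
  The symplectic subquadrangles of the Hermitian surface \<open>isotropic_geometry p\<close>, where \<open>p\<close> is a
  unitary polarity. That a subquadrangle consists of points and lines of the surface follows from
  the condition relating the two polarities.
\<close>

definition symplectic_subquadrangle ::
    "(('f::field ^ 4) set \<Rightarrow> ('f ^ 4) set) \<Rightarrow> ('f ^ 4) geometry \<Rightarrow> bool" where
  "symplectic_subquadrangle p W \<longleftrightarrow>
     (\<exists>M \<rho> p' \<sigma>. invertible M \<and> symplectic_polarity \<rho> \<and> W = symplectic_quadrangle M \<rho> \<and>
        symplectic_polarity p' \<and> extends_polarity M \<rho> p' \<and>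
        semilinear_involution \<sigma> \<and> {P \<in> pg_points. \<sigma> P = P} = baer_points M \<and>
        (\<forall>U. vec.subspace U \<longrightarrow> p' (p U) = \<sigma> U \<and> p (p' U) = \<sigma> U))"

definition quadratic_form :: "('f::field ^ 'n \<Rightarrow> 'f) \<Rightarrow> bool" where
  "quadratic_form q \<longleftrightarrow>
     (\<forall>c v. q (c *s v) = c\<^sup>2 * q v) \<and> bilinear_form (\<lambda>u v. q (u + v) - q u - q v)"

definition nonsingular_quadratic_form :: "('f::field ^ 'n \<Rightarrow> 'f) \<Rightarrow> bool" where
  "nonsingular_quadratic_form q \<longleftrightarrow> quadratic_form q \<and>
     (\<forall>v. q v = 0 \<and> (\<forall>u. q (u + v) - q u - q v = 0) \<longrightarrow> v = 0)"

definition witt_index :: "('f::field ^ 'n \<Rightarrow> 'f) \<Rightarrow> nat" where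
  "witt_index q = Max {vec.dim U | U. vec.subspace U \<and> (\<forall>v\<in>U. q v = 0)}"

definition elliptic_quadric :: "('f::field ^ 4) set set \<Rightarrow> bool" where
  "elliptic_quadric Q \<longleftrightarrow>
     (\<exists>q. nonsingular_quadratic_form q \<and> witt_index q = 1 \<and>
        Q = {P \<in> pg_points. \<forall>v\<in>P. q v = 0})"

text \<open>Here \<open>M\<close> is any coordinatisation of the Baer subgeometry underlying \<open>W\<close>.\<close>

definition elliptic_ovoid :: "('f::field ^ 4) geometry \<Rightarrow> ('f ^ 4) set set \<Rightarrow> bool" where
  "elliptic_ovoid W X \<longleftrightarrow>
     (\<exists>M Q. invertible M \<and> points_of W = baer_points M \<and>
        elliptic_quadric Q \<and> X = baer_embedding M ` Q \<and>
        {L \<in> baer_lines M. card {P \<in> X. P \<subseteq> L} = 1} = lines_of W)"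

text \<open>
  The five points of an elliptic ovoid form a frame of the projective space, so they determine
  the Baer subgeometry and hence the subquadrangle; the description below is therefore proper.
\<close>

definition subquadrangle_of ::
    "(('f::field ^ 4) set \<Rightarrow> ('f ^ 4) set) \<Rightarrow> ('f ^ 4) set set \<Rightarrow> ('f ^ 4) geometry" where
  "subquadrangle_of p X = (THE W. symplectic_subquadrangle p W \<and> elliptic_ovoid W X)"

definition Gamma_vertices :: "(('f::field ^ 4) set \<Rightarrow> ('f ^ 4) set) \<Rightarrow> ('f ^ 4) set set set" where
  "Gamma_vertices p = {X. \<exists>W. symplectic_subquadrangle p W \<and> elliptic_ovoid W X}"

definition Gamma_adjacent ::
    "(('f::field ^ 4) set \<Rightarrow> ('f ^ 4) set) \<Rightarrow> ('f ^ 4) set set \<Rightarrow> ('f ^ 4) set set \<Rightarrow> bool" where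
  "Gamma_adjacent p X Y \<longleftrightarrow>
     card (X \<inter> Y) = 1 \<and>
     card (points_of (subquadrangle_of p X) \<inter> points_of (subquadrangle_of p Y)) = 6"

definition clique :: "'v set \<Rightarrow> ('v \<Rightarrow> 'v \<Rightarrow> bool) \<Rightarrow> 'v set \<Rightarrow> bool" where
  "clique V E C \<longleftrightarrow> C \<subseteq> V \<and> (\<forall>x\<in>C. \<forall>y\<in>C. x \<noteq> y \<longrightarrow> E x y)"

definition maximal_clique :: "'v set \<Rightarrow> ('v \<Rightarrow> 'v \<Rightarrow> bool) \<Rightarrow> 'v set \<Rightarrow> bool" where
  "maximal_clique V E C \<longleftrightarrow> clique V E C \<and> (\<forall>D. clique V E D \<longrightarrow> \<not> C \<subset> D)"

end

(*
  Ovoids become frames: sets B of five vectors with sum 0 such that h x x = 0 and h x y = 1 for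
  distinct x, y in B. The points of an elliptic ovoid are spanned by the vectors of a frame, unique up
  to a scalar, and the points of its subquadrangle by the nonzero vectors of the lattice of B, the
  F_2-span {v. h v b is 0 or 1 for all b in B}. Conversely, composing h with the conjugation that fixes
  this lattice gives the symplectic form exhibiting the lattice as a symplectic subquadrangle.

  Scale two adjacent ovoids so that their frames share a vector x. Counting the six common points
  shows that the lattice L of the first one meets that of the second in {0, x, y, x + y} with
  h x y = 1, and meets a multiple of it, by a scalar other than 0 and 1, in the orthogonal complement
  of x and y in L. Hence the neighbours of B are the frames consisting of x, x + y and the three
  vectors y + w (s + t), where x, y, s, t are distinct in B and w is a scalar other than 0 and 1.
  Among three neighbours of B two have the same w; then a common point is already a common vector,
  and comparing the values h u b for b in B shows that they are not adjacent. So there is no clique of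
  size four. On the other hand the neighbours with parameters (x, y, w) and (y, x, w^2) are adjacent,
  so every edge lies in a triangle.
*)
theory Submission
  imports Defs
begin

section \<open>Points, lines and polarities\<close>

text \<open>A polarity determines its form only up to a scalar, so the geometric data give
  orthogonality but no values. The ovoid supplies the normalisation: its secants are not generators
  and its tangents are, which forces the products of distinct representatives to coincide, and
  conjugate symmetry then leaves only the value 1. The number six is decisive because lattices are
  spaces over F_2. The common points of two lattices fall into three classes according to the scalar
  relating their representatives, each class consists of the nonzero vectors of a subspace, and six
  is possible only as 3 + 3 + 0. The two classes of size three are orthogonal: a product in F_2 that
  stays in F_2 after multiplication by a scalar outside F_2 must vanish. The pigeonhole step for
  three neighbours uses that F_4 has just two scalars outside F_2. The geometric definitions hide
  choices of a basis, possibly different ones for the polarity and for the quadric; frames replace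
  them, and the description operator in \<open>subquadrangle_of\<close> calls for uniqueness of the
  lines as well as of the points.\<close>

lemma pg_points_eq: "pg_points = {vec.span {v} | v :: 'f::field ^ 'n. v \<noteq> 0}"
proof (intro equalityI subsetI)
  fix P :: "('f ^ 'n) set" assume "P \<in> pg_points"
  then have P: "vec.subspace P" "vec.dim P = 1" by (auto simp: pg_points_def)
  obtain B where B: "B \<subseteq> P" "vec.independent B" "P \<subseteq> vec.span B" "card B = vec.dim P"
    using vec.basis_exists .
  then obtain v where v: "B = {v}" using P(2) by (metis card_1_singletonE)
  then have "v \<noteq> 0" using B(2) vec.dependent_zero by blast
  moreover have "P = vec.span {v}" using B v P(1) vec.span_minimal by blast
  ultimately show "P \<in> {vec.span {v} | v. v \<noteq> 0}" by blast
next
  fix P :: "('f ^ 'n) set" assume "P \<in> {vec.span {v} | v. v \<noteq> 0}"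
  then obtain v where "P = vec.span {v}" "v \<noteq> 0" by blast
  then show "P \<in> pg_points"
    by (simp add: pg_points_def vec.dim_insert)
qed

lemma pg_lines_eq:
  "pg_lines = {vec.span {u, v} | u v :: 'f::field ^ 'n. u \<noteq> 0 \<and> v \<notin> vec.span {u}}"
proof (intro equalityI subsetI)
  fix L :: "('f ^ 'n) set" assume "L \<in> pg_lines"
  then have L: "vec.subspace L" "vec.dim L = 2" by (auto simp: pg_lines_def)
  obtain B where B: "B \<subseteq> L" "vec.independent B" "L \<subseteq> vec.span B" "card B = vec.dim L"
    using vec.basis_exists .
  then obtain u v where uv: "B = {u, v}" "u \<noteq> v" using L(2) by (auto simp: card_2_iff)
  then have "u \<noteq> 0" using B(2) vec.dependent_zero by blast
  moreover have "v \<notin> vec.span {u}"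
  proof -
    have "B - {v} = {u}" using uv by auto
    then show ?thesis using B(2) uv(1) unfolding vec.dependent_def by auto
  qed
  moreover have "L = vec.span {u, v}" using B uv L(1) vec.span_minimal by blast
  ultimately show "L \<in> {vec.span {u, v} | u v. u \<noteq> 0 \<and> v \<notin> vec.span {u}}" by blast
next
  fix L :: "('f ^ 'n) set" assume "L \<in> {vec.span {u, v} | u v. u \<noteq> 0 \<and> v \<notin> vec.span {u}}"
  then obtain u v where L: "L = vec.span {u, v}" "u \<noteq> 0" "v \<notin> vec.span {u}" by blast
  have "vec.dim {v, u} = 2" using L by (simp add: vec.dim_insert)
  then show "L \<in> pg_lines"
    by (simp add: pg_lines_def L(1) insert_commute)
qed

lemma bilinear_form_simps:
  assumes "bilinear_form f"
  shows "f (u + u') v = f u v + f u' v" "f (c *s u) v = c * f u v" "f u (v + v') = f u v + f u v'"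
    "f u (c *s v) = c * f u v" "f 0 v = 0" "f u 0 = 0"
proof -
  interpret l: Vector_Spaces.linear "(*s)" "(*)" "\<lambda>u. f u v" for v
    using assms unfolding bilinear_form_def by blast
  interpret r: Vector_Spaces.linear "(*s)" "(*)" "\<lambda>v. f u v" for u
    using assms unfolding bilinear_form_def by blast
  show "f (u + u') v = f u v + f u' v" "f (c *s u) v = c * f u v" "f u (v + v') = f u v + f u v'"
    "f u (c *s v) = c * f u v" "f 0 v = 0" "f u 0 = 0"
    by (rule l.add l.scale r.add r.scale l.zero r.zero)+
qed

lemma bilinear_formI:
  assumes "\<And>u u' v. f (u + u') v = f u v + f u' v" "\<And>c u v. f (c *s u) v = c * f u v"
    "\<And>u v v'. f u (v + v') = f u v + f u v'" "\<And>c u v. f u (c *s v) = c * f u v"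
  shows "bilinear_form f"
  unfolding bilinear_form_def using assms
  by (intro conjI allI Vector_Spaces.linear_iff[THEN iffD2])
    (auto intro: vec.vector_space_axioms vector_space_over_itself.vector_space_axioms)

lemma subspace_perp: "bilinear_form f \<Longrightarrow> vec.subspace (perp f U)"
  by (rule vec.subspaceI) (auto simp: perp_def bilinear_form_simps)

lemma perp_span:
  assumes "bilinear_form f"
  shows "perp f (vec.span S) = perp f S"
proof (intro equalityI subsetI)
  fix v assume v: "v \<in> perp f S"
  have "vec.subspace {u. f u v = 0}"
    by (rule vec.subspaceI) (auto simp: bilinear_form_simps[OF assms])
  moreover have "S \<subseteq> {u. f u v = 0}" using v by (auto simp: perp_def)
  ultimately have "vec.span S \<subseteq> {u. f u v = 0}" by (rule vec.span_minimal[rotated])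
  then show "v \<in> perp f (vec.span S)" by (auto simp: perp_def)
qed (auto simp: perp_def vec.span_base)

lemma alternating_sym:
  assumes "alternating_form f"
  shows "f u v = - f v u"
proof -
  have b: "bilinear_form f" and a: "\<And>v. f v v = 0" using assms by (auto simp: alternating_form_def)
  have "f (u + v) (u + v) = f u u + f v u + (f u v + f v v)"
    by (simp only: bilinear_form_simps[OF b] add.assoc)
  then show ?thesis by (simp add: a eq_neg_iff_add_eq_0 add.commute)
qed

text \<open>A vector outside U is separated from U by a linear functional that vanishes on U and is
  1 at the vector. Nondegeneracy turns this functional into u -> f u w with w perpendicular to U, so
  the vector is not perpendicular to w.\<close>

lemma perp_perp:
  fixes f :: "'f::field ^ 'n \<Rightarrow> 'f ^ 'n \<Rightarrow> 'f"
  assumes "alternating_form f" "nondegenerate_form f" "vec.subspace U"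
  shows "perp f (perp f U) = U"
proof (intro equalityI subsetI)
  have b: "bilinear_form f" using assms(1) by (simp add: alternating_form_def)
  note bs = bilinear_form_simps[OF b]
  fix v assume v: "v \<in> perp f (perp f U)"
  show "v \<in> U"
  proof (rule ccontr)
    assume "v \<notin> U"
    obtain S where S: "S \<subseteq> U" "vec.independent S" "U \<subseteq> vec.span S" using vec.basis_exists by metis
    then have span: "vec.span S = U" using assms(3) vec.span_minimal by blast
    then have ind: "vec.independent (insert v S)"
      using S(2) \<open>v \<notin> U\<close> by (simp add: vec.independent_insert)
    \<comment> \<open>The functional is coded as one coordinate, at the arbitrary index
      \<open>undefined\<close>, of an endomorphism.\<close>
    obtain g where g: "Vector_Spaces.linear (*s) (*s) g" "\<forall>x\<in>insert v S. g x = (if x = v then axis undefined 1 else 0 :: 'f ^ 'n)"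
      using vec.linear_independent_extend[OF ind, of "\<lambda>x. if x = v then axis undefined 1 else 0"] by blast
    interpret g: Vector_Spaces.linear "(*s)" "(*s)" g by (rule g(1))
    define \<phi> where "\<phi> x = g x $ undefined" for x
    have "v \<notin> S" using S(1) \<open>v \<notin> U\<close> by blast
    have \<phi>v: "\<phi> v = 1" using g(2) by (simp add: \<phi>_def axis_def)
    have \<phi>S: "\<phi> x = 0" if "x \<in> S" for x using g(2) that \<open>v \<notin> S\<close> by (auto simp: \<phi>_def)
    have \<phi>_add: "\<phi> (x + y) = \<phi> x + \<phi> y" and \<phi>_scale: "\<phi> (c *s x) = c * \<phi> x" and \<phi>_0: "\<phi> 0 = 0" for x y c
      by (simp_all add: \<phi>_def g.add g.scale g.zero)
    have "vec.subspace {x. \<phi> x = 0}"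
      by (rule vec.subspaceI) (auto simp: \<phi>_add \<phi>_scale \<phi>_0)
    then have \<phi>U: "\<phi> x = 0" if "x \<in> U" for x
      using vec.span_minimal[of S "{x. \<phi> x = 0}"] \<phi>S span that by blast
    \<comment> \<open>T w is the coordinate vector of the functional u -> f u w. Nondegeneracy makes
      T injective, hence surjective by dimension, so every functional is represented.\<close>
    define T where "T w = (\<chi> i. f (axis i 1) w)" for w
    have T: "Vector_Spaces.linear (*s) (*s) T"
      by (intro Vector_Spaces.linear_iff[THEN iffD2] conjI vec.vector_space_axioms allI)
        (simp_all add: T_def vec_eq_iff bs)
    have T_ext: "f u w = (\<Sum>i\<in>UNIV. u $ i * T w $ i)" for u w
    proof -
      interpret l: Vector_Spaces.linear "(*s)" "(*)" "\<lambda>u. f u w"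
        using b unfolding bilinear_form_def by blast
      have "f u w = f (\<Sum>i\<in>UNIV. u $ i *s axis i 1) w" by (simp add: basis_expansion)
      then show ?thesis by (simp add: l.sum l.scale T_def)
    qed
    have "inj T"
    proof (rule injI)
      fix w w' assume "T w = T w'"
      then have "f u (w - w') = 0" for u
        using bs(3)[of u "w - w'" w'] by (simp add: T_ext[of u w] T_ext[of u w'])
      then have "w - w' = 0" using assms(2) unfolding nondegenerate_form_def by blast
      then show "w = w'" by simp
    qed
    then have "surj T" using vec.linear_inj_imp_surj[OF T] by blast
    then obtain w where w: "T w = (\<chi> i. \<phi> (axis i 1))" by (metis surjD)
    have fw: "f u w = \<phi> u" for u
    proof -
      have "\<phi> u = \<phi> (\<Sum>i\<in>UNIV. u $ i *s axis i 1)" by (simp add: basis_expansion)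
      also have "\<dots> = (\<Sum>i\<in>UNIV. u $ i * \<phi> (axis i 1))"
        by (simp add: \<phi>_def g.sum g.scale)
      finally show ?thesis unfolding T_ext w by simp
    qed
    have "w \<in> perp f U" using fw \<phi>U by (auto simp: perp_def)
    then have "f w v = 0" using v by (auto simp: perp_def)
    then have "f v w = 0" using alternating_sym[OF assms(1), of v w] by simp
    then show False using fw \<phi>v by simp
  qed
next
  fix v assume "v \<in> U"
  then have "f u v = 0" if "u \<in> perp f U" for u
    using alternating_sym[OF assms(1), of u v] that by (simp add: perp_def)
  then show "v \<in> perp f (perp f U)" by (simp add: perp_def)
qed

section \<open>Elliptic quadrics over the field of order two\<close>

declare add_bit_eq_xor [simp del] mult_bit_eq_and [simp del] power_bit_unfold [simp del]

lemma bit_add_self [simp]: "(b::bit) + b = 0"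
  by (cases b) simp_all

lemma bvec_add_self [simp]: "(x::bit ^ 'n) + x = 0"
  by (simp add: vec_eq_iff)

lemma bit_scale: "(c::bit) *s x = (if c = 0 then 0 else x)"
  by (cases c) simp_all

lemma bit_span_singleton: "vec.span {x :: bit ^ 'n} = {0, x}"
  by (auto simp: vec.span_singleton bit_scale)

lemma bit_span_pair: "vec.span {x, y} = {0, x, y, x + y}" for x y :: "bit ^ 4"
proof
  show "vec.span {x, y} \<subseteq> {0, x, y, x + y}"
  proof (rule vec.span_minimal)
    show "vec.subspace {0, x, y, x + y}"
      by (rule vec.subspaceI) (auto simp: bit_scale add.commute add.left_commute add.assoc[symmetric])
  qed simp
  show "{0, x, y, x + y} \<subseteq> vec.span {x, y}"
    by (auto intro: vec.span_zero vec.span_base vec.span_add)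
qed

lemma bit_minus_eq: "(a::bit) - b = a + b" by simp

text \<open>A singular vector x1, which exists because the Witt index is positive, extends to a
  hyperbolic pair x1, x2. The orthogonal complement P of the pair has four elements and no nonzero
  singular vector, so q is 1 on its nonzero elements and the singular vectors can be listed. The
  conclusions about sums serve to recognise tangents and to generate the lattice.\<close>

lemma elliptic_quadric_bit:
  fixes Q :: "(bit ^ 4) set set"
  assumes "elliptic_quadric Q"
  obtains S where "card S = 5" "\<Sum>S = 0" "0 \<notin> S" "Q = (\<lambda>x. vec.span {x}) ` S"
    "\<forall>x\<in>S. \<forall>y\<in>S. x \<noteq> y \<longrightarrow> x + y \<notin> S"
    "\<forall>x\<in>S. \<forall>y\<in>S. \<forall>z\<in>S. distinct [x, y, z] \<longrightarrow> x + y + z \<notin> S"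
    "\<forall>v. v = 0 \<or> v \<in> S \<or> (\<exists>x\<in>S. \<exists>y\<in>S. v = x + y)"
proof -
  have vadd_self: "(x :: bit ^ 4) + x = 0" "x + (x + y) = y" for x y
    by (simp_all add: vec_eq_iff add.assoc[symmetric])
  have badd_self: "(a :: bit) + a = 0" for a by (cases a) simp_all
  obtain q where q: "nonsingular_quadratic_form q" "witt_index q = 1" "Q = {P \<in> pg_points. \<forall>v\<in>P. q v = 0}"
    using assms unfolding elliptic_quadric_def by blast
  define f where "f u v = q (u + v) + q u + q v" for u v
  have b: "bilinear_form f" and q_scale: "q (c *s v) = c\<^sup>2 * q v" for c v
    using q(1) unfolding nonsingular_quadratic_form_def quadratic_form_def f_def by simp_all
  note bs = bilinear_form_simps[OF b]
  have q_add: "q (u + v) = q u + q v + f u v" for u v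
    unfolding f_def by (cases "q u"; cases "q v"; cases "q (u + v)") simp_all
  have q0: "q 0 = 0" using q_scale[of 0 0] by simp
  have f_self: "f v v = 0" for v by (simp add: f_def vadd_self q0 badd_self)
  have f_sym: "f u v = f v u" for u v by (simp add: f_def add.commute add.left_commute)
  let ?D = "{vec.dim U | U. vec.subspace U \<and> (\<forall>v\<in>U. q v = 0)}"
  have "vec.dim (U :: (bit ^ 4) set) \<le> 4" for U using dim_subset_UNIV_cart_gen[of U] by simp
  then have fin: "finite ?D" by (intro finite_subset[of ?D "{..4}"]) auto
  have "?D \<noteq> {}" using q0 vec.subspace_single_0 by fastforce
  then have "1 \<in> ?D" using Max_in[OF fin] q(2) unfolding witt_index_def by simp
  then obtain U where U: "vec.subspace U" "\<forall>v\<in>U. q v = 0" "vec.dim U = 1" by auto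
  then have "U \<in> pg_points" by (simp add: pg_points_def)
  then obtain x1 where "U = vec.span {x1}" and x1: "x1 \<noteq> 0" unfolding pg_points_eq by blast
  then have qx1: "q x1 = 0" using U(2) vec.span_base by blast
  have le1: "vec.dim U \<le> 1" if "vec.subspace U" "\<forall>v\<in>U. q v = 0" for U
    using Max_ge[OF fin, of "vec.dim U"] that q(2) unfolding witt_index_def by auto
  have "\<forall>v. q v = 0 \<and> (\<forall>u. f u v = 0) \<longrightarrow> v = 0"
    using q(1) unfolding nonsingular_quadratic_form_def f_def bit_minus_eq by blast
  then obtain y where "f y x1 \<noteq> 0" using x1 qx1 by blast
  then have y: "f y x1 = 1" by simp
  obtain x2 where x2: "q x2 = 0" "f x2 x1 = 1"
  proof (cases "q y = 0")
    case True
    then show ?thesis using that y by blast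
  next
    case False
    \<comment> \<open>If y is not singular, y + x1 is: q (y + x1) = q y + q x1 + f y x1 = 1 + 0 +
      1.\<close>
    then show ?thesis using that[of "y + x1"] y qx1 by (simp add: q_add bs f_self)
  qed
  define P where "P = {v. f v x1 = 0 \<and> f v x2 = 0}"
  have f12: "f x1 x2 = 1" using x2 f_sym by simp
  have P_add: "u + v \<in> P" if "u \<in> P" "v \<in> P" for u v using that by (simp add: P_def bs)
  have decomp: "\<exists>b\<in>P. v = f v x2 *s x1 + f v x1 *s x2 + b" for v
  proof
    show "v + f v x2 *s x1 + f v x1 *s x2 \<in> P"
      using x2 f12 by (simp add: P_def bs f_self badd_self)
    show "v = f v x2 *s x1 + f v x1 *s x2 + (v + f v x2 *s x1 + f v x1 *s x2)"
      by (simp add: add.commute add.left_commute vadd_self)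
  qed
  have "(UNIV :: bit set) = {0, 1}" by (auto intro: bit.exhaust)
  moreover have "card {0, 1 :: bit} = 2" by simp
  ultimately have card_bit: "CARD(bit) = 2" by simp
  define g where "g t = fst t *s x1 + fst (snd t) *s x2 + snd (snd t)" for t
  \<comment> \<open>Splitting off the hyperbolic pair is a bijection, so 2 * 2 * card P =
    16.\<close>
  have "bij_betw g (UNIV \<times> UNIV \<times> P) UNIV"
  proof (rule bij_betw_imageI)
    show "g ` (UNIV \<times> UNIV \<times> P) = UNIV"
    proof (intro equalityI subsetI)
      fix v :: "bit ^ 4"
      obtain b where "b \<in> P" "v = f v x2 *s x1 + f v x1 *s x2 + b" using decomp by blast
      then have "v = g (f v x2, f v x1, b)" "(f v x2, f v x1, b) \<in> UNIV \<times> UNIV \<times> P" by (simp_all add: g_def)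
      then show "v \<in> g ` (UNIV \<times> UNIV \<times> P)" by blast
    qed simp
    have fg: "f (g t) x2 = fst t" "f (g t) x1 = fst (snd t)" if "t \<in> UNIV \<times> UNIV \<times> P" for t
      using that x2 f12 by (auto simp: g_def P_def bs f_self)
    show "inj_on g (UNIV \<times> UNIV \<times> P)"
    proof (rule inj_onI)
      fix s t assume st: "s \<in> UNIV \<times> UNIV \<times> P" "t \<in> UNIV \<times> UNIV \<times> P" "g s = g t"
      then have 1: "fst s = fst t" "fst (snd s) = fst (snd t)" using fg by metis+
      then have "snd (snd s) = snd (snd t)" using st(3) by (simp add: g_def)
      with 1 show "s = t" by (simp add: prod_eq_iff)
    qed
  qed
  then have "card (UNIV \<times> UNIV \<times> P :: (bit \<times> bit \<times> (bit ^ 4)) set) = CARD(bit ^ 4)"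
    by (rule bij_betw_same_card)
  then have "card P = 4"
    by (simp add: card_cartesian_product card_bit)
  then have "\<not> P \<subseteq> {0}" using card_mono[of "{0}" P] by auto
  then obtain b1 where b1: "b1 \<in> P" "b1 \<noteq> 0" by blast
  have "\<not> P \<subseteq> {0, b1}" using card_mono[of "{0, b1}" P] \<open>card P = 4\<close> b1 by auto
  then obtain b2 where b2: "b2 \<in> P" "b2 \<noteq> 0" "b2 \<noteq> b1" by blast
  have "0 \<in> P" by (simp add: P_def bs)
  have sum_ne: "b1 + b2 \<noteq> 0" "b1 + b2 \<noteq> b1" "b1 + b2 \<noteq> b2"
    using b1 b2 vadd_self by (metis add.right_neutral add.commute)+
  have P: "P = {0, b1, b2, b1 + b2}"
  proof (rule card_seteq[symmetric])
    show "finite P" using \<open>card P = 4\<close> card.infinite by fastforce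
    show "{0, b1, b2, b1 + b2} \<subseteq> P" using b1 b2 P_add \<open>0 \<in> P\<close> by blast
    show "card P \<le> card {0, b1, b2, b1 + b2}" using \<open>card P = 4\<close> b1 b2 sum_ne by auto
  qed
  \<comment> \<open>A nonzero singular vector of P would span with x1 a totally singular subspace of
    dimension 2, against Witt index 1.\<close>
  have qP: "q b = 1" if "b \<in> P" "b \<noteq> 0" for b
  proof (rule ccontr)
    assume "q b \<noteq> 1"
    then have qb: "q b = 0" by simp
    have span: "vec.span {x1, b} \<subseteq> {0, x1, b, x1 + b}"
    proof (rule vec.span_minimal)
      show "vec.subspace {0, x1, b, x1 + b}"
        by (rule vec.subspaceI) (auto simp: vadd_self add.commute add.left_commute bit_scale)
    qed simp
    have "f x1 b = 0" using that(1) f_sym by (simp add: P_def)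
    then have "\<forall>v\<in>vec.span {x1, b}. q v = 0" using span qb qx1 q0 by (auto simp: q_add)
    then have "vec.dim (vec.span {x1, b}) \<le> 1" by (intro le1) simp_all
    moreover have "b \<notin> vec.span {x1}"
    proof -
      have "b \<noteq> x1" using that(1) f12 by (auto simp: P_def)
      then show ?thesis using that(2) by (auto simp: vec.span_singleton bit_scale)
    qed
    then have "vec.dim (insert b {x1}) = 2" using x1 by (simp add: vec.dim_insert)
    ultimately show False by (simp add: insert_commute)
  qed
  have qb: "q b1 = 1" "q b2 = 1" "q (b1 + b2) = 1" using qP b1 b2 sum_ne P by auto
  have fb: "f b1 b2 = 1" using qb by (simp add: f_def)
  have fv: "f x1 x1 = 0" "f x2 x2 = 0" "f b1 b1 = 0" "f b2 b2 = 0" "f x1 x2 = 1" "f x2 x1 = 1" "f b1 b2 = 1" "f b2 b1 = 1"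
    "f b1 x1 = 0" "f b1 x2 = 0" "f b2 x1 = 0" "f b2 x2 = 0" "f x1 b1 = 0" "f x2 b1 = 0" "f x1 b2 = 0" "f x2 b2 = 0"
    using f_self f12 x2 fb f_sym b1(1) b2(1) by (auto simp: P_def)
  define S where "S = {v. v \<noteq> 0 \<and> q v = 0}"
  \<comment> \<open>The value q (x1 + x2) = 1 is compensated by each nonzero b in P: q (x1 + x2 + b)
    = 1 + 1.\<close>
  let ?T = "{x1, x2, x1 + x2 + b1, x1 + x2 + b2, x1 + x2 + (b1 + b2)}"
  have T1: "f u v = 1" if "u \<in> ?T" "v \<in> ?T" "u \<noteq> v" for u v
    using that by (elim insertE emptyE) (simp_all add: bs fv)
  have T0: "?T \<subseteq> S"
  proof
    fix u assume u: "u \<in> ?T"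
    have "q u = 0" using u by (elim insertE emptyE) (simp_all add: q_add qx1 x2 qb bs fv)
    moreover have "f u x1 = 1 \<or> f u x2 = 1"
      using u by (elim insertE emptyE) (simp_all add: bs fv)
    then have "u \<noteq> 0" using bs(5) by auto
    ultimately show "u \<in> S" by (simp add: S_def)
  qed
  have ST: "S \<subseteq> ?T"
  proof
    fix v assume v: "v \<in> S"
    obtain b where b: "b \<in> P" "v = f v x2 *s x1 + f v x1 *s x2 + b" using decomp by blast
    define a c where "a = f v x2" and "c = f v x1"
    have va: "v = a *s x1 + c *s x2 + b" using b(2) by (simp add: a_def c_def)
    have "q v = 0" "v \<noteq> 0" using v by (auto simp: S_def)
    then show "v \<in> ?T" using b(1) unfolding va P
      by (cases a; cases c) (auto simp: q_add bs fv qx1 x2 qb q0 add.assoc)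
  qed
  have S: "S = ?T" using T0 ST by blast
  have d: "distinct [x1, x2, x1 + x2 + b1, x1 + x2 + b2, x1 + x2 + (b1 + b2)]"
  proof -
    have ne: "u \<noteq> v" if "f u v = 1" for u v using that f_self by auto
    have "x1 \<noteq> x2" "x1 \<noteq> x1 + x2 + b1" "x1 \<noteq> x1 + x2 + b2" "x1 \<noteq> x1 + x2 + (b1 + b2)"
      "x2 \<noteq> x1 + x2 + b1" "x2 \<noteq> x1 + x2 + b2" "x2 \<noteq> x1 + x2 + (b1 + b2)" "x1 + x2 + b1 \<noteq> x1 + x2 + b2"
      "x1 + x2 + b1 \<noteq> x1 + x2 + (b1 + b2)" "x1 + x2 + b2 \<noteq> x1 + x2 + (b1 + b2)"
      by (rule ne, simp add: bs fv)+
    then show ?thesis by simp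
  qed
  have f1: "f u v = 1" if "u \<in> S" "v \<in> S" "u \<noteq> v" for u v using T1 that S by blast
  show ?thesis
  proof
    show "card S = 5" using d unfolding S by simp
    show "\<Sum>S = 0" using d unfolding S by (simp add: vadd_self add.commute add.left_commute)
    show "0 \<notin> S" by (simp add: S_def)
    show "Q = (\<lambda>x. vec.span {x}) ` S"
    proof -
      have "(\<forall>v\<in>vec.span {x}. q v = 0) \<longleftrightarrow> q x = 0" for x
        by (auto simp: vec.span_singleton q_scale vec.span_base intro: vec.span_base)
      then show ?thesis unfolding q(3) pg_points_eq S_def by auto
    qed
    have "x + y \<notin> S" if "x \<in> S" "y \<in> S" "x \<noteq> y" for x y
      using that f1[OF that] by (simp add: S_def q_add)
    then show "\<forall>x\<in>S. \<forall>y\<in>S. x \<noteq> y \<longrightarrow> x + y \<notin> S" by blast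
    have "x + y + z \<notin> S" if "x \<in> S" "y \<in> S" "z \<in> S" "distinct [x, y, z]" for x y z
      using that f1[OF that(1,2)] f1[OF that(1,3)] f1[OF that(2,3)] by (simp add: S_def q_add bs)
    then show "\<forall>x\<in>S. \<forall>y\<in>S. \<forall>z\<in>S. distinct [x, y, z] \<longrightarrow> x + y + z \<notin> S" by blast
    show "\<forall>v. v = 0 \<or> v \<in> S \<or> (\<exists>x\<in>S. \<exists>y\<in>S. v = x + y)"
    proof
      fix v
      obtain b where b: "b \<in> P" "v = f v x2 *s x1 + f v x1 *s x2 + b" using decomp by blast
      define a c where "a = f v x2" and "c = f v x1"
      have va: "v = a *s x1 + c *s x2 + b" using b(2) by (simp add: a_def c_def)
      show "v = 0 \<or> v \<in> S \<or> (\<exists>x\<in>S. \<exists>y\<in>S. v = x + y)" using b(1) unfolding va P S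
        by (cases a; cases c; elim insertE emptyE) (simp_all add: vadd_self add.commute add.left_commute)
    qed
  qed
qed

section \<open>Baer subgeometries over the field of order four\<close>

locale field4 =
  fixes ty :: "'f::field itself"
  assumes card_field: "CARD('f) = 4"
begin

lemma finite_field: "finite (UNIV :: 'f set)"
  using card_field by (metis card.infinite zero_neq_numeral)

text \<open>Translation by 1 permutes the field and so preserves the sum of all elements, yet it
  adds 4 times 1. Hence 4 = 0.\<close>

lemma two_eq_0 [simp]: "(2::'f) = 0"
proof -
  have "(\<Sum>x::'f\<in>UNIV. x + 1) = (\<Sum>x\<in>UNIV. x)"
    by (rule sum.reindex_bij_witness[of _ "\<lambda>x. x - 1" "\<lambda>x. x + 1"]) auto
  then have "of_nat (CARD('f)) = (0::'f)"
    by (simp add: sum.distrib)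
  then have "(2::'f) * 2 = 0" by (simp add: card_field)
  then show ?thesis by (metis mult_eq_0_iff)
qed

lemma add_self [simp]: "(x::'f) + x = 0"
  by (metis mult_2 mult_zero_left two_eq_0)

lemma add_self_left [simp]: "(x::'f) + (x + y) = y"
  by (metis add.assoc add_0 add_self)

lemma minus_eq [simp]: "- (x::'f) = x"
  by (metis add_self minus_unique)

lemma diff_eq [simp]: "(x::'f) - y = x + y"
  by (metis minus_eq diff_conv_add_uminus)

lemma vadd_self [simp]: "(x::'f^'n) + x = 0"
  by (simp add: vec_eq_iff)

lemma vadd_self_left [simp]: "(x::'f^'n) + (x + y) = y"
  by (simp add: vec_eq_iff)

lemma vtwo_eq_0 [simp]: "(2::'f^'n) = 0"
  by (simp add: vec_eq_iff)

lemma vminus_eq [simp]: "- (x::'f^'n) = x"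
  by (simp add: vec_eq_iff)

lemma vdiff_eq [simp]: "(x::'f^'n) - y = x + y"
  by (simp add: vec_eq_iff)

lemma add_eq_0 [simp]: "(x::'f) + y = 0 \<longleftrightarrow> x = y"
  by (metis add_self_left add.right_neutral add_self)

lemma vadd_eq_0 [simp]: "(x::'f^'n) + y = 0 \<longleftrightarrow> x = y"
  by (simp add: vec_eq_iff)

lemma add_self_simps [simp]:
  "(x::'f) + y = x \<longleftrightarrow> y = 0" "(x::'f) + y = y \<longleftrightarrow> x = 0"
  by auto

lemma square_add: "((x::'f) + y)\<^sup>2 = x\<^sup>2 + y\<^sup>2"
  by (simp add: power2_sum)

lemma elements:
  assumes "(w::'f) \<noteq> 0" "w \<noteq> 1"
  shows "UNIV = {0, 1, w, w + 1}" "w * w = w + 1"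
proof -
  have "{0, 1, w, w + 1} \<subseteq> UNIV" by simp
  moreover have "card {0, 1, w, w + 1} = 4"
    using assms by auto
  ultimately show *: "UNIV = {0, 1, w, w + 1}"
    using card_field finite_field by (metis card_subset_eq)
  have "w * w \<noteq> 1"
  proof
    assume "w * w = 1"
    then have "(w + 1) * (w + 1) = 0" by (simp add: algebra_simps)
    with assms show False by simp
  qed
  then show "w * w = w + 1" using * assms by (metis UNIV_I empty_iff insert_iff mult_cancel_right1 mult_eq_0_iff)
qed

lemma ex_primitive: "\<exists>w::'f. w \<noteq> 0 \<and> w \<noteq> 1"
proof (rule ccontr)
  assume "\<nexists>w::'f. w \<noteq> 0 \<and> w \<noteq> 1"
  then have "UNIV \<subseteq> {0, 1::'f}" by auto
  then have "CARD('f) \<le> card {0, 1::'f}" by (intro card_mono) auto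
  then show False using card_field by simp
qed

lemma cases_01 [consumes 1]:
  assumes "(w::'f) \<noteq> 0" "w \<noteq> 1"
  shows "c = 0 \<or> c = 1 \<or> c = w \<or> c = w + 1"
  using elements(1)[OF assms] by auto

text \<open>The norm from F_4 to F_2: every nonzero scalar has norm 1. For a Hermitian form this
  means h (c *s u) (c *s v) = h u v, so frames may be rescaled.\<close>

lemma mult_square [simp]: "(c::'f) \<noteq> 0 \<Longrightarrow> c * c\<^sup>2 = 1" "(c::'f) \<noteq> 0 \<Longrightarrow> c\<^sup>2 * c = 1"
proof -
  assume c: "c \<noteq> 0"
  show "c * c\<^sup>2 = 1"
  proof (cases "c = 1")
    case False
    have "c * c\<^sup>2 = c * (c + 1)" by (simp add: power2_eq_square elements(2)[OF c False])
    also have "\<dots> = (c + 1) + c" by (simp add: distrib_left elements(2)[OF c False])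
    finally show ?thesis by (simp add: add.commute add.left_commute)
  qed simp
  then show "c\<^sup>2 * c = 1" by (simp add: mult.commute)
qed

lemma square_square [simp]: "((c::'f)\<^sup>2)\<^sup>2 = c"
proof (cases "c = 0")
  case False
  then have "c * (c * c\<^sup>2) = c" by simp
  then show ?thesis by (simp add: power2_eq_square mult.assoc)
qed simp

lemma square_eq_1 [simp]: "(c::'f)\<^sup>2 = 1 \<longleftrightarrow> c = 1"
  by (metis one_power2 square_square)

lemma square_fixed: "(c::'f)\<^sup>2 = c \<longleftrightarrow> c = 0 \<or> c = 1"
  by (simp add: power2_eq_square)

lemma power4_eq [simp]: "(c::'f) ^ 4 = c"
  using square_square[of c] by (simp del: square_square flip: power_mult)

lemma finite_vectors: "finite (A :: ('f ^ 'n) set)"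
proof -
  have "CARD('f ^ 'n) \<noteq> 0" by (simp add: card_field)
  then show ?thesis by (metis card.infinite finite_subset subset_UNIV)
qed

definition lift :: "bit \<Rightarrow> 'f" where "lift b = (if b = 0 then 0 else 1)"

definition baer_vec :: "'f ^ 4 ^ 4 \<Rightarrow> bit ^ 4 \<Rightarrow> 'f ^ 4" where
  "baer_vec M x = M *v (\<chi> i. lift (x $ i))"

lemma lift_simps [simp]: "lift 0 = 0" "lift 1 = 1" "lift b = 0 \<longleftrightarrow> b = 0" "lift b = 1 \<longleftrightarrow> b = 1"
  "(lift b)\<^sup>2 = lift b"
  by (cases b; simp add: lift_def)+

lemma lift_eq_iff [simp]: "lift a = lift b \<longleftrightarrow> a = b"
  by (cases a; cases b; simp)

lemma lift_add: "lift (a + b) = lift a + lift b"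
  by (cases a; cases b; simp)

lemma lift_mult: "lift (a * b) = lift a * lift b"
  by (cases a; cases b; simp)

lemma baer_vec_add: "baer_vec M (x + y) = baer_vec M x + baer_vec M y"
proof -
  have "(\<chi> i. lift ((x + y) $ i)) = (\<chi> i. lift (x $ i)) + (\<chi> i. lift (y $ i))"
    by (simp add: vec_eq_iff lift_add)
  then show ?thesis by (simp add: baer_vec_def matrix_vector_right_distrib)
qed

lemma baer_vec_0 [simp]: "baer_vec M 0 = 0"
  using baer_vec_add[of M 0 0] by simp

lemma baer_vec_scale: "baer_vec M (c *s x) = lift c *s baer_vec M x"
  by (simp add: bit_scale)

lemma baer_embedding_span: "baer_embedding M U = vec.span (baer_vec M ` U)"
  by (simp add: baer_embedding_def baer_vec_def lift_def)

text \<open>F_4 is F_2 + w F_2, so each coordinate relative to M splits into two bits. With the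
  uniqueness below, the space is the direct sum of the binary lattice and its multiple by w.\<close>

lemma baer_vec_coords_exist:
  assumes "invertible M" "w \<noteq> 0" "w \<noteq> 1"
  shows "\<exists>x y. v = baer_vec M x + w *s baer_vec M y"
proof -
  obtain N where N: "M ** N = mat 1" using assms(1) unfolding invertible_def by blast
  define a where "a = N *v v"
  have v: "v = M *v a" using N by (simp add: a_def matrix_vector_mul_assoc)
  have "\<exists>s t. c = lift s + w * lift t" for c
    using cases_01[OF assms(2,3), of c]
    by (elim disjE; force intro: exI[of _ 0] exI[of _ 1] simp: add.commute)
  then obtain s t where st: "\<And>c. c = lift (s c) + w * lift (t c)" by metis
  have "a = (\<chi> i. lift (s (a $ i))) + w *s (\<chi> i. lift (t (a $ i)))"
    using st by (simp add: vec_eq_iff)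
  then have "v = M *v ((\<chi> i. lift (s (a $ i))) + w *s (\<chi> i. lift (t (a $ i))))"
    using v by simp
  then have "v = baer_vec M (\<chi> i. s (a $ i)) + w *s baer_vec M (\<chi> i. t (a $ i))"
    by (simp add: baer_vec_def matrix_vector_right_distrib vec.scale)
  then show ?thesis by blast
qed

lemma invertible_inj: "invertible M \<Longrightarrow> M *v (a :: 'f ^ 4) = M *v b \<longleftrightarrow> a = b"
  by (metis invertible_def matrix_left_invertible_injective injD)

lemma baer_vec_coords_unique:
  assumes "invertible M" "w \<noteq> 0" "w \<noteq> 1"
    "baer_vec M x + w *s baer_vec M y = baer_vec M x' + w *s baer_vec M y'"
  shows "x = x'" "y = y'"
proof -
  have "M *v ((\<chi> i. lift (x $ i)) + w *s (\<chi> i. lift (y $ i))) =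
      M *v ((\<chi> i. lift (x' $ i)) + w *s (\<chi> i. lift (y' $ i)))"
    using assms(4) by (simp add: baer_vec_def matrix_vector_right_distrib vec.scale)
  then have *: "lift (x $ i) + w * lift (y $ i) = lift (x' $ i) + w * lift (y' $ i)" for i
    using invertible_inj[OF assms(1)] by (simp add: vec_eq_iff)
  have "x $ i = x' $ i \<and> y $ i = y' $ i" for i
    using *[of i] assms(2,3) by (cases "x $ i"; cases "y $ i"; cases "x' $ i"; cases "y' $ i") auto
  then show "x = x'" "y = y'" by (simp_all add: vec_eq_iff)
qed

lemma inj_baer_vec:
  assumes "invertible M"
  shows "baer_vec M x = baer_vec M y \<longleftrightarrow> x = y"
proof -
  obtain w where "w \<noteq> (0::'f)" "w \<noteq> 1" using ex_primitive by blast
  then show ?thesis using baer_vec_coords_unique(1)[OF assms, of w x 0 y 0] by auto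
qed

lemma baer_vec_eq_0: "invertible M \<Longrightarrow> baer_vec M x = 0 \<longleftrightarrow> x = 0"
  using inj_baer_vec[of M x 0] by simp

text \<open>The set U + w U is already closed under scalars because w * w = w + 1. Membership in the
  extended subspace thus becomes a condition on bit vectors.\<close>

lemma baer_embedding_eq:
  assumes "vec.subspace U" "w \<noteq> 0" "w \<noteq> 1"
  shows "baer_embedding M U = {baer_vec M x + w *s baer_vec M y | x y. x \<in> U \<and> y \<in> U}" (is "_ = ?R")
proof
  note add = vec.subspace_add[OF assms(1)] and zero = vec.subspace_0[OF assms(1)]
  have w_mult: "w *s v \<in> ?R" if v: "v \<in> ?R" for v
  proof -
    obtain x y where xy: "v = baer_vec M x + w *s baer_vec M y" "x \<in> U" "y \<in> U" using v by blast
    have "w *s v = w *s baer_vec M x + (w * w) *s baer_vec M y"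
      by (simp add: xy vec.scale_right_distrib)
    also have "\<dots> = baer_vec M y + w *s baer_vec M (x + y)"
      by (simp add: elements(2)[OF assms(2,3)] vec.scale_left_distrib vec.scale_right_distrib baer_vec_add add.commute add.left_commute)
    finally show ?thesis using xy add by blast
  qed
  have R_add: "u + v \<in> ?R" if u: "u \<in> ?R" and v: "v \<in> ?R" for u v
  proof -
    obtain x y x' y' where "u = baer_vec M x + w *s baer_vec M y" "v = baer_vec M x' + w *s baer_vec M y'"
      "x \<in> U" "y \<in> U" "x' \<in> U" "y' \<in> U" using u v by blast
    moreover from this have "u + v = baer_vec M (x + x') + w *s baer_vec M (y + y')"
      by (simp add: baer_vec_add vec.scale_right_distrib add.commute add.left_commute)
    ultimately show ?thesis using add by blast
  qed
  have "0 \<in> ?R" using zero by (auto intro!: exI[of _ 0])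
  moreover have "c *s v \<in> ?R" if "v \<in> ?R" for c v
    using cases_01[OF assms(2,3), of c] \<open>0 \<in> ?R\<close> that w_mult[OF that] R_add[OF w_mult[OF that] that]
    by (elim disjE) (simp_all only: vec.scale_zero_left vec.scale_one vec.scale_left_distrib)
  ultimately have "vec.subspace ?R" using R_add by (intro vec.subspaceI)
  moreover have "baer_vec M ` U \<subseteq> ?R"
  proof
    fix v assume "v \<in> baer_vec M ` U"
    then obtain x where "x \<in> U" "v = baer_vec M x" by blast
    then have "v = baer_vec M x + w *s baer_vec M 0" by simp
    then show "v \<in> ?R" using zero \<open>x \<in> U\<close> by blast
  qed
  ultimately show "baer_embedding M U \<subseteq> ?R"
    unfolding baer_embedding_span by (rule vec.span_minimal[rotated])
  show "?R \<subseteq> baer_embedding M U"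
    unfolding baer_embedding_span
    by (clarify, intro vec.span_add vec.span_scale) (rule vec.span_base, rule imageI, assumption)+
qed

lemma baer_embedding_mem:
  assumes "invertible M" "vec.subspace U"
  shows "baer_vec M x \<in> baer_embedding M U \<longleftrightarrow> x \<in> U"
proof -
  obtain w where w: "w \<noteq> (0::'f)" "w \<noteq> 1" using ex_primitive by blast
  show ?thesis
  proof
    assume "baer_vec M x \<in> baer_embedding M U"
    then obtain y z where "baer_vec M x = baer_vec M y + w *s baer_vec M z" "y \<in> U"
      unfolding baer_embedding_eq[OF assms(2) w] by blast
    then show "x \<in> U" using baer_vec_coords_unique(1)[OF assms(1) w, of x 0 y z] by simp
  next
    assume "x \<in> U"
    then show "baer_vec M x \<in> baer_embedding M U"
      unfolding baer_embedding_span by (simp add: vec.span_base)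
  qed
qed

lemma baer_embedding_span_set: "baer_embedding M (vec.span S) = vec.span (baer_vec M ` S)"
proof -
  have "vec.subspace {x. baer_vec M x \<in> vec.span (baer_vec M ` S)}"
    by (rule vec.subspaceI) (auto simp: baer_vec_add baer_vec_scale vec.span_zero intro: vec.span_add vec.span_scale)
  moreover have "S \<subseteq> {x. baer_vec M x \<in> vec.span (baer_vec M ` S)}" by (auto intro: vec.span_base)
  ultimately have "vec.span S \<subseteq> {x. baer_vec M x \<in> vec.span (baer_vec M ` S)}"
    by (rule vec.span_minimal[rotated])
  then have "baer_vec M ` vec.span S \<subseteq> vec.span (baer_vec M ` S)" by blast
  then have "vec.span (baer_vec M ` vec.span S) \<subseteq> vec.span (baer_vec M ` S)"
    by (simp add: vec.span_minimal)
  moreover have "vec.span (baer_vec M ` S) \<subseteq> vec.span (baer_vec M ` vec.span S)"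
    by (intro vec.span_mono image_mono) (auto intro: vec.span_base)
  ultimately show ?thesis unfolding baer_embedding_span by blast
qed

lemma baer_points_eq: "baer_points M = {vec.span {baer_vec M x} | x. x \<noteq> 0}"
proof -
  have "baer_points M = {baer_embedding M (vec.span {x}) | x. x \<noteq> 0}"
    unfolding baer_points_def pg_points_eq by blast
  then show ?thesis by (simp add: baer_embedding_span_set)
qed

lemma baer_lines_eq:
  "baer_lines M = {vec.span {baer_vec M x, baer_vec M y} | x y. x \<noteq> 0 \<and> y \<noteq> 0 \<and> x \<noteq> y}"
proof -
  have "baer_lines M = {baer_embedding M (vec.span {x, y}) | x y. x \<noteq> 0 \<and> y \<notin> vec.span {x}}"
    unfolding baer_lines_def pg_lines_eq by blast
  then show ?thesis by (auto simp: baer_embedding_span_set bit_span_singleton)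
qed

end

section \<open>Frames of a unitary space\<close>

locale hermitian_space = field4 "TYPE('f)"
  for h :: "'f::field ^ 4 \<Rightarrow> 'f ^ 4 \<Rightarrow> 'f" +
  assumes herm: "hermitian_form_4 h" and nondeg: "nondegenerate_form h"
begin

lemma h_sym: "h u v = (h v u)\<^sup>2"
  using herm unfolding hermitian_form_4_def by blast

lemma h_linear: "Vector_Spaces.linear (*s) (*) (\<lambda>u. h u v)"
  using herm unfolding hermitian_form_4_def by blast

interpretation hl: Vector_Spaces.linear "(*s)" "(*)" "\<lambda>u. h u v" for v
  by (rule h_linear)

lemma h_add_left [simp]: "h (u + u') v = h u v + h u' v"
  by (rule hl.add)
lemma h_scale_left [simp]: "h (c *s u) v = c * h u v"
  by (rule hl.scale)
lemma h_zero_left [simp]: "h 0 v = 0"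
  by (rule hl.zero)
lemma h_sum_left: "h (\<Sum>i\<in>I. f i) v = (\<Sum>i\<in>I. h (f i) v)"
  by (rule hl.sum)
lemma h_add_right [simp]: "h v (u + u') = h v u + h v u'"
  using h_sym[of v "u + u'"] h_sym[of v u] h_sym[of v u'] by (simp add: square_add)
lemma h_scale_right [simp]: "h v (c *s u) = c\<^sup>2 * h v u"
  using h_sym[of v "c *s u"] h_sym[of v u] by (simp add: power_mult_distrib)
lemma h_zero_right [simp]: "h v 0 = 0"
  using h_sym[of v 0] by simp
lemma h_zero_sym: "h u v = 0 \<longleftrightarrow> h v u = 0"
  using h_sym[of u v] by simp
lemma h_one_sym: "h u v = 1 \<longleftrightarrow> h v u = 1"
  using h_sym[of u v] by simp

definition frame :: "('f ^ 4) set \<Rightarrow> bool" where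
  "frame B \<longleftrightarrow> card B = 5 \<and> \<Sum>B = 0 \<and> (\<forall>x\<in>B. \<forall>y\<in>B. h x y = (if x = y then 0 else 1))"

text \<open>Described by values rather than as a span, since vectors are compared through their
  values on B throughout. For a frame there are 16 such vectors.\<close>

definition lattice :: "('f ^ 4) set \<Rightarrow> ('f ^ 4) set" where
  "lattice B = {v. \<forall>b\<in>B. h v b = 0 \<or> h v b = 1}"

abbreviation pt :: "'f ^ 4 \<Rightarrow> ('f ^ 4) set" where
  "pt v \<equiv> vec.span {v}"

definition frame_points :: "('f ^ 4) set \<Rightarrow> ('f ^ 4) set set" where
  "frame_points B = pt ` B"

definition lattice_points :: "('f ^ 4) set \<Rightarrow> ('f ^ 4) set set" where
  "lattice_points B = pt ` (lattice B - {0})"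

lemma pt_eq_iff:
  assumes "u \<noteq> 0"
  shows "pt u = pt v \<longleftrightarrow> (\<exists>c. c \<noteq> 0 \<and> u = c *s v)"
proof
  assume "pt u = pt v"
  then have "u \<in> pt v" using vec.span_base by blast
  then obtain c where "u = c *s v" by (auto simp: vec.span_singleton)
  with assms show "\<exists>c. c \<noteq> 0 \<and> u = c *s v" by auto
next
  assume "\<exists>c. c \<noteq> 0 \<and> u = c *s v"
  then obtain c where c: "c \<noteq> 0" "u = c *s v" by auto
  then have "v = inverse c *s u" by simp
  then have "v \<in> pt u" using vec.span_base vec.span_scale by blast
  moreover have "u \<in> pt v" using c vec.span_base vec.span_scale by blast
  ultimately show "pt u = pt v" by (simp add: vec.span_eq)
qed

lemma frame_finite: "frame B \<Longrightarrow> finite B"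
  unfolding frame_def by (metis card.infinite zero_neq_numeral)

lemma frame_card: "frame B \<Longrightarrow> card B = 5"
  unfolding frame_def by blast

lemma frame_sum: "frame B \<Longrightarrow> \<Sum>B = 0"
  unfolding frame_def by blast

lemma frame_h: "frame B \<Longrightarrow> x \<in> B \<Longrightarrow> y \<in> B \<Longrightarrow> h x y = (if x = y then 0 else 1)"
  unfolding frame_def by blast

lemma frame_obtain2:
  assumes "frame B" "x \<in> B" "y \<in> B" "x \<noteq> y"
  obtains z s t where "B = {x, y, z, s, t}" "distinct [x, y, z, s, t]"
proof -
  have "card (B - {x, y}) = 3"
    using assms frame_finite[OF assms(1)] frame_card[OF assms(1)] by (simp add: card_Diff_subset)
  then obtain z s t where *: "B - {x, y} = {z, s, t}" "z \<noteq> s" "s \<noteq> t" "z \<noteq> t"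
    by (auto simp: card_3_iff)
  have "B = {x, y} \<union> (B - {x, y})" using assms by auto
  then have "B = {x, y, z, s, t}" using * by auto
  moreover have "z \<in> B - {x, y}" "s \<in> B - {x, y}" "t \<in> B - {x, y}" unfolding * by simp_all
  then have "distinct [x, y, z, s, t]" using *(2-4) assms(4) by auto
  ultimately show ?thesis using that by blast
qed

lemma frame_obtain3:
  assumes "frame B" "x \<in> B" "y \<in> B" "z \<in> B" "distinct [x, y, z]"
  obtains s t where "B = {x, y, z, s, t}" "distinct [x, y, z, s, t]"
proof -
  have "card (B - {x, y, z}) = 2"
    using assms frame_finite[OF assms(1)] frame_card[OF assms(1)] by (simp add: card_Diff_subset)
  then obtain s t where *: "B - {x, y, z} = {s, t}" "s \<noteq> t"
    by (auto simp: card_2_iff)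
  have "B = {x, y, z} \<union> (B - {x, y, z})" using assms by auto
  then have "B = {x, y, z, s, t}" using * by auto
  moreover have "s \<in> B - {x, y, z}" "t \<in> B - {x, y, z}" unfolding * by simp_all
  then have "distinct [x, y, z, s, t]" using *(2) assms(5) by auto
  ultimately show ?thesis using that by blast
qed

lemma frame_ex1: "frame B \<Longrightarrow> x \<in> B \<Longrightarrow> \<exists>y\<in>B. y \<noteq> x"
proof (rule ccontr)
  assume *: "frame B" "x \<in> B" "\<not> (\<exists>y\<in>B. y \<noteq> x)"
  then have "B = {x}" by blast
  then show False using frame_card[OF *(1)] by simp
qed

lemma frame_obtain1:
  assumes "frame B" "x \<in> B"
  obtains y z s t where "B = {x, y, z, s, t}" "distinct [x, y, z, s, t]"
proof -
  obtain y where "y \<in> B" "x \<noteq> y" using frame_ex1[OF assms] by blast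
  then show ?thesis using frame_obtain2[OF assms, of y] that by metis
qed

lemma frame_obtain:
  assumes "frame B"
  obtains x y z s t where "B = {x, y, z, s, t}" "distinct [x, y, z, s, t]"
proof -
  from frame_card[OF assms] have "B \<noteq> {}" by auto
  then show ?thesis using frame_ex1 frame_obtain2 assms that by (metis all_not_in_conv)
qed

text \<open>Pairing a vanishing combination of four frame vectors with the fifth shows that its
  coefficients have sum 0; pairing it with one of the four then isolates the coefficient of that
  one. So four of the five vectors are independent.\<close>

lemma frame_span:
  assumes "frame B"
  shows "vec.span B = UNIV"
proof -
  obtain x y z s t where B: "B = {x, y, z, s, t}" "distinct [x, y, z, s, t]"
    using frame_obtain[OF assms] .
  define A where "A = {x, y, z, s}"
  have A: "finite A" "A \<subseteq> B" "card A = 4" "t \<notin> A" "t \<in> B" using B by (auto simp: A_def)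
  have "vec.independent A"
  proof (rule vec.independent_if_scalars_zero)
    fix f v assume 0: "(\<Sum>b\<in>A. f b *s b) = 0" and v: "v \<in> A"
    have eq: "(\<Sum>b\<in>A. f b) + (if k \<in> A then f k else 0) = 0" if "k \<in> B" for k
    proof -
      have "0 = h (\<Sum>b\<in>A. f b *s b) k" using 0 by simp
      also have "\<dots> = (\<Sum>b\<in>A. f b * h b k)" by (simp add: h_sum_left)
      also have "\<dots> = (\<Sum>b\<in>A. f b + (if b = k then f k else 0))"
      proof (rule sum.cong)
        fix b assume "b \<in> A"
        then have "b \<in> B" using A(2) by blast
        then show "f b * h b k = f b + (if b = k then f k else 0)"
          by (simp add: frame_h[OF assms _ that])
      qed simp
      also have "\<dots> = (\<Sum>b\<in>A. f b) + (if k \<in> A then f k else 0)"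
        by (simp only: sum.distrib sum.delta[OF A(1)])
      finally show ?thesis by simp
    qed
    have "(\<Sum>b\<in>A. f b) = 0" using eq[OF A(5)] A(4) by simp
    then show "f v = 0" using eq[of v] v A(2) by auto
  qed (rule A(1))
  then have "vec.span A = UNIV"
    using vec.card_ge_dim_independent[of A UNIV] A(3) by (auto simp: card_cart_basis)
  then show ?thesis using vec.span_mono[OF A(2)] by auto
qed

text \<open>By nondegeneracy a vector orthogonal to a spanning set is 0. Comparing vectors by their
  five values on B turns the later case distinctions into computations.\<close>

lemma frame_ext:
  assumes "frame B" "\<And>b. b \<in> B \<Longrightarrow> h u b = h v b"
  shows "u = v"
proof -
  have "h (u + v) w = 0" for w
  proof -
    have "vec.subspace {w. h (u + v) w = 0}"
      by (rule vec.subspaceI) auto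
    moreover have "B \<subseteq> {w. h (u + v) w = 0}" using assms by auto
    ultimately have "vec.span B \<subseteq> {w. h (u + v) w = 0}" by (rule vec.span_minimal[rotated])
    then show ?thesis using frame_span[OF assms(1)] by auto
  qed
  then have "\<forall>w. h w (u + v) = 0" using h_zero_sym by blast
  then have "u + v = 0" using nondeg unfolding nondegenerate_form_def by blast
  then show ?thesis by simp
qed

lemma frame_sum_h:
  assumes "frame B"
  shows "(\<Sum>b\<in>B. h v b) = 0"
proof -
  have "(\<Sum>b\<in>B. h b v) = 0"
    using h_sum_left[of "\<lambda>x. x" B v] by (simp add: frame_sum[OF assms])
  have "(\<Sum>b\<in>B. h v b) = (\<Sum>b\<in>B. (h b v)\<^sup>2)"
    by (rule sum.cong[OF refl h_sym])
  also have "\<dots> = (\<Sum>b\<in>B. h b v)\<^sup>2"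
    by (induction B rule: infinite_finite_induct) (auto simp: square_add)
  finally show ?thesis using \<open>(\<Sum>b\<in>B. h b v) = 0\<close> by simp
qed

lemma frameI:
  assumes "a + b + c + d + e = 0" "h a a = 0" "h b b = 0" "h c c = 0" "h d d = 0" "h e e = 0"
    "h a b = 1" "h a c = 1" "h a d = 1" "h a e = 1" "h b c = 1" "h b d = 1" "h b e = 1"
    "h c d = 1" "h c e = 1" "h d e = 1"
  shows "frame {a, b, c, d, e}"
proof -
  have "h b a = 1" "h c a = 1" "h d a = 1" "h e a = 1" "h c b = 1" "h d b = 1" "h e b = 1"
    "h d c = 1" "h e c = 1" "h e d = 1" using assms h_one_sym by blast+
  moreover from this have "distinct [a, b, c, d, e]" using assms by auto
  ultimately show ?thesis unfolding frame_def using assms by (auto simp: add.assoc)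
qed

lemma frame_simps:
  assumes "frame {a, b, c, d, e}" "distinct [a, b, c, d, e]"
  shows "a + b + c + d + e = 0"
    "h a a = 0" "h b b = 0" "h c c = 0" "h d d = 0" "h e e = 0"
    "h a b = 1" "h a c = 1" "h a d = 1" "h a e = 1" "h b c = 1" "h b d = 1" "h b e = 1"
    "h c d = 1" "h c e = 1" "h d e = 1"
    "h b a = 1" "h c a = 1" "h d a = 1" "h e a = 1" "h c b = 1" "h d b = 1" "h e b = 1"
    "h d c = 1" "h e c = 1" "h e d = 1"
    "a \<noteq> 0" "b \<noteq> 0" "c \<noteq> 0" "d \<noteq> 0" "e \<noteq> 0"
proof -
  show "a + b + c + d + e = 0" using frame_sum[OF assms(1)] assms(2) by (auto simp: add.assoc)
  have *: "h x y = (if x = y then 0 else 1)" if "x \<in> {a, b, c, d, e}" "y \<in> {a, b, c, d, e}" for x y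
    by (rule frame_h[OF assms(1) that])
  show "h a a = 0" "h b b = 0" "h c c = 0" "h d d = 0" "h e e = 0"
    "h a b = 1" "h a c = 1" "h a d = 1" "h a e = 1" "h b c = 1" "h b d = 1" "h b e = 1"
    "h c d = 1" "h c e = 1" "h d e = 1"
    "h b a = 1" "h c a = 1" "h d a = 1" "h e a = 1" "h c b = 1" "h d b = 1" "h e b = 1"
    "h d c = 1" "h e c = 1" "h e d = 1"
    using assms(2) by (auto simp: *)
  then show "a \<noteq> 0" "b \<noteq> 0" "c \<noteq> 0" "d \<noteq> 0" "e \<noteq> 0" by auto
qed

section \<open>The binary lattice of a frame\<close>

lemma lattice_add: "u \<in> lattice B \<Longrightarrow> v \<in> lattice B \<Longrightarrow> u + v \<in> lattice B"
  unfolding lattice_def by fastforce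

lemma lattice_zero: "0 \<in> lattice B"
  unfolding lattice_def by simp

lemma frame_subset_lattice: "frame B \<Longrightarrow> B \<subseteq> lattice B"
  by (auto simp: lattice_def frame_h split: if_splits)

lemma frame_elem_nonzero: "frame B \<Longrightarrow> x \<in> B \<Longrightarrow> x \<noteq> 0"
  using frame_h frame_ex1 by (metis h_zero_left zero_neq_one)

text \<open>By \<open>frame_sum_h\<close> the five values of a lattice vector form a word of even
  weight. A sum of two frame vectors has its ones at these two, a single frame vector at the other
  four; together with 0 this exhausts the 16 words. The eight with value 0 at a are listed here, the
  others in the next lemma.\<close>

lemma lattice_ortho_cases:
  assumes "frame {a, b, c, d, e}" "distinct [a, b, c, d, e]" "v \<in> lattice {a, b, c, d, e}" "h v a = 0"
  shows "v \<in> {0, a, b + c, b + d, b + e, c + d, c + e, d + e}"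
proof -
  note f = frame_simps[OF assms(1,2)]
  have s: "h v b + (h v c + (h v d + h v e)) = 0"
    using frame_sum_h[OF assms(1), of v] assms(2,4) by simp
  have ext: "v = u" if "h v a = h u a" "h v b = h u b" "h v c = h u c" "h v d = h u d" "h v e = h u e" for u
    by (rule frame_ext[OF assms(1)]) (use that in auto)
  have "h v b = 0 \<or> h v b = 1" "h v c = 0 \<or> h v c = 1" "h v d = 0 \<or> h v d = 1" "h v e = 0 \<or> h v e = 1"
    using assms(3) by (auto simp: lattice_def)
  then show ?thesis
    using s ext[of 0] ext[of a] ext[of "b+c"] ext[of "b+d"] ext[of "b+e"] ext[of "c+d"] ext[of "c+e"] ext[of "d+e"]
    by (elim disjE) (simp_all add: f assms(4))
qed

lemma lattice_nonortho_cases: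
  assumes "frame {a, b, c, d, e}" "distinct [a, b, c, d, e]" "v \<in> lattice {a, b, c, d, e}" "h v a = 1"
  shows "v \<in> {b, c, d, e, a + b, a + c, a + d, a + e}"
proof -
  note f = frame_simps[OF assms(1,2)]
  have s: "1 + (h v b + (h v c + (h v d + h v e))) = 0"
    using frame_sum_h[OF assms(1), of v] assms(2,4) by simp
  have ext: "v = u" if "h v a = h u a" "h v b = h u b" "h v c = h u c" "h v d = h u d" "h v e = h u e" for u
    by (rule frame_ext[OF assms(1)]) (use that in auto)
  have "h v b = 0 \<or> h v b = 1" "h v c = 0 \<or> h v c = 1" "h v d = 0 \<or> h v d = 1" "h v e = 0 \<or> h v e = 1"
    using assms(3) by (auto simp: lattice_def)
  then show ?thesis
    using s ext[of b] ext[of c] ext[of d] ext[of e] ext[of "a+b"] ext[of "a+c"] ext[of "a+d"] ext[of "a+e"]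
    by (elim disjE) (simp_all add: f assms(4))
qed

text \<open>The vector v is 0, a frame vector or a sum of two, and u has values in F_2 on B. So h
  restricts to an F_2-valued form on the lattice.\<close>

lemma lattice_h:
  assumes "frame B" "u \<in> lattice B" "v \<in> lattice B"
  shows "h u v = 0 \<or> h u v = 1"
proof -
  obtain a b c d e where B: "B = {a, b, c, d, e}" "distinct [a, b, c, d, e]"
    using frame_obtain[OF assms(1)] .
  have uB: "h u x = 0 \<or> h u x = 1" if "x \<in> B" for x using assms(2) that by (auto simp: lattice_def)
  have add: "h u (x + y) = 0 \<or> h u (x + y) = 1" if "x \<in> B" "y \<in> B" for x y
    using uB[OF that(1)] uB[OF that(2)] by auto
  have "h v a = 0 \<or> h v a = 1" using assms(3) B by (auto simp: lattice_def)
  then consider "v \<in> {0, a, b + c, b + d, b + e, c + d, c + e, d + e}"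
    | "v \<in> {b, c, d, e, a + b, a + c, a + d, a + e}"
    using lattice_ortho_cases[of a b c d e v] lattice_nonortho_cases[of a b c d e v] assms B by blast
  then show ?thesis
  proof cases
    case 1
    have "h u 0 = 0" "a \<in> B" "b \<in> B" "c \<in> B" "d \<in> B" "e \<in> B" by (simp_all add: B(1))
    with 1 show ?thesis using uB add by blast
  next
    case 2
    have "a \<in> B" "b \<in> B" "c \<in> B" "d \<in> B" "e \<in> B" by (simp_all add: B(1))
    with 2 show ?thesis using uB add by blast
  qed
qed

text \<open>Some value of u on B is 1, and scaling turns it into c. Hence a projective point
  contains at most one nonzero lattice vector, and points can be counted as vectors.\<close>

lemma lattice_scalar:
  assumes "frame B" "u \<in> lattice B" "c *s u \<in> lattice B" "u \<noteq> 0" "c \<noteq> 0"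
  shows "c = 1"
proof -
  obtain b where "b \<in> B" "h u b \<noteq> 0"
    using frame_ext[OF assms(1), of u 0] assms(4) by auto
  then have "h u b = 1" using assms(2) by (auto simp: lattice_def)
  then show ?thesis using assms(3,5) \<open>b \<in> B\<close> by (auto simp: lattice_def)
qed

lemma pt_eq_lattice:
  assumes "frame B" "u \<in> lattice B" "v \<in> lattice B" "u \<noteq> 0" "pt u = pt v"
  shows "u = v"
proof -
  obtain c where "c \<noteq> 0" "u = c *s v" using assms(4,5) pt_eq_iff by blast
  then show ?thesis using lattice_scalar[of B v c] assms by auto
qed

lemma inj_on_pt: "frame B \<Longrightarrow> inj_on pt (lattice B - {0})"
  by (auto intro!: inj_onI pt_eq_lattice)

lemma card_frame_points: "frame B \<Longrightarrow> card (frame_points B) = 5"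
proof -
  assume "frame B"
  then have "inj_on pt B"
    using frame_subset_lattice frame_elem_nonzero by (intro inj_on_subset[OF inj_on_pt]) blast+
  then show ?thesis using \<open>frame B\<close> by (simp add: frame_points_def card_image frame_card)
qed

lemma frame_eq_iff:
  assumes "frame {a, b, c, d, e}"
  shows "u = v \<longleftrightarrow> h u a = h v a \<and> h u b = h v b \<and> h u c = h v c \<and> h u d = h v d \<and> h u e = h v e"
  using frame_ext[OF assms] by auto

lemma lattice_ortho2_cases:
  assumes "frame {a, b, c, d, e}" "distinct [a, b, c, d, e]" "v \<in> lattice {a, b, c, d, e}"
    "h v a = 0" "h v b = 0"
  shows "v \<in> {0, c + d, c + e, d + e}"
  using lattice_ortho_cases[OF assms(1-4)] assms(5) frame_simps[OF assms(1,2)] by auto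

text \<open>Multiplication by c preserves h because c * c^2 = 1. Passing to a multiple lets a common
  point become a common vector.\<close>

lemma frame_scale:
  assumes "frame B" "c \<noteq> 0"
  shows "frame ((*s) c ` B)" "frame_points ((*s) c ` B) = frame_points B"
    "lattice_points ((*s) c ` B) = lattice_points B"
proof -
  have inj: "inj_on ((*s) c) B" using assms(2) by (auto intro!: inj_onI)
  have pt: "pt (c *s v) = pt v" for v
  proof (cases "v = 0")
    case False
    then show ?thesis using pt_eq_iff[of "c *s v" v] assms(2) by auto
  qed simp
  have "\<Sum>((*s) c ` B) = c *s \<Sum>B"
    using inj by (simp add: sum.reindex vec.scale_sum_right)
  then show "frame ((*s) c ` B)"
    using assms inj by (auto simp: frame_def card_image mult.assoc[symmetric])
  show "frame_points ((*s) c ` B) = frame_points B"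
    by (simp add: frame_points_def image_image pt)
  have "lattice ((*s) c ` B) = (*s) c ` lattice B"
  proof (intro equalityI subsetI)
    fix v assume "v \<in> lattice ((*s) c ` B)"
    then have "c\<^sup>2 *s v \<in> lattice B" by (auto simp: lattice_def)
    moreover have "v = c *s (c\<^sup>2 *s v)" using assms(2) by simp
    ultimately show "v \<in> (*s) c ` lattice B" by blast
  next
    fix v assume "v \<in> (*s) c ` lattice B"
    then show "v \<in> lattice ((*s) c ` B)" using assms(2) by (auto simp: lattice_def mult.assoc[symmetric])
  qed
  then have "lattice ((*s) c ` B) - {0} = (*s) c ` (lattice B - {0})" using assms(2) by auto
  then show "lattice_points ((*s) c ` B) = lattice_points B"
    by (simp only: lattice_points_def image_image pt)
qed

section \<open>Neighbours of a frame\<close>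

definition adjacent_frames :: "('f ^ 4) set \<Rightarrow> ('f ^ 4) set \<Rightarrow> bool" where
  "adjacent_frames B B' \<longleftrightarrow>
     card (frame_points B \<inter> frame_points B') = 1 \<and> card (lattice_points B \<inter> lattice_points B') = 6"

text \<open>For w = 1 the relation x + y + z + s + t = 0 turns this into x, x + y, x + z, x + s, x +
  t, another frame of the same lattice. For nonzero w it is the image of that frame under the
  isometry that is the identity on the span of x and y and multiplication by w on the orthogonal
  complement, where the sums s + t lie.\<close>

definition neighbour :: "('f ^ 4) set \<Rightarrow> 'f ^ 4 \<Rightarrow> 'f ^ 4 \<Rightarrow> 'f \<Rightarrow> ('f ^ 4) set" where
  "neighbour B x y w =
     {x, x + y} \<union> {y + w *s (s + t) | s t. s \<in> B - {x, y} \<and> t \<in> B - {x, y} \<and> s \<noteq> t}"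

lemma neighbour_eq:
  assumes "B = {x, y, z, s, t}" "distinct [x, y, z, s, t]"
  shows "neighbour B x y w = {x, x + y, y + w *s (z + s), y + w *s (z + t), y + w *s (s + t)}"
proof -
  have B: "B - {x, y} = {z, s, t}" using assms by auto
  let ?L = "{y + w *s (a + b) | a b. a \<in> {z, s, t} \<and> b \<in> {z, s, t} \<and> a \<noteq> b}"
  have "?L \<subseteq> {y + w *s (z + s), y + w *s (z + t), y + w *s (s + t)}"
    by (auto simp: add.commute)
  moreover have "y + w *s (z + s) \<in> ?L" "y + w *s (z + t) \<in> ?L" "y + w *s (s + t) \<in> ?L"
    using assms(2) by (force simp del: add_self_simps)+
  ultimately have L: "?L = {y + w *s (z + s), y + w *s (z + t), y + w *s (s + t)}" by blast
  then show ?thesis unfolding neighbour_def B L by (simp only: Un_insert_left Un_empty_left)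
qed

lemma frame_neighbour:
  assumes "frame B" "x \<in> B" "y \<in> B" "x \<noteq> y" "w \<noteq> 0"
  shows "frame (neighbour B x y w)"
proof -
  obtain z s t where B: "B = {x, y, z, s, t}" "distinct [x, y, z, s, t]"
    using frame_obtain2[OF assms(1-4)] .
  note f = frame_simps[OF assms(1)[unfolded B(1)] B(2)]
  show ?thesis unfolding neighbour_eq[OF B]
  proof (rule frameI)
    show "x + (x + y) + (y + w *s (z + s)) + (y + w *s (z + t)) + (y + w *s (s + t)) = 0"
      by (simp add: vec.scale_right_distrib add.commute add.left_commute)
  qed (use assms(5) in \<open>simp_all add: f add.commute add.left_commute distrib_left\<close>)
qed

text \<open>A vector of the new lattice is a + w b with a in the plane of x and y and b in its
  complement, both taken in the old lattice. If c times this vector is in the old lattice, products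
  with x and y force c = 1 unless a = 0, and products with z + s and z + t force c w = 1 unless b =
  0. As w is not 1, one of a and b vanishes.\<close>

lemma lattice_neighbour_cases:
  assumes "frame {x, y, z, s, t}" "distinct [x, y, z, s, t]" "w \<noteq> 0" "w \<noteq> 1"
    and u: "u \<in> lattice {x, y, z, s, t}" "u = c *s v" "u \<noteq> 0"
      "v \<in> lattice (neighbour {x, y, z, s, t} x y w)"
  shows "u \<in> {x, y, x + y, z + s, z + t, s + t}"
    "v \<in> {x, y, x + y, w *s (z + s), w *s (z + t), w *s (s + t)}"
proof -
  let ?m1 = "y + w *s (z + s)" and ?m2 = "y + w *s (z + t)" and ?m3 = "y + w *s (s + t)"
  note f = frame_simps[OF assms(1,2)]
  have N: "neighbour {x, y, z, s, t} x y w = {x, x + y, ?m1, ?m2, ?m3}"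
    using neighbour_eq[OF refl assms(2)] .
  have fN: "frame {x, x + y, ?m1, ?m2, ?m3}"
    using frame_neighbour[OF assms(1), of x y w] assms(2,3) N by simp
  have dN: "distinct [x, x + y, ?m1, ?m2, ?m3]" using frame_card[OF fN] by (auto simp: card_insert_if split: if_splits)
  have "h v x = 0 \<or> h v x = 1" using u(4) by (auto simp: N lattice_def)
  then have "v \<in> {0, x, (x + y) + ?m1, (x + y) + ?m2, (x + y) + ?m3, ?m1 + ?m2, ?m1 + ?m3, ?m2 + ?m3,
      x + y, ?m1, ?m2, ?m3, x + (x + y), x + ?m1, x + ?m2, x + ?m3}"
    using lattice_ortho_cases[OF fN dN, of v] lattice_nonortho_cases[OF fN dN, of v] u(4) N by auto
  then have "\<exists>a\<in>{0, x, y, x + y}. \<exists>b\<in>{0, z + s, z + t, s + t}. v = a + w *s b"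
    by (elim insertE emptyE) (simp_all add: vec.scale_right_distrib add.commute add.left_commute)
  then obtain a b where v: "v = a + w *s b" and a: "a \<in> {0, x, y, x + y}" and b: "b \<in> {0, z + s, z + t, s + t}"
    by blast
  have lat: "k \<in> lattice {x, y, z, s, t}" if "k \<in> {x, y, z, s, t}" for k
    using frame_subset_lattice[OF assms(1)] that by blast
  have hu: "h u k = 0 \<or> h u k = 1" if "k \<in> lattice {x, y, z, s, t}" for k
    using lattice_h[OF assms(1) u(1) that] .
  have c: "c \<noteq> 0" using u by auto
  have 1: "c = 1" if "a \<noteq> 0"
    using hu[OF lat, of x] hu[OF lat, of y] a b c that by (auto simp: u(2) v f)
  have 2: "c * w = 1" if "b \<noteq> 0"
    using hu[OF lattice_add[OF lat lat], of z s] hu[OF lattice_add[OF lat lat], of z t] a b c that assms(3)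
    by (auto simp: u(2) v f distrib_left add.commute add.left_commute)
  show "u \<in> {x, y, x + y, z + s, z + t, s + t}"
    "v \<in> {x, y, x + y, w *s (z + s), w *s (z + t), w *s (s + t)}"
    using a b 1 2 assms(4) u(2,3) v by (cases "a = 0"; cases "b = 0"; auto)+
qed

lemma neighbour_adjacent:
  assumes "frame B" "x \<in> B" "y \<in> B" "x \<noteq> y" "w \<noteq> 0" "w \<noteq> 1"
  shows "adjacent_frames B (neighbour B x y w)"
proof -
  obtain z s t where B: "B = {x, y, z, s, t}" "distinct [x, y, z, s, t]"
    using frame_obtain2[OF assms(1-4)] .
  note F = assms(1)[unfolded B(1)]
  note f = frame_simps[OF F B(2)]
  let ?N = "neighbour B x y w"
  have fN: "frame ?N" using frame_neighbour assms by blast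
  note NC = lattice_neighbour_cases[OF F B(2) assms(5,6), folded B(1)]
  have N: "?N = {x, x + y, y + w *s (z + s), y + w *s (z + t), y + w *s (s + t)}"
    using neighbour_eq[OF B] .
  have BL: "x \<in> lattice B" "y \<in> lattice B" "z \<in> lattice B" "s \<in> lattice B" "t \<in> lattice B"
    using frame_subset_lattice[OF assms(1)] B(1) by auto
  let ?S = "{x, y, x + y, z + s, z + t, s + t}"
  have S: "?S \<subseteq> lattice B - {0}"
    using BL B(2) f lattice_add by auto
  \<comment> \<open>The plane of x and y is common as it stands, its complement only after
    multiplication by w. These are the 3 + 3 common points.\<close>
  have SN: "\<exists>c v. c \<noteq> 0 \<and> v \<in> lattice ?N \<and> u = c *s v" if "u \<in> ?S" for u
  proof (cases "u \<in> {x, y, x + y}")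
    case True
    then have "u \<in> lattice ?N"
      unfolding N lattice_def using assms(5) by (auto simp: f)
    then show ?thesis by (intro exI[of _ 1] exI[of _ u]) simp
  next
    case False
    then have "w *s u \<in> lattice ?N"
      unfolding N lattice_def using assms(5) that by (auto simp: f)
    then show ?thesis using assms(5) by (intro exI[of _ "inverse w"] exI[of _ "w *s u"]) simp
  qed
  have "lattice_points B \<inter> lattice_points ?N = pt ` ?S"
  proof (intro equalityI subsetI)
    fix P assume "P \<in> lattice_points B \<inter> lattice_points ?N"
    then obtain u v where u: "P = pt u" "u \<in> lattice B" "u \<noteq> 0" and v: "P = pt v" "v \<in> lattice ?N"
      unfolding lattice_points_def by blast
    then obtain c where "u = c *s v" using pt_eq_iff[of u v] by auto
    then have "u \<in> ?S"
      using NC(1) u v(2) by blast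
    then show "P \<in> pt ` ?S" using u(1) by blast
  next
    fix P assume "P \<in> pt ` ?S"
    then obtain u where u: "u \<in> ?S" "P = pt u" by blast
    then obtain c v where cv: "c \<noteq> 0" "v \<in> lattice ?N" "u = c *s v" using SN by blast
    have u0: "u \<in> lattice B - {0}" using S u(1) by blast
    then have "P = pt v" using pt_eq_iff[of u v] cv u(2) by auto
    moreover have "v \<noteq> 0" using u0 cv(3) by auto
    ultimately show "P \<in> lattice_points B \<inter> lattice_points ?N"
      unfolding lattice_points_def using cv(2) u0 u(2) by blast
  qed
  moreover have "card (pt ` ?S) = card ?S"
    using inj_on_subset[OF inj_on_pt[OF assms(1)] S] by (rule card_image)
  moreover have "card ?S = 6"
    using B(2) by (simp add: frame_eq_iff[OF F] f card_insert_if)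
  ultimately have 6: "card (lattice_points B \<inter> lattice_points ?N) = 6" by simp
  have "frame_points B \<inter> frame_points ?N = {pt x}"
  proof (intro equalityI subsetI)
    fix P assume "P \<in> frame_points B \<inter> frame_points ?N"
    then obtain u v where u: "P = pt u" "u \<in> B" and v: "P = pt v" "v \<in> ?N"
      unfolding frame_points_def by blast
    have u0: "u \<noteq> 0" "u \<in> lattice B" using frame_elem_nonzero frame_subset_lattice assms(1) u(2) by blast+
    have vN: "v \<in> lattice ?N" using frame_subset_lattice[OF fN] v(2) by blast
    obtain c where c: "c \<noteq> 0" "u = c *s v" using pt_eq_iff[of u v] u0 u v by auto
    have "v \<in> {x, y, x + y, w *s (z + s), w *s (z + t), w *s (s + t)}"
      using NC(2) u0 vN c by blast
    then have "v = x \<or> v = x + y"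
      using v(2) assms(5) unfolding N
      by (elim insertE emptyE) (simp_all add: frame_eq_iff[OF F] f)
    moreover have "v \<noteq> x + y"
    proof
      assume "v = x + y"
      \<comment> \<open>A frame vector has exactly one zero among its values on B, whereas a
        multiple of x + y vanishes at both z and s.\<close>
      then have "h u x = c" "h u y = c" "h u z = 0" "h u s = 0" by (simp_all add: c(2) f)
      then show False using u(2) c(1) f unfolding B(1) by auto
    qed
    ultimately have "v = x" by blast
    then show "P \<in> {pt x}" using v by simp
  next
    fix P assume "P \<in> {pt x}"
    moreover have "x \<in> ?N" unfolding N by simp
    ultimately show "P \<in> frame_points B \<inter> frame_points ?N"
      unfolding frame_points_def using assms(2) by blast
  qed
  then have "card (frame_points B \<inter> frame_points ?N) = 1" by simp
  with 6 show ?thesis by (simp add: adjacent_frames_def)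
qed

text \<open>Such a set is a vector space over F_2. Spelling out the dimensions up to 2 suffices: the
  number of nonzero elements is 0, 1, 3 or at least 7, and the total to be reached is 6.\<close>

lemma xor_subgroup_cases:
  assumes "0 \<in> A" "finite A" "\<And>u v. u \<in> A \<Longrightarrow> v \<in> A \<Longrightarrow> u + v \<in> (A :: ('f ^ 4) set)"
  obtains "A = {0}" | a where "a \<noteq> 0" "A = {0, a}"
  | a b where "a \<noteq> 0" "b \<noteq> 0" "a \<noteq> b" "A = {0, a, b, a + b}"
  | "card A \<ge> 8"
proof (cases "A = {0}")
  case False
  with assms(1) obtain a where a: "a \<in> A" "a \<noteq> 0" by blast
  show ?thesis
  proof (cases "A = {0, a}")
    case False
    with a assms(1) obtain b where b: "b \<in> A" "b \<noteq> 0" "b \<noteq> a" by blast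
    define S where "S = {0, a, b, a + b}"
    have S: "S \<subseteq> A" using a b assms by (auto simp: S_def)
    have card_S: "finite S" "card S = 4" using a b by (auto simp: S_def)
    have closed: "u + v \<in> S" if "u \<in> S" "v \<in> S" for u v
      using that unfolding S_def
      by (elim insertE emptyE) (simp_all add: add.commute add.left_commute)
    show ?thesis
    proof (cases "A = S")
      case False
      with S obtain c where c: "c \<in> A" "c \<notin> S" by blast
      have "S \<inter> (\<lambda>u. u + c) ` S = {}"
      proof (rule ccontr)
        assume "S \<inter> (\<lambda>u. u + c) ` S \<noteq> {}"
        then obtain u where "u \<in> S" "u + c \<in> S" by blast
        then have "u + (u + c) \<in> S" by (rule closed)
        with c(2) show False by simp
      qed
      moreover have "card ((\<lambda>u. u + c) ` S) = card S" by (rule card_image) (auto intro!: inj_onI)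
      ultimately have "card (S \<union> (\<lambda>u. u + c) ` S) = 8" by (subst card_Un_disjoint) (simp_all add: card_S)
      moreover have "S \<union> (\<lambda>u. u + c) ` S \<subseteq> A" using S c(1) assms(3) by blast
      ultimately have "card A \<ge> 8" using assms(2) by (metis card_mono)
      then show ?thesis using that by blast
    qed (use a b that S_def in blast)
  qed (use a that in blast)
qed (use that in blast)

text \<open>The common points are sorted by the scalar c with u = c *s v into groups I c. Two groups
  have order 4: the one for c = 1, which contains x, and one for a scalar outside F_2. Their
  orthogonality locates them inside the lattice of B, and then the vectors of B' are forced.\<close>

lemma adjacent_frames_eq_neighbour:
  assumes "frame B" "frame B'" "x \<in> B" "x \<in> B'" "adjacent_frames B B'"
  obtains y w where "y \<in> B" "y \<noteq> x" "w \<noteq> 0" "w \<noteq> 1" "B' = neighbour B x y w"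
proof -
  define I where "I c = {u \<in> lattice B. \<exists>v\<in>lattice B'. u = c *s v}" for c
  obtain \<omega> where \<omega>: "\<omega> \<noteq> (0::'f)" "\<omega> \<noteq> 1" using ex_primitive by blast
  have I0: "0 \<in> I c" for c
    unfolding I_def using lattice_zero by (auto intro!: bexI[of _ 0])
  have Iadd: "u + v \<in> I c" if "u \<in> I c" "v \<in> I c" for u v c
    using that unfolding I_def by (auto simp: lattice_add vec.scale_right_distrib[symmetric] simp del: vec.scale_right_distrib)
  \<comment> \<open>A nonzero vector in two groups would give two nonzero vectors of the lattice of
    B' that differ by a scalar other than 1.\<close>
  have disj: "u = 0" if "u \<in> I c" "u \<in> I d" "c \<noteq> 0" "d \<noteq> 0" "c \<noteq> d" for u c d
  proof (rule ccontr)
    assume "u \<noteq> 0"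
    from that obtain v v' where v: "v \<in> lattice B'" "v' \<in> lattice B'" "u = c *s v" "u = d *s v'"
      unfolding I_def by blast
    then have "v' = (inverse d * c) *s v" using that(4) by (metis left_inverse vec.scale_one vec.scale_scale)
    moreover have "v \<noteq> 0" using v \<open>u \<noteq> 0\<close> by auto
    ultimately have "inverse d * c = 1"
      using lattice_scalar[OF assms(2) v(1)] v(2) that(3,4) by auto
    then show False using that(4,5) by (metis inverse_unique mult.commute inverse_inverse_eq)
  qed
  have w1: "\<omega> + 1 \<noteq> 0" "\<omega> + 1 \<noteq> 1" "\<omega> + 1 \<noteq> \<omega>" using \<omega> by auto
  have "lattice_points B \<inter> lattice_points B' = pt ` ((I 1 - {0}) \<union> ((I \<omega> - {0}) \<union> (I (\<omega> + 1) - {0})))"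
  proof (intro equalityI subsetI)
    fix P assume "P \<in> lattice_points B \<inter> lattice_points B'"
    then obtain u v where u: "P = pt u" "u \<in> lattice B" "u \<noteq> 0" and v: "P = pt v" "v \<in> lattice B'"
      unfolding lattice_points_def by blast
    then obtain c where c: "c \<noteq> 0" "u = c *s v" using pt_eq_iff[of u v] by auto
    have "u \<in> I c" unfolding I_def using u v c by blast
    then show "P \<in> pt ` ((I 1 - {0}) \<union> ((I \<omega> - {0}) \<union> (I (\<omega> + 1) - {0})))"
      using cases_01[OF \<omega>, of c] c(1) u by blast
  next
    fix P assume "P \<in> pt ` ((I 1 - {0}) \<union> ((I \<omega> - {0}) \<union> (I (\<omega> + 1) - {0})))"
    then obtain u where u: "P = pt u" "u \<noteq> 0" "u \<in> I 1 \<or> u \<in> I \<omega> \<or> u \<in> I (\<omega> + 1)" by blast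
    then obtain c where c: "u \<in> I c" "c \<noteq> 0" using \<omega>(1) w1(1) by (metis zero_neq_one)
    then obtain v where v: "u = c *s v" "v \<in> lattice B'" "u \<in> lattice B" unfolding I_def by blast
    then have "P = pt v" "v \<noteq> 0" using u c pt_eq_iff[of u v] by auto
    then show "P \<in> lattice_points B \<inter> lattice_points B'"
      unfolding lattice_points_def using u v by blast
  qed
  moreover have "inj_on pt ((I 1 - {0}) \<union> ((I \<omega> - {0}) \<union> (I (\<omega> + 1) - {0})))"
    by (rule inj_on_subset[OF inj_on_pt[OF assms(1)]]) (auto simp: I_def)
  ultimately have "card ((I 1 - {0}) \<union> ((I \<omega> - {0}) \<union> (I (\<omega> + 1) - {0}))) = 6"
    using assms(5) by (simp add: adjacent_frames_def card_image)
  moreover have "card ((I 1 - {0}) \<union> ((I \<omega> - {0}) \<union> (I (\<omega> + 1) - {0})))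
      = card (I 1 - {0}) + (card (I \<omega> - {0}) + card (I (\<omega> + 1) - {0}))"
    using disj \<omega> w1
    by (subst card_Un_disjoint, use finite_vectors in blast, use finite_vectors in blast, fastforce)
      (subst card_Un_disjoint, use finite_vectors in blast, use finite_vectors in blast, fastforce+)
  ultimately have sum6: "card (I 1 - {0}) + (card (I \<omega> - {0}) + card (I (\<omega> + 1) - {0})) = 6" by simp
  have card_I: "card (I c - {0}) = 0 \<or> card (I c - {0}) = 1 \<or> card (I c - {0}) \<ge> 7 \<or>
     (card (I c - {0}) = 3 \<and> (\<exists>a b. a \<noteq> 0 \<and> b \<noteq> 0 \<and> a \<noteq> b \<and> I c = {0, a, b, a + b}))" for c
  proof (rule xor_subgroup_cases[OF I0 finite_vectors Iadd, of c])
    fix a b :: "'f ^ 4" assume ab: "a \<noteq> 0" "b \<noteq> 0" "a \<noteq> b" "I c = {0, a, b, a + b}"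
    have "{0, a, b, a + b} - {0} = {a, b, a + b}" using ab by auto
    then have "card (I c - {0}) = 3" using ab by (auto simp: card_insert_if)
    then show ?thesis using ab by blast
  next
    assume "8 \<le> card (I c)"
    then have "card (I c - {0}) \<ge> 7" using I0 finite_vectors by (simp add: card_Diff_subset)
    then show ?thesis by blast
  qed auto
  have x1: "x \<in> I 1" "x \<noteq> 0"
    using assms frame_subset_lattice frame_elem_nonzero unfolding I_def by (auto intro!: bexI[of _ x])
  then have "x \<in> I 1 - {0}" by simp
  then have "card (I 1 - {0}) \<noteq> 0" using finite_vectors card_0_eq by blast
  \<comment> \<open>Each summand is 0, 1, 3 or at least 7 and the total is 6, so two summands are 3;
    the first is positive and hence one of them.\<close>
  then have "card (I 1 - {0}) = 3 \<and> (card (I \<omega> - {0}) = 3 \<or> card (I (\<omega> + 1) - {0}) = 3)"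
    using sum6 card_I[of 1] card_I[of \<omega>] card_I[of "\<omega> + 1"] by arith
  then obtain c where c: "c \<noteq> 0" "c \<noteq> 1" "card (I 1 - {0}) = 3" "card (I c - {0}) = 3"
    using \<omega> w1 by blast
  then obtain a b p q where ab: "a \<noteq> 0" "b \<noteq> 0" "a \<noteq> b" "I 1 = {0, a, b, a + b}"
    and pq: "p \<noteq> 0" "q \<noteq> 0" "p \<noteq> q" "I c = {0, p, q, p + q}"
    using card_I[of 1] card_I[of c] by auto
  obtain z where z: "z \<noteq> 0" "z \<noteq> x" "I 1 = {0, x, z, x + z}"
  proof -
    have "x = a \<or> x = b \<or> x = a + b" using x1 ab by auto
    then show ?thesis
    proof (elim disjE)
      assume "x = a" then show ?thesis using ab that[of b] by auto
    next
      assume "x = b" then show ?thesis using ab that[of a] by (auto simp: add.commute)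
    next
      assume "x = a + b" then show ?thesis using ab that[of a] by (auto simp: add.commute add.left_commute)
    qed
  qed
  \<comment> \<open>With u' = c *s v, both h u v and h u u' = c^2 * h u v lie in F_2, but c^2 does
    not. So both vanish.\<close>
  have perp: "h u u' = 0" if "u \<in> I 1" "u' \<in> I c" for u u'
  proof -
    from that(2) obtain v where v: "v \<in> lattice B'" "u' = c *s v" unfolding I_def by blast
    have u: "u \<in> lattice B" "u \<in> lattice B'" "u' \<in> lattice B" using that unfolding I_def by auto
    have "h u v = 0 \<or> h u v = 1" "h u u' = 0 \<or> h u u' = 1"
      using lattice_h assms(1,2) u v by blast+
    then show ?thesis using v(2) c(1,2) by auto
  qed
  have IB: "I d \<subseteq> lattice B" for d unfolding I_def by blast
  have "\<exists>y\<in>B. y \<noteq> x \<and> I 1 = {0, x, y, x + y}"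
  proof -
    obtain b c' d e where B: "B = {x, b, c', d, e}" "distinct [x, b, c', d, e]"
      using frame_obtain1[OF assms(1,3)] .
    note F = assms(1)[unfolded B(1)]
    note f = frame_simps[OF F B(2)]
    have zB: "z \<in> lattice {x, b, c', d, e}" using z(3) IB[of 1] B(1) by blast
    have pB: "p \<in> lattice {x, b, c', d, e}" using pq(4) IB[of c] B(1) by blast
    have "h z x = 0 \<or> h z x = 1" using zB by (auto simp: lattice_def)
    then show ?thesis
    proof
      \<comment> \<open>If z were orthogonal to x, I 1 would be a totally isotropic plane and so its
        own orthogonal complement in the lattice. The vector p, orthogonal to it, would then lie in
        it, though the two groups share only 0.\<close>
      assume zx: "h z x = 0"
      have px: "h x p = 0" "h z p = 0" using perp z(3) pq(4) by auto
      have pz: "h p x = 0" "h p z = 0" using px h_zero_sym by blast+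
      have "p \<in> {0, x, z, x + z}"
        using lattice_ortho_cases[OF F B(2) zB zx] lattice_ortho_cases[OF F B(2) pB pz(1)] pz(2) z(1,2)
        by (elim insertE emptyE) (simp_all add: f frame_eq_iff[OF F])
      then have "p \<in> I 1" using z(3) by simp
      then have "p = 0" using disj[of p 1 c] pq(4) c by auto
      then show ?thesis using pq(1) by simp
    next
      assume zx: "h z x = 1"
      obtain y0 where y0: "y0 \<in> {b, c', d, e}" "z = y0 \<or> z = x + y0"
        using lattice_nonortho_cases[OF F B(2) zB zx] by blast
      have "y0 \<in> B" "y0 \<noteq> x" using y0(1) B by auto
      moreover have "I 1 = {0, x, y0, x + y0}" unfolding z(3) using y0(2)
      proof
        assume "z = x + y0"
        then show "{0, x, z, x + z} = {0, x, y0, x + y0}" by (simp add: insert_commute[of y0])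
      qed simp
      ultimately show ?thesis by blast
    qed
  qed
  then obtain y where y: "y \<in> B" "y \<noteq> x" "I 1 = {0, x, y, x + y}" by blast
  obtain z s t where B: "B = {x, y, z, s, t}" "distinct [x, y, z, s, t]"
    using frame_obtain2[OF assms(1,3) y(1) y(2)[symmetric]] .
  note F = assms(1)[unfolded B(1)]
  note f = frame_simps[OF F B(2)]
  have "I c \<subseteq> {0, z + s, z + t, s + t}"
  proof
    fix v assume v: "v \<in> I c"
    then have "h x v = 0" "h y v = 0" using perp[of x v] perp[of y v] y(3) by auto
    then have "h v x = 0" "h v y = 0" using h_zero_sym by blast+
    moreover have "v \<in> lattice {x, y, z, s, t}" using v IB B(1) by blast
    ultimately show "v \<in> {0, z + s, z + t, s + t}"
      using lattice_ortho2_cases[OF F B(2)] by blast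
  qed
  moreover have "card (I c) = 4" using pq by (auto simp: card_insert_if)
  moreover have "card {0, z + s, z + t, s + t} \<le> 4" by (simp add: card_insert_if)
  ultimately have Ic: "I c = {0, z + s, z + t, s + t}"
    by (metis card_seteq finite_vectors)
  define w where "w = inverse c"
  have w: "w \<noteq> 0" "w \<noteq> 1" using c by (auto simp: w_def)
  have wI: "w *s u \<in> lattice B'" if "u \<in> I c" for u
    using that c(1) unfolding I_def w_def by auto
  have y': "y \<in> lattice B'" "x + y \<in> lattice B'" using y(3) unfolding I_def by auto
  \<comment> \<open>With y in B' there would be two common frame points. As a vector of the lattice
    of B' that is not orthogonal to x, y is then x + b for some b in B', and this b is x +
    y.\<close>
  have "y \<notin> B'"
  proof
    assume "y \<in> B'"
    then have sub: "{pt x, pt y} \<subseteq> frame_points B \<inter> frame_points B'"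
      using assms(3,4) y(1) by (auto simp: frame_points_def)
    have "pt x \<noteq> pt y"
      using pt_eq_lattice[OF assms(1), of x y] frame_subset_lattice[OF assms(1)] x1(2) y(1,2) assms(3) by blast
    then have "card {pt x, pt y} = 2" by simp
    moreover have "finite (frame_points B \<inter> frame_points B')"
      using frame_finite[OF assms(1)] by (simp add: frame_points_def)
    ultimately have "2 \<le> card (frame_points B \<inter> frame_points B')" using sub by (metis card_mono)
    then show False using assms(5) by (simp add: adjacent_frames_def)
  qed
  have xy: "x + y \<in> B'"
  proof -
    obtain b c' d e where B': "B' = {x, b, c', d, e}" "distinct [x, b, c', d, e]"
      using frame_obtain1[OF assms(2,4)] .
    note F' = assms(2)[unfolded B'(1)]
    have "y \<in> {b, c', d, e, x + b, x + c', x + d, x + e}"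
      using lattice_nonortho_cases[OF F' B'(2), of y] y'(1) f unfolding B'(1) by blast
    then show ?thesis using \<open>y \<notin> B'\<close> unfolding B'(1) by auto
  qed
  have "x \<noteq> x + y" using f by auto
  from frame_obtain2[OF assms(2,4) xy this] obtain u1 u2 u3 where B': "B' = {x, x + y, u1, u2, u3}" "distinct [x, x + y, u1, u2, u3]"
    .
  note F' = assms(2)[unfolded B'(1)]
  have u: "y = u1 + u2 + u3" using frame_simps(1)[OF F' B'(2)] by (simp add: add.assoc)
  \<comment> \<open>The vector w *s v is a sum of two of u1, u2, u3, and adding y = u1 + u2 + u3
    leaves the third.\<close>
  have mem: "y + w *s v \<in> B'" if "v \<in> {z + s, z + t, s + t}" for v
  proof -
    have "w *s v \<in> lattice {x, x + y, u1, u2, u3}" using wI[of v] that Ic B'(1) by auto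
    moreover have "h (w *s v) x = 0" "h (w *s v) (x + y) = 0" "w *s v \<noteq> 0"
      using that w B(2) by (auto simp: f)
    ultimately have "w *s v \<in> {u1 + u2, u1 + u3, u2 + u3}"
      using lattice_ortho2_cases[OF F' B'(2)] by blast
    then show ?thesis unfolding B'(1) u by (auto simp: add.commute add.left_commute)
  qed
  have "neighbour B x y w \<subseteq> B'"
    unfolding neighbour_eq[OF B] using mem[of "z + s"] mem[of "z + t"] mem[of "s + t"] xy assms(4) by auto
  moreover have "frame (neighbour B x y w)"
    using frame_neighbour assms(1,3) y(1,2) w(1) by blast
  ultimately have "B' = neighbour B x y w"
    using frame_card assms(2) frame_finite by (metis card_subset_eq)
  then show ?thesis using that y w by blast
qed

section \<open>Adjacency between neighbours of one frame\<close>

text \<open>The point is that w does not occur as a value. This asymmetry between w and 1 + w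
  prevents two neighbours with the same w from sharing a point through different vectors.\<close>

lemma neighbour_values:
  assumes "frame B" "x \<in> B" "y \<in> B" "x \<noteq> y" "u \<in> neighbour B x y w"
  shows "\<forall>b\<in>B. h u b \<in> {0, 1, 1 + w}" "\<exists>b\<in>B. h u b = 1"
proof -
  obtain z s t where B: "B = {x, y, z, s, t}" "distinct [x, y, z, s, t]"
    using frame_obtain2[OF assms(1-4)] .
  note f = frame_simps[OF assms(1)[unfolded B(1)] B(2)]
  show "\<forall>b\<in>B. h u b \<in> {0, 1, 1 + w}" "\<exists>b\<in>B. h u b = 1"
    using assms(5) unfolding neighbour_eq[OF B] unfolding B(1)
    by (elim insertE emptyE; simp add: f)+
qed

text \<open>If u = c *s u' then c is a value of u, so it is 1 or 1 + w. In the second case u' would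
  have the value w wherever u has the value 1, because (1 + w) * w = 1; but w does not
  occur.\<close>

lemma neighbour_common_vector:
  assumes "frame B" "x \<in> B" "y \<in> B" "x \<noteq> y" "x' \<in> B" "y' \<in> B" "x' \<noteq> y'"
    and "w \<noteq> 0" "w \<noteq> 1" "u \<in> neighbour B x y w" "u' \<in> neighbour B x' y' w" "pt u = pt u'"
  shows "u = u'"
proof -
  note v = neighbour_values[OF assms(1-4,10)] and v' = neighbour_values[OF assms(1,5-7,11)]
  have "u \<noteq> 0" using v(2) by auto
  then obtain c where c: "c \<noteq> 0" "u = c *s u'" using pt_eq_iff[of u u'] assms(12) by blast
  obtain b where b: "b \<in> B" "h u' b = 1" using v'(2) by blast
  have "h u b = c" using b c by simp
  then have "c = 1 \<or> c = 1 + w" using v(1) b(1) c(1) by auto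
  moreover have "c \<noteq> 1 + w"
  proof
    assume cw: "c = 1 + w"
    obtain k where k: "k \<in> B" "h u k = 1" using v(2) by blast
    then have "(1 + w) * h u' k = 1" using c cw by simp
    moreover have "h u' k \<in> {0, 1, 1 + w}" using v'(1) k(1) by blast
    ultimately show False
      using elements(2)[OF assms(8,9)] assms(8,9) by (auto simp: algebra_simps)
  qed
  ultimately show ?thesis using c by simp
qed

text \<open>A common point is a common vector p, and adjacency makes the second frame a neighbour of
  the first at p, so it contains p + q for another vector q of the first. The cases are the
  positions of x', y' relative to x, y. Either there is no common vector, or p is known and p + q is
  not in the second frame; equal and swapped pairs are excluded by counting points and by comparing
  lattices.\<close>

lemma neighbours_same_scalar_not_adjacent:
  assumes "frame B" "x \<in> B" "y \<in> B" "x \<noteq> y" "x' \<in> B" "y' \<in> B" "x' \<noteq> y'" "w \<noteq> 0" "w \<noteq> 1"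
  shows "\<not> adjacent_frames (neighbour B x y w) (neighbour B x' y' w)"
proof
  let ?N = "neighbour B x y w" and ?N' = "neighbour B x' y' w"
  assume adj: "adjacent_frames ?N ?N'"
  then have "card (frame_points ?N \<inter> frame_points ?N') = 1" by (simp add: adjacent_frames_def)
  then obtain P where "P \<in> frame_points ?N \<inter> frame_points ?N'" by (metis card_1_singletonE insertI1)
  then obtain p p' where "p \<in> ?N" "p' \<in> ?N'" "pt p = pt p'" by (auto simp: frame_points_def)
  then have p: "p \<in> ?N" "p \<in> ?N'" using neighbour_common_vector[OF assms] by blast+
  have fN: "frame ?N" "frame ?N'" using frame_neighbour assms by blast+
  obtain q k where q: "q \<in> ?N" "q \<noteq> p" "k \<noteq> 0" "k \<noteq> 1" "?N' = neighbour ?N p q k"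
    using adjacent_frames_eq_neighbour[OF fN p adj] .
  then have pq: "p + q \<in> ?N'" by (simp add: neighbour_def)
  have w1: "1 + w \<noteq> 0" "1 + w \<noteq> 1" "1 + w \<noteq> w" using assms(8,9) by auto
  consider (same) "x' = x" "y' = y" | (xx) "x' = x" "y' \<noteq> y" "y' \<noteq> x" | (swap) "x' = y" "y' = x"
    | (yy) "y' = y" "x' \<noteq> x" "x' \<noteq> y" | (xy) "y' = x" "x' \<noteq> x" "x' \<noteq> y"
    | (yx) "x' = y" "y' \<noteq> x" "y' \<noteq> y" | (disj) "distinct [x, y, x', y']"
    using assms(4,7) by auto
  then show False
  proof cases
    case same
    then show False using adj card_frame_points[OF fN(1)] by (simp add: adjacent_frames_def)
  next
    case xx
    obtain s t where B: "B = {x, y, y', s, t}" "distinct [x, y, y', s, t]"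
      using frame_obtain3[OF assms(1-3,6)] xx assms(4) by auto
    then have B': "B = {x, y', y, s, t}" "distinct [x, y', y, s, t]" by auto
    note F = assms(1)[unfolded B(1)]
    note f = frame_simps[OF F B(2)]
    note N = neighbour_eq[OF B, of w] and N' = neighbour_eq[OF B', of w]
    have "p = x" using p unfolding xx N N'
      using assms(8,9) w1 by (elim insertE emptyE; simp add: f frame_eq_iff[OF F])
    then show False using pq q(1,2) unfolding xx N N'
      using assms(8,9) w1 by (elim insertE emptyE; simp add: f frame_eq_iff[OF F])
  next
    case swap
    obtain z s t where B: "B = {x, y, z, s, t}" "distinct [x, y, z, s, t]"
      using frame_obtain2[OF assms(1-4)] .
    then have B': "B = {y, x, z, s, t}" "distinct [y, x, z, s, t]" by auto
    note N = neighbour_eq[OF B, of w] and N' = neighbour_eq[OF B', of w]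
    have add: "u + v \<in> lattice ?N" if "u \<in> ?N" "v \<in> ?N" for u v
      using frame_subset_lattice[OF fN(1)] lattice_add that by blast
    \<comment> \<open>With x and y swapped and the same w, both frames lie in one lattice: x + w *s
      (z + s) = (x + y) + (y + w *s (z + s)). A neighbour has vectors outside the lattice, since the
      product of q + k *s (r + r') with r is 1 + k.\<close>
    have "?N' \<subseteq> lattice ?N"
    proof
      fix v assume "v \<in> ?N'"
      moreover have "x + y \<in> ?N" "x \<in> ?N" "y + w *s (z + s) \<in> ?N" "y + w *s (z + t) \<in> ?N" "y + w *s (s + t) \<in> ?N"
        unfolding N by simp_all
      ultimately show "v \<in> lattice ?N"
        using add[of x "x + y"] add[of "x + y" "y + w *s (z + s)"] add[of "x + y" "y + w *s (z + t)"]
          add[of "x + y" "y + w *s (s + t)"] frame_subset_lattice[OF fN(1)]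
        unfolding swap N' by (auto simp: add.assoc add.commute[of y x])
    qed
    moreover obtain r r' r'' where r: "?N = {p, q, r, r', r''}" "distinct [p, q, r, r', r'']"
      using frame_obtain2[OF fN(1) p(1) q(1) q(2)[symmetric]] .
    moreover have "q + k *s (r + r') \<in> ?N'"
      unfolding q(5) neighbour_eq[OF r] by simp
    moreover have "r \<in> ?N" using r(1) by simp
    ultimately have "h (q + k *s (r + r')) r = 0 \<or> h (q + k *s (r + r')) r = 1"
      unfolding lattice_def by blast
    then show False using frame_simps[OF fN(1)[unfolded r(1)] r(2)] q(3,4) by auto
  next
    case yy
    obtain s t where B: "B = {x, y, x', s, t}" "distinct [x, y, x', s, t]"
      using frame_obtain3[OF assms(1-3,5)] yy assms(4) by auto
    then have B': "B = {x', y, x, s, t}" "distinct [x', y, x, s, t]" by auto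
    note F = assms(1)[unfolded B(1)]
    note f = frame_simps[OF F B(2)]
    note N = neighbour_eq[OF B, of w] and N' = neighbour_eq[OF B', of w]
    have "p = y + w *s (s + t)" using p unfolding yy N N'
      using assms(8,9) w1 by (elim insertE emptyE; simp add: f frame_eq_iff[OF F])
    then show False using pq q(1,2) unfolding yy N N'
      using assms(8,9) w1 by (elim insertE emptyE; simp add: f frame_eq_iff[OF F])
  next
    case xy
    obtain s t where B: "B = {x, y, x', s, t}" "distinct [x, y, x', s, t]"
      using frame_obtain3[OF assms(1-3,5)] xy assms(4) by auto
    then have B': "B = {x', x, y, s, t}" "distinct [x', x, y, s, t]" by auto
    note F = assms(1)[unfolded B(1)]
    note f = frame_simps[OF F B(2)]
    note N = neighbour_eq[OF B, of w] and N' = neighbour_eq[OF B', of w]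
    show False using p unfolding xy N N'
      using assms(8,9) w1 by (elim insertE emptyE; simp add: f frame_eq_iff[OF F])
  next
    case yx
    obtain s t where B: "B = {x, y, y', s, t}" "distinct [x, y, y', s, t]"
      using frame_obtain3[OF assms(1-3,6)] yx assms(4) by auto
    then have B': "B = {y, y', x, s, t}" "distinct [y, y', x, s, t]" by auto
    note F = assms(1)[unfolded B(1)]
    note f = frame_simps[OF F B(2)]
    note N = neighbour_eq[OF B, of w] and N' = neighbour_eq[OF B', of w]
    show False using p unfolding yx N N'
      using assms(8,9) w1 by (elim insertE emptyE; simp add: f frame_eq_iff[OF F])
  next
    case disj
    obtain z s t where B0: "B = {x, y, z, s, t}" "distinct [x, y, z, s, t]"
      using frame_obtain2[OF assms(1-4)] .
    have "x' \<in> {z, s, t}" "y' \<in> {z, s, t}" using B0(1) assms(5,6) disj by auto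
    then have "\<exists>r. B = {x, y, x', y', r} \<and> distinct [x, y, x', y', r]"
      using B0 disj by (elim insertE emptyE) auto
    then obtain r where B: "B = {x, y, x', y', r}" "distinct [x, y, x', y', r]" by blast
    then have B': "B = {x', y', x, y, r}" "distinct [x', y', x, y, r]" by auto
    note F = assms(1)[unfolded B(1)]
    note f = frame_simps[OF F B(2)]
    note N = neighbour_eq[OF B, of w] and N' = neighbour_eq[OF B', of w]
    show False using p unfolding N N'
      using assms(8,9) w1 by (elim insertE emptyE; simp add: f frame_eq_iff[OF F])
  qed
qed

text \<open>This completes an edge to a triangle: the frame is a neighbour of the first neighbour by
  one description and of B by the other. The scalar arises as w * w = w + 1, because the sums of two
  of the vectors y + w *s (s + t) already carry a factor w.\<close>

lemma neighbour_neighbour: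
  assumes "frame B" "x \<in> B" "y \<in> B" "x \<noteq> y" "w \<noteq> 0" "w \<noteq> 1"
  shows "neighbour (neighbour B x y w) (x + y) x w = neighbour B y x (w + 1)"
proof -
  obtain z s t where B: "B = {x, y, z, s, t}" "distinct [x, y, z, s, t]"
    using frame_obtain2[OF assms(1-4)] .
  then have B': "B = {y, x, z, s, t}" "distinct [y, x, z, s, t]" by auto
  have fN: "frame (neighbour B x y w)" using frame_neighbour assms by blast
  have N: "neighbour B x y w = {x + y, x, y + w *s (z + s), y + w *s (z + t), y + w *s (s + t)}"
    using neighbour_eq[OF B] by (simp add: insert_commute)
  have dN: "distinct [x + y, x, y + w *s (z + s), y + w *s (z + t), y + w *s (s + t)]"
    using frame_card[OF fN] unfolding N by (auto simp: card_insert_if split: if_splits)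
  have w: "w *s (w *s v) = (w + 1) *s v" for v :: "'f ^ 4"
    using elements(2)[OF assms(5,6)] by simp
  have "y + w *s (z + s) + (y + w *s (z + t)) = w *s (s + t)"
    "y + w *s (z + s) + (y + w *s (s + t)) = w *s (z + t)"
    "y + w *s (z + t) + (y + w *s (s + t)) = w *s (z + s)"
    by (simp_all add: vec.scale_right_distrib add.commute add.left_commute)
  then show ?thesis
    unfolding neighbour_eq[OF N dN] neighbour_eq[OF B'] w
    by (simp add: add.commute[of y x] add.assoc w del: vec.scale_left_distrib vec.scale_right_distrib vec.scale_scale) blast
qed

section \<open>Existence of frames\<close>

text \<open>Gram-Schmidt with isotropic vectors as the obstacle: after projecting off S there are
  two nonorthogonal vectors, and one of them or a suitable combination of both has product 1 with
  itself.\<close>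

lemma ex_orthonormal_extension:
  assumes "finite S" "card S < 4" "\<And>u v. u \<in> S \<Longrightarrow> v \<in> S \<Longrightarrow> h u v = (if u = v then 1 else 0)"
  shows "\<exists>v. h v v = 1 \<and> (\<forall>u\<in>S. h v u = 0 \<and> h u v = 0)"
proof -
  define proj where "proj v = v + (\<Sum>u\<in>S. h v u *s u)" for v
  have proj: "h (proj v) u = 0" if "u \<in> S" for u v
  proof -
    have "h (\<Sum>u\<in>S. h v u *s u) u = (\<Sum>u'\<in>S. if u' = u then h v u else 0)"
      unfolding h_sum_left by (rule sum.cong) (use assms(3) that in auto)
    then show ?thesis using that assms(1) by (simp add: proj_def)
  qed
  have "\<not> UNIV \<subseteq> vec.span S"
    using vec.dim_le_card[of UNIV S] assms(1,2) by (auto simp: card_cart_basis)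
  then obtain v0 where v0: "v0 \<notin> vec.span S" by blast
  have "(\<Sum>u\<in>S. h v u *s u) \<in> vec.span S" for v
    by (intro vec.span_sum vec.span_scale vec.span_base)
  then have "proj v0 \<noteq> 0" using v0 by (metis proj_def vadd_eq_0)
  then obtain u where u: "h u (proj v0) \<noteq> 0"
    using nondeg unfolding nondegenerate_form_def by blast
  \<comment> \<open>The vector \<open>proj v0\<close> is orthogonal to S, so changing u by a
    combination of S does not alter the product.\<close>
  have "h u (proj v0) = h (proj u) (proj v0)"
  proof -
    have "h (\<Sum>u'\<in>S. h u u' *s u') (proj v0) = 0"
      unfolding h_sum_left by (rule sum.neutral) (use proj h_zero_sym in auto)
    then show ?thesis by (simp add: proj_def[of u])
  qed
  with u have ab: "h (proj u) (proj v0) \<noteq> 0" by simp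
  let ?a = "proj u" and ?b = "proj v0"
  let ?c = "h ?a ?b"
  have sq: "h v v = 0 \<or> h v v = 1" for v using h_sym[of v v] square_fixed by metis
  obtain \<omega> where \<omega>: "\<omega> \<noteq> (0::'f)" "\<omega> \<noteq> 1" using ex_primitive by blast
  \<comment> \<open>The factor makes k * ?c equal to \<omega>, so for isotropic ?a and ?b the value
    h g g is the trace \<omega>^2 + \<omega> = 1.\<close>
  define k where "k = \<omega> * ?c\<^sup>2"
  define g where "g = k *s ?a + ?b"
  have "k * ?c = \<omega>" using ab by (simp add: k_def mult.assoc)
  then have "k\<^sup>2 * ?c\<^sup>2 = \<omega>\<^sup>2" by (simp add: power_mult_distrib[symmetric])
  have "\<exists>v\<in>{?a, ?b, g}. h v v = 1"
  proof (rule ccontr)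
    assume "\<not> ?thesis"
    then have 0: "h ?a ?a = 0" "h ?b ?b = 0" "h g g = 0"
      using sq by auto
    have "h ?b ?a = ?c\<^sup>2" by (rule h_sym)
    then have "h g g = k\<^sup>2 * ?c\<^sup>2 + k * ?c" using 0(1,2) by (simp add: g_def)
    then have "\<omega>\<^sup>2 + \<omega> = 0" using 0(3) \<open>k * ?c = \<omega>\<close> \<open>k\<^sup>2 * ?c\<^sup>2 = \<omega>\<^sup>2\<close> by simp
    then show False using \<omega> elements(2)[OF \<omega>] by (simp add: power2_eq_square)
  qed
  moreover have "h v k = 0 \<and> h k v = 0" if "k \<in> S" "v \<in> {?a, ?b, g}" for k v
  proof -
    have "h v k = 0" using that(2) proj[OF that(1)] by (auto simp: g_def)
    then show ?thesis using h_zero_sym by blast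
  qed
  ultimately show ?thesis by blast
qed

text \<open>Ensures that the graph has a vertex, so that the empty clique is not maximal. An
  orthonormal basis yields two orthogonal hyperbolic pairs; the five vectors then repeat the pattern
  of the singular vectors of an elliptic form: one pair, and its sum plus each nonzero combination
  of the other pair.\<close>

lemma ex_frame: "\<exists>B. frame B"
proof -
  have ex: "\<exists>S. finite S \<and> card S = n \<and> (\<forall>u\<in>S. \<forall>v\<in>S. h u v = (if u = v then 1 else 0))" if "n \<le> 4" for n
    using that
  proof (induction n)
    case 0
    show ?case by (intro exI[of _ "{}"]) simp
  next
    case (Suc n)
    then obtain S where S: "finite S" "card S = n" "\<forall>u\<in>S. \<forall>v\<in>S. h u v = (if u = v then 1 else 0)" by auto
    then obtain v where v: "h v v = 1" "\<forall>u\<in>S. h v u = 0 \<and> h u v = 0"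
      using ex_orthonormal_extension[of S] Suc.prems by auto
    then have "v \<notin> S" by auto
    then show ?case using S v by (intro exI[of _ "insert v S"]) auto
  qed
  obtain S where S: "card S = 4" "\<forall>u\<in>S. \<forall>v\<in>S. h u v = (if u = v then 1 else 0)" using ex[of 4] by auto
  obtain a b c d where abcd: "S = {a, b, c, d}" "distinct [a, b, c, d]"
    using S(1) by (auto simp: card_Suc_eq numeral_eq_Suc)
  obtain \<omega> where \<omega>: "\<omega> \<noteq> (0::'f)" "\<omega> \<noteq> 1" using ex_primitive by blast
  have e: "h a a = 1" "h b b = 1" "h c c = 1" "h d d = 1" "h a b = 0" "h a c = 0" "h a d = 0" "h b a = 0" "h b c = 0" "h b d = 0"
    "h c a = 0" "h c b = 0" "h c d = 0" "h d a = 0" "h d b = 0" "h d c = 0"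
    using S(2) abcd by auto
  \<comment> \<open>The norms of the coefficients \<omega> and \<omega> + 1 add up to 1 + 1 = 0, so
    u2 is isotropic; h u1 u2 is the sum of their conjugates, which is 1.\<close>
  define u1 u2 u3 u4 where "u1 = a + b" and "u2 = \<omega> *s a + (\<omega> + 1) *s b" and "u3 = c + d" and "u4 = \<omega> *s c + (\<omega> + 1) *s d"
  note u = u1_def u2_def u3_def u4_def
  have w: "\<omega> * \<omega> = \<omega> + 1" "(\<omega> + 1)\<^sup>2 = \<omega>" "(1 + \<omega>)\<^sup>2 = \<omega>" "\<omega>\<^sup>2 = \<omega> + 1"
    using elements(2)[OF \<omega>] by (simp_all add: power2_eq_square distrib_left distrib_right add.assoc)
  have "h u1 u1 = 0" "h u2 u2 = 0" "h u3 u3 = 0" "h u4 u4 = 0" "h u1 u2 = 1" "h u2 u1 = 1" "h u3 u4 = 1" "h u4 u3 = 1"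
    "h u1 u3 = 0" "h u1 u4 = 0" "h u2 u3 = 0" "h u2 u4 = 0" "h u3 u1 = 0" "h u4 u1 = 0" "h u3 u2 = 0" "h u4 u2 = 0"
    unfolding u by (simp_all add: e w distrib_left distrib_right add.commute add.left_commute)
  then have "frame {u1, u2, u1 + u2 + u3, u1 + u2 + u4, u1 + u2 + u3 + u4}"
    by (intro frameI) (simp_all add: add.commute add.left_commute)
  then show ?thesis by blast
qed

lemma neighbour_of_frame_points:
  assumes "frame B" "frame B'" "adjacent_frames B B'"
  obtains x y w where "x \<in> B" "y \<in> B" "x \<noteq> y" "w \<noteq> 0" "w \<noteq> 1"
    "frame_points B' = frame_points (neighbour B x y w)"
proof -
  have "card (frame_points B \<inter> frame_points B') = 1"
    using assms(3) by (simp add: adjacent_frames_def)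
  then obtain P where "P \<in> frame_points B \<inter> frame_points B'" by (metis card_1_singletonE insertI1)
  then obtain x u where x: "x \<in> B" "u \<in> B'" "pt x = pt u" by (auto simp: frame_points_def)
  moreover have "x \<noteq> 0" using frame_elem_nonzero[OF assms(1) x(1)] .
  ultimately obtain c where c: "c \<noteq> 0" "x = c *s u" using pt_eq_iff by blast
  have "x \<in> (*s) c ` B'" using x c by blast
  moreover have "adjacent_frames B ((*s) c ` B')"
    using assms(3) frame_scale[OF assms(2) c(1)] by (simp add: adjacent_frames_def)
  ultimately obtain y w where "y \<in> B" "y \<noteq> x" "w \<noteq> 0" "w \<noteq> 1" "(*s) c ` B' = neighbour B x y w"
    using adjacent_frames_eq_neighbour[OF assms(1) frame_scale(1)[OF assms(2) c(1)] x(1)] by blast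
  then show ?thesis using that[of x y w] x(1) frame_scale(2)[OF assms(2) c(1)] by auto
qed

section \<open>Cliques of frames\<close>

text \<open>The graph enters only through V and E, which keeps this part independent of the encoding
  of ovoids and subquadrangles.\<close>

lemma card_maximal_clique_frames:
  assumes V: "\<And>X. X \<in> V \<longleftrightarrow> (\<exists>B. frame B \<and> X = frame_points B)"
    and E: "\<And>B B'. frame B \<Longrightarrow> frame B' \<Longrightarrow> E (frame_points B) (frame_points B') \<longleftrightarrow> adjacent_frames B B'"
    and C: "maximal_clique V E C"
  shows "card C = 3"
proof -
  have C_clique: "clique V E C" and C_max: "\<And>D. clique V E D \<Longrightarrow> C \<subseteq> D \<Longrightarrow> D = C"
    using C by (auto simp: maximal_clique_def)
  have CV: "C \<subseteq> V" and CE: "\<And>X Y. X \<in> C \<Longrightarrow> Y \<in> C \<Longrightarrow> X \<noteq> Y \<Longrightarrow> E X Y"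
    using C_clique by (auto simp: clique_def)
  \<comment> \<open>Finiteness matters because \<open>card\<close> is 0 for infinite sets
    too.\<close>
  have "C \<subseteq> Pow (Pow UNIV)" by simp
  then have fin: "finite C" using finite_vectors by (metis finite_Pow_iff finite_subset)
  have sym: "E X Y \<Longrightarrow> E Y X" if "X \<in> V" "Y \<in> V" for X Y
    using that V E by (auto simp: adjacent_frames_def Int_commute)
  have irrefl: "\<not> E X X" if "X \<in> V" for X
    using that V E card_frame_points by (auto simp: adjacent_frames_def)
  have nbr: "\<exists>x y w. x \<in> B \<and> y \<in> B \<and> x \<noteq> y \<and> w \<noteq> 0 \<and> w \<noteq> 1 \<and> Y = frame_points (neighbour B x y w)"
    if "frame B" "Y \<in> V" "E (frame_points B) Y" for B Y
  proof -
    from that(2) obtain B' where B': "frame B'" "Y = frame_points B'" using V[of Y] by blast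
    then have "adjacent_frames B B'" using E[OF that(1) B'(1)] that(3) by blast
    then show ?thesis using neighbour_of_frame_points[OF that(1) B'(1)] B'(2) by metis
  qed
  have le: "card C \<le> 3"
  proof (rule ccontr)
    assume "\<not> card C \<le> 3"
    then have "4 \<le> card C" by simp
    then obtain D where D: "D \<subseteq> C" "card D = 4" by (rule obtain_subset_with_card_n)
    from D(2) obtain X X1 X2 X3 where X: "D = {X, X1, X2, X3}" "distinct [X, X1, X2, X3]"
      by (auto simp: card_Suc_eq numeral_eq_Suc)
    have inC: "X \<in> C" "X1 \<in> C" "X2 \<in> C" "X3 \<in> C" using D(1) X(1) by auto
    have "X \<in> V" using CV inC(1) by blast
    then obtain B where B: "frame B" "X = frame_points B" using V[of X] by blast
    have *: "\<exists>x y w. x \<in> B \<and> y \<in> B \<and> x \<noteq> y \<and> w \<noteq> 0 \<and> w \<noteq> 1 \<and> Y = frame_points (neighbour B x y w)"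
      if "Y \<in> C" "Y \<noteq> X" for Y
      using nbr[OF B(1)] that CV CE[OF inC(1) that(1)] B(2) by blast
    have different: "w \<noteq> w'"
      if "x \<in> B" "y \<in> B" "x \<noteq> y" "w \<noteq> 0" "w \<noteq> 1" "x' \<in> B" "y' \<in> B" "x' \<noteq> y'"
        "frame_points (neighbour B x y w) \<in> C" "frame_points (neighbour B x' y' w') \<in> C"
        "frame_points (neighbour B x y w) \<noteq> frame_points (neighbour B x' y' w')" for x y w x' y' w'
    proof
      assume w: "w = w'"
      have "frame (neighbour B x y w)" "frame (neighbour B x' y' w)"
        using frame_neighbour[OF B(1)] that by blast+
      then have "adjacent_frames (neighbour B x y w) (neighbour B x' y' w)"
        using CE[OF that(9,10,11)] E w by blast
      then show False using neighbours_same_scalar_not_adjacent[OF B(1)] that by blast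
    qed
    obtain x1 y1 w1 where 1: "x1 \<in> B" "y1 \<in> B" "x1 \<noteq> y1" "w1 \<noteq> 0" "w1 \<noteq> 1" "X1 = frame_points (neighbour B x1 y1 w1)"
      using *[of X1] inC X(2) by auto
    obtain x2 y2 w2 where 2: "x2 \<in> B" "y2 \<in> B" "x2 \<noteq> y2" "w2 \<noteq> 0" "w2 \<noteq> 1" "X2 = frame_points (neighbour B x2 y2 w2)"
      using *[of X2] inC X(2) by auto
    obtain x3 y3 w3 where 3: "x3 \<in> B" "y3 \<in> B" "x3 \<noteq> y3" "w3 \<noteq> 0" "w3 \<noteq> 1" "X3 = frame_points (neighbour B x3 y3 w3)"
      using *[of X3] inC X(2) by auto
    have "w1 \<noteq> w2" by (rule different[of x1 y1 w1 x2 y2 w2]) (use 1 2 inC X(2) in auto)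
    moreover have "w1 \<noteq> w3" by (rule different[of x1 y1 w1 x3 y3 w3]) (use 1 3 inC X(2) in auto)
    moreover have "w2 \<noteq> w3" by (rule different[of x2 y2 w2 x3 y3 w3]) (use 2 3 inC X(2) in auto)
    \<comment> \<open>Three distinct scalars outside F_2 are one too many for F_4.\<close>
    ultimately show False using cases_01[OF 1(4,5), of w2] cases_01[OF 1(4,5), of w3] 2 3 by auto
  qed
  obtain \<omega> where \<omega>: "\<omega> \<noteq> (0::'f)" "\<omega> \<noteq> 1" using ex_primitive by blast
  have triangle: "\<exists>Y Z. Y \<in> V \<and> Z \<in> V \<and> Y = frame_points (neighbour B x y w) \<and>
      E (frame_points B) Y \<and> E (frame_points B) Z \<and> E Y Z"
    if "frame B" "x \<in> B" "y \<in> B" "x \<noteq> y" "w \<noteq> 0" "w \<noteq> 1" for B x y w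
  proof -
    let ?N = "neighbour B x y w" and ?N' = "neighbour B y x (w + 1)"
    have w: "w + 1 \<noteq> 0" "w + 1 \<noteq> 1" using that(5,6) by auto
    have f: "frame ?N" "frame ?N'" using frame_neighbour that w by auto
    have "x \<in> ?N" "x + y \<in> ?N" by (simp_all add: neighbour_def)
    moreover have "x + y \<noteq> x" using frame_elem_nonzero that by auto
    ultimately have "adjacent_frames ?N (neighbour ?N (x + y) x w)"
      using neighbour_adjacent[OF f(1)] that(5,6) by blast
    then have "adjacent_frames ?N ?N'" using neighbour_neighbour[OF that] by simp
    moreover have "adjacent_frames B ?N" "adjacent_frames B ?N'"
      using neighbour_adjacent[OF that(1)] that w by auto
    ultimately show ?thesis using E V f that(1) by blast
  qed
  have "card C = 0 \<or> card C = 1 \<or> card C = 2 \<or> card C = 3" using le by arith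
  then show ?thesis
  proof (elim disjE)
    assume "card C = 0"
    then have C: "C = {}" using fin by simp
    obtain B where "frame B" using ex_frame by blast
    then have "clique V E {frame_points B}" using V by (auto simp: clique_def)
    then show ?thesis using C_max C by blast
  next
    assume "card C = 1"
    then obtain X where X: "C = {X}" by (metis card_1_singletonE)
    then obtain B where B: "frame B" "X = frame_points B" using CV V by auto
    obtain x y z s t where "B = {x, y, z, s, t}" "distinct [x, y, z, s, t]" using frame_obtain[OF B(1)] .
    then obtain Y where "Y \<in> V" "E X Y" using triangle[OF B(1), of x y \<omega>] \<omega> B(2) by auto
    moreover from this have "clique V E {X, Y}" using CV X sym by (auto simp: clique_def)
    ultimately have "{X, Y} = {X}" using C_max X by blast
    then show ?thesis using \<open>E X Y\<close> irrefl CV X by auto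
  next
    assume "card C = 2"
    then obtain X Y where XY: "C = {X, Y}" "X \<noteq> Y" by (auto simp: card_2_iff)
    then obtain B where B: "frame B" "X = frame_points B" using CV V by auto
    have "Y \<in> V" "E X Y" using XY CV CE by auto
    then obtain x y w where "x \<in> B" "y \<in> B" "x \<noteq> y" "w \<noteq> 0" "w \<noteq> 1" "Y = frame_points (neighbour B x y w)"
      using nbr[OF B(1)] B(2) by blast
    then obtain Z where Z: "Z \<in> V" "E X Z" "E Y Z" using triangle[OF B(1)] B(2) by blast
    then have "clique V E {X, Y, Z}" using CV XY sym \<open>E X Y\<close> by (auto simp: clique_def)
    then have "{X, Y, Z} = {X, Y}" using C_max XY by blast
    then have "Z = X \<or> Z = Y" by auto
    then show ?thesis using Z irrefl by blast
  qed
qed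

section \<open>Subquadrangles and ovoids\<close>

text \<open>Lines described by points alone. The coordinatisations in the definitions of a
  subquadrangle and of an ovoid may differ, but having the same points they have the same
  lines.\<close>

definition joins :: "('f ^ 4) set set \<Rightarrow> ('f ^ 4) set set" where
  "joins A = {vec.span (P \<union> P') | P P'. P \<in> A \<and> P' \<in> A \<and> P \<noteq> P'}"

lemma span_union_pt: "vec.span (pt u \<union> pt v) = vec.span {u, v}"
proof -
  have "pt u \<subseteq> vec.span {u, v}" "pt v \<subseteq> vec.span {u, v}" by (rule vec.span_mono, simp)+
  moreover have "u \<in> vec.span (pt u \<union> pt v)" "v \<in> vec.span (pt u \<union> pt v)"
    by (simp_all add: vec.span_base)
  ultimately show ?thesis by (simp add: vec.span_eq)
qed

lemma baer_lines_joins: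
  assumes "invertible M"
  shows "baer_lines M = joins (baer_points M)"
proof -
  have pt_inj: "pt (baer_vec M x) = pt (baer_vec M y) \<longleftrightarrow> x = y" if "x \<noteq> 0" for x y
  proof
    assume "pt (baer_vec M x) = pt (baer_vec M y)"
    then have "baer_vec M x \<in> baer_embedding M (vec.span {y})"
      by (metis baer_embedding_span_set image_empty image_insert insertI1 vec.span_base)
    then have "x \<in> {0, y}" using baer_embedding_mem[OF assms] bit_span_singleton by (metis vec.subspace_span)
    then show "x = y" using that by simp
  qed simp
  show ?thesis
    unfolding baer_lines_eq joins_def baer_points_eq
  proof (intro equalityI subsetI)
    fix L assume "L \<in> {vec.span {baer_vec M x, baer_vec M y} |x y. x \<noteq> 0 \<and> y \<noteq> 0 \<and> x \<noteq> y}"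
    then obtain x y where xy: "L = vec.span {baer_vec M x, baer_vec M y}" "x \<noteq> 0" "y \<noteq> 0" "x \<noteq> y" by blast
    then have "pt (baer_vec M x) \<noteq> pt (baer_vec M y)" using pt_inj by blast
    then show "L \<in> {vec.span (P \<union> P') |P P'. P \<in> {pt (baer_vec M x) |x. x \<noteq> 0} \<and> P' \<in> {pt (baer_vec M x) |x. x \<noteq> 0} \<and> P \<noteq> P'}"
      using xy span_union_pt by blast
  next
    fix L assume "L \<in> {vec.span (P \<union> P') |P P'. P \<in> {pt (baer_vec M x) |x. x \<noteq> 0} \<and> P' \<in> {pt (baer_vec M x) |x. x \<noteq> 0} \<and> P \<noteq> P'}"
    then obtain x y where xy: "L = vec.span (pt (baer_vec M x) \<union> pt (baer_vec M y))" "x \<noteq> 0" "y \<noteq> 0" "pt (baer_vec M x) \<noteq> pt (baer_vec M y)"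
      by blast
    then have "x \<noteq> y" by blast
    then show "L \<in> {vec.span {baer_vec M x, baer_vec M y} |x y. x \<noteq> 0 \<and> y \<noteq> 0 \<and> x \<noteq> y}"
      using xy span_union_pt by blast
  qed
qed

lemma span_scale_pair:
  assumes "c \<noteq> 0" "d \<noteq> 0"
  shows "vec.span {c *s u, d *s v} = vec.span {u, v :: 'f ^ 4}"
proof -
  have "pt (c *s u) = pt u" "pt (d *s v) = pt v"
    using assms pt_eq_iff[of "c *s u" u] pt_eq_iff[of "d *s v" v] by (cases "u = 0"; cases "v = 0"; auto)+
  then show ?thesis using span_union_pt[of u v] span_union_pt[of "c *s u" "d *s v"] by simp
qed

lemma h_perp_span: "perp h (vec.span S) = perp h S"
proof (intro equalityI subsetI)
  fix v assume v: "v \<in> perp h S"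
  have "vec.subspace {u. h u v = 0}"
    by (rule vec.subspaceI) auto
  moreover have "S \<subseteq> {u. h u v = 0}" using v by (auto simp: perp_def)
  ultimately have "vec.span S \<subseteq> {u. h u v = 0}" by (rule vec.span_minimal[rotated])
  then show "v \<in> perp h (vec.span S)" by (auto simp: perp_def)
qed (auto simp: perp_def vec.span_base)

text \<open>An involution fixing every point of the Baer subgeometry fixes its subspaces, so that
  \<open>p (p' U) = \<sigma> U\<close> forces the two polarities to agree there.\<close>

lemma subquadrangle_polarity:
  assumes "invertible M" "alternating_form f" "nondegenerate_form f"
    and p': "extends_polarity M (perp f) p'"
    and \<sigma>: "semilinear_involution \<sigma>" "{P \<in> pg_points. \<sigma> P = P} = baer_points M"
    and p: "\<And>U. vec.subspace U \<Longrightarrow> perp h (p' U) = \<sigma> U"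
    and U: "vec.subspace U"
  shows "perp h (baer_embedding M U) = baer_embedding M (perp f U)"
proof -
  have b: "bilinear_form f" using assms(2) by (simp add: alternating_form_def)
  obtain s \<theta> where s': "bij s \<and> (\<forall>u v. s (u + v) = s u + s v) \<and> (\<forall>c v. s (c *s v) = \<theta> c *s s v) \<and>
      bij \<theta> \<and> (\<forall>a b. \<theta> (a + b) = \<theta> a + \<theta> b) \<and> (\<forall>a b. \<theta> (a * b) = \<theta> a * \<theta> b) \<and> \<sigma> = image s"
    using \<sigma>(1)[unfolded semilinear_involution_def, THEN conjunct1] by (elim exE) (rule that)
  then have s: "\<And>u v. s (u + v) = s u + s v" "\<And>c v. s (c *s v) = \<theta> c *s s v" "\<sigma> = image s"
    by blast+
  have \<sigma>2: "\<sigma> (\<sigma> V) = V" if "vec.subspace V" for V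
    using \<sigma>(1)[unfolded semilinear_involution_def, THEN conjunct2, THEN conjunct1] that by blast
  have s0: "s 0 = 0" using s(1)[of 0 0] by (metis add_self_left add_cancel_left_left)
  \<comment> \<open>Semilinearity makes the preimage of the embedded subspace a subspace. It
    contains the Baer vectors of V because each nonzero one spans a fixed point.\<close>
  have \<sigma>_le: "\<sigma> (baer_embedding M V) \<subseteq> baer_embedding M V" for V
  proof -
    have "vec.subspace {v. s v \<in> baer_embedding M V}"
      unfolding baer_embedding_span
      by (rule vec.subspaceI) (auto simp: s(1,2) s0 vec.span_zero intro: vec.span_add vec.span_scale)
    moreover have "baer_vec M ` V \<subseteq> {v. s v \<in> baer_embedding M V}"
    proof
      fix v assume "v \<in> baer_vec M ` V"
      then obtain x where x: "x \<in> V" "v = baer_vec M x" by blast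
      have "s v \<in> pt v"
      proof (cases "x = 0")
        case False
        then have "pt v \<in> baer_points M" unfolding baer_points_eq using x by blast
        then have "\<sigma> (pt v) = pt v" using \<sigma>(2) by blast
        then show ?thesis unfolding s(3) using vec.span_base by blast
      qed (simp add: x s0)
      moreover have "pt v \<subseteq> baer_embedding M V"
        unfolding baer_embedding_span using x by (intro vec.span_mono) blast
      ultimately show "v \<in> {v. s v \<in> baer_embedding M V}" by blast
    qed
    ultimately have "baer_embedding M V \<subseteq> {v. s v \<in> baer_embedding M V}"
      unfolding baer_embedding_span[of M V] by (rule vec.span_minimal[rotated])
    then show ?thesis unfolding s(3) by blast
  qed
  have \<sigma>_eq: "\<sigma> (baer_embedding M V) = baer_embedding M V" for V
  proof -
    have "vec.subspace (baer_embedding M V)" by (simp add: baer_embedding_span)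
    then have "baer_embedding M V = \<sigma> (\<sigma> (baer_embedding M V))" using \<sigma>2 by simp
    also have "\<dots> \<subseteq> \<sigma> (baer_embedding M V)" using \<sigma>_le[of V] unfolding s(3) by blast
    finally show ?thesis using \<sigma>_le[of V] by blast
  qed
  have ext: "p' (baer_embedding M V) = baer_embedding M (perp f V)" if "vec.subspace V" for V
    using p' that unfolding extends_polarity_def by blast
  \<comment> \<open>The double perpendicular writes the embedded U as a value of p', to which the
    hypothesis on \<open>perp h\<close> applies.\<close>
  have "baer_embedding M U = p' (baer_embedding M (perp f U))"
    using ext[OF subspace_perp[OF b, of U]] perp_perp[OF assms(2,3) U] by simp
  then have "perp h (baer_embedding M U) = \<sigma> (baer_embedding M (perp f U))"
    using p[of "baer_embedding M (perp f U)"] by (simp add: baer_embedding_span)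
  then show ?thesis using \<sigma>_eq by simp
qed

text \<open>The polarity controls only which products vanish. Secants are not generators, so
  distinct ovoid vectors x, y are not orthogonal; the line through x and y + z is tangent, so h x y
  = h x z. These equalities and conjugate symmetry make the common value its own square, hence 1.
  The coordinatisation M carries the polarity and K the quadric; they are connected only through the
  points and lines of W.\<close>

lemma subquadrangle_frame:
  assumes "symplectic_subquadrangle (perp h) W" "elliptic_ovoid W X"
  obtains B where "frame B" "X = frame_points B" "points_of W = lattice_points B"
    "lines_of W = {L \<in> joins (points_of W). card {P \<in> X. P \<subseteq> L} = 1}"
proof -
  obtain M \<rho> p' \<sigma> where M: "invertible M" and "symplectic_polarity \<rho>" and W: "W = symplectic_quadrangle M \<rho>"
    and p': "extends_polarity M \<rho> p'" and \<sigma>: "semilinear_involution \<sigma>" "{P \<in> pg_points. \<sigma> P = P} = baer_points M"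
    and p: "\<forall>U. vec.subspace U \<longrightarrow> p' (perp h U) = \<sigma> U \<and> perp h (p' U) = \<sigma> U"
    using assms(1) unfolding symplectic_subquadrangle_def by (elim exE conjE) (rule that; assumption)
  obtain f where f: "alternating_form f" "nondegenerate_form f" and \<rho>: "\<rho> = perp f"
    using \<open>symplectic_polarity \<rho>\<close> unfolding symplectic_polarity_def by (elim exE conjE) (rule that; assumption)
  have b: "bilinear_form f" and f_self: "f v v = 0" for v using f(1) by (auto simp: alternating_form_def)
  note bs = bilinear_form_simps[OF b]
  have perp_emb: "perp h (baer_embedding M U) = baer_embedding M (perp f U)" if "vec.subspace U" for U
    using subquadrangle_polarity[OF M f p'[unfolded \<rho>] \<sigma> _ that] p by blast
  have h_f: "h (baer_vec M x) (baer_vec M y) = 0 \<longleftrightarrow> f x y = 0" for x y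
  proof -
    have "h (baer_vec M x) (baer_vec M y) = 0 \<longleftrightarrow> baer_vec M y \<in> perp h (baer_embedding M (vec.span {x}))"
      unfolding baer_embedding_span_set h_perp_span by (simp add: perp_def)
    also have "\<dots> \<longleftrightarrow> y \<in> perp f (vec.span {x})"
      using perp_emb[of "vec.span {x}"] baer_embedding_mem[OF M] subspace_perp[OF b] by simp
    also have "\<dots> \<longleftrightarrow> f x y = 0" unfolding perp_span[OF b] by (simp add: perp_def)
    finally show ?thesis .
  qed
  have pts: "points_of W = baer_points M" and lns: "lines_of W = baer_embedding M ` {L \<in> pg_lines. L \<subseteq> perp f L}"
    by (simp_all add: W symplectic_quadrangle_def isotropic_geometry_def totally_isotropic_def \<rho>)
  have line_isotropic: "h u v = 0" if "L \<in> lines_of W" "u \<in> L" "v \<in> L" for L u v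
  proof -
    from that(1) obtain U where U: "L = baer_embedding M U" "U \<in> pg_lines" "U \<subseteq> perp f U" unfolding lns by blast
    then have "L \<subseteq> baer_embedding M (perp f U)"
      unfolding U(1) baer_embedding_span by (intro vec.span_mono image_mono)
    also have "\<dots> = perp h L" using perp_emb U by (simp add: pg_lines_def)
    finally show ?thesis using that(2,3) by (auto simp: perp_def)
  qed
  have isotropic_line: "vec.span {u, v} \<in> lines_of W"
    if "pt u \<in> points_of W" "pt v \<in> points_of W" "pt u \<noteq> pt v" "h u v = 0" for u v
  proof -
    from that(1,2) obtain x y where xy: "pt u = pt (baer_vec M x)" "x \<noteq> 0" "pt v = pt (baer_vec M y)" "y \<noteq> 0"
      unfolding pts baer_points_eq by blast
    have "x \<noteq> y" using that(3) xy by blast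
    have nz: "baer_vec M x \<noteq> 0" "baer_vec M y \<noteq> 0" using xy M baer_vec_eq_0 by auto
    obtain c d where cd: "c \<noteq> 0" "baer_vec M x = c *s u" "d \<noteq> 0" "baer_vec M y = d *s v"
      using pt_eq_iff[OF nz(1), of u] pt_eq_iff[OF nz(2), of v] xy by metis
    have "f x y = 0" using h_f[of x y] cd that(4) by simp
    then have "f y x = 0" using alternating_sym[OF f(1), of y x] by simp
    have "vec.subspace (perp f {x, y})" using subspace_perp[OF b] .
    moreover have "{x, y} \<subseteq> perp f {x, y}"
      using \<open>f x y = 0\<close> \<open>f y x = 0\<close> f_self by (auto simp: perp_def)
    ultimately have "vec.span {x, y} \<subseteq> perp f (vec.span {x, y})"
      unfolding perp_span[OF b] by (rule vec.span_minimal[rotated])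
    moreover have "vec.span {x, y} \<in> pg_lines"
      unfolding pg_lines_eq using xy \<open>x \<noteq> y\<close> bit_span_singleton[of x] by blast
    ultimately have "baer_embedding M (vec.span {x, y}) \<in> lines_of W" unfolding lns by blast
    moreover have "baer_embedding M (vec.span {x, y}) = vec.span {u, v}"
      using span_scale_pair[OF cd(1,3), of u v] cd by (simp add: baer_embedding_span_set)
    ultimately show ?thesis by simp
  qed
  obtain K Q where K: "invertible K" and pts_K: "points_of W = baer_points K" and "elliptic_quadric Q"
    and X: "X = baer_embedding K ` Q"
    and lns_K: "{L \<in> baer_lines K. card {P \<in> X. P \<subseteq> L} = 1} = lines_of W"
    using assms(2) unfolding elliptic_ovoid_def by (elim exE conjE) (rule that; assumption)
  obtain S where S: "card S = 5" "\<Sum>S = 0" "0 \<notin> S" "Q = (\<lambda>x. vec.span {x}) ` S"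
    "\<forall>x\<in>S. \<forall>y\<in>S. x \<noteq> y \<longrightarrow> x + y \<notin> S"
    "\<forall>x\<in>S. \<forall>y\<in>S. \<forall>z\<in>S. distinct [x, y, z] \<longrightarrow> x + y + z \<notin> S"
    "\<forall>v. v = 0 \<or> v \<in> S \<or> (\<exists>x\<in>S. \<exists>y\<in>S. v = x + y)"
    using elliptic_quadric_bit[OF \<open>elliptic_quadric Q\<close>] .
  let ?b = "baer_vec K"
  have XS: "X = (\<lambda>x. pt (?b x)) ` S" unfolding X S(4) by (simp add: image_image baer_embedding_span_set)
  have b_pt: "pt (?b x) \<in> points_of W" if "x \<noteq> 0" for x
    unfolding pts_K baer_points_eq using that by blast
  have b_nz: "?b x \<noteq> 0" if "x \<noteq> 0" for x using baer_vec_eq_0[OF K] that by simp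
  have pt_sub: "pt (?b x) \<subseteq> baer_embedding K (vec.span A) \<longleftrightarrow> x \<in> vec.span A" for x A
  proof -
    have "pt (?b x) \<subseteq> baer_embedding K (vec.span A) \<longleftrightarrow> ?b x \<in> baer_embedding K (vec.span A)"
      by (auto simp: baer_embedding_span_set vec.span_base intro: vec.span_minimal[THEN subsetD] )
    then show ?thesis using baer_embedding_mem[OF K] by simp
  qed
  have pt_eq: "pt (?b x) = pt (?b y) \<longleftrightarrow> x = y" if "x \<noteq> 0" for x y
  proof
    assume "pt (?b x) = pt (?b y)"
    then have "pt (?b x) \<subseteq> baer_embedding K (vec.span {y})" by (simp add: baer_embedding_span_set)
    then have "x \<in> vec.span {y}" using pt_sub by blast
    then have "x \<in> {0, y}" by (simp only: bit_span_singleton)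
    then show "x = y" using that by simp
  qed simp
  \<comment> \<open>Isotropy is read off in the coordinates M, where the alternating form lives; the
    point has a representative there too.\<close>
  have iso: "h (?b x) (?b x) = 0" for x
  proof (cases "x = 0")
    case False
    have "pt (?b x) \<in> baer_points M" using b_pt[OF False] pts by simp
    then obtain y where y: "pt (?b x) = pt (baer_vec M y)" unfolding baer_points_eq by blast
    then obtain c where "?b x = c *s baer_vec M y" using pt_eq_iff[OF b_nz[OF False]] by blast
    then show ?thesis using h_f[of y y] f_self by simp
  qed simp
  have secant: "h (?b x) (?b y) \<noteq> 0" if "x \<in> S" "y \<in> S" "x \<noteq> y" for x y
  proof
    assume 0: "h (?b x) (?b y) = 0"
    have nz: "x \<noteq> 0" "y \<noteq> 0" using that S(3) by auto
    let ?L = "vec.span {?b x, ?b y}"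
    have "?L \<in> lines_of W" using isotropic_line[OF b_pt b_pt _ 0] nz pt_eq that(3) by blast
    then have "card {P \<in> X. P \<subseteq> ?L} = 1" using lns_K by blast
    then obtain P where P: "{P \<in> X. P \<subseteq> ?L} = {P}" by (rule card_1_singletonE)
    have "pt (?b x) \<in> X" "pt (?b y) \<in> X" using XS that by blast+
    moreover have "pt (?b x) \<subseteq> ?L" "pt (?b y) \<subseteq> ?L" by (rule vec.span_mono, simp)+
    ultimately have "pt (?b x) = P" "pt (?b y) = P" using P by blast+
    then have "pt (?b x) = pt (?b y)" by simp
    then show False using pt_eq nz that(3) by blast
  qed
  \<comment> \<open>The third point of the line is x + y + z. Neither it nor y + z comes from S, so
    x gives the only ovoid point on the line.\<close>
  have tangent: "h (?b x) (?b (y + z)) = 0" if "x \<in> S" "y \<in> S" "z \<in> S" "distinct [x, y, z]" for x y z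
  proof -
    let ?L = "vec.span {?b x, ?b (y + z)}"
    have sums: "y + z \<notin> S" "x + y + z \<notin> S" using S(5,6) that by auto
    then have "x \<noteq> y + z" using that(1) by auto
    moreover have "y + z \<noteq> 0"
    proof
      assume "y + z = 0"
      moreover have "y = (y + z) + z" by (simp add: add.assoc)
      ultimately have "y = z" by simp
      then show False using that(4) by simp
    qed
    moreover have "x \<noteq> 0" using that S(3) by blast
    ultimately have L: "?L \<in> baer_lines K" unfolding baer_lines_eq by blast
    have LE: "?L = baer_embedding K (vec.span {x, y + z})" by (simp add: baer_embedding_span_set)
    have "{P \<in> X. P \<subseteq> ?L} = {pt (?b x)}"
    proof -
      have "x' = x" if "x' \<in> S" "x' \<in> {0, x, y + z, x + (y + z)}" for x'
        using that S(3) sums by (auto simp: add.assoc)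
      then have "pt (?b x') \<subseteq> ?L \<longleftrightarrow> x' = x" if "x' \<in> S" for x'
        using pt_sub[of x' "{x, y + z}"] that unfolding LE bit_span_pair[of x "y + z"] by blast
      then show ?thesis unfolding XS using that(1) by blast
    qed
    then have "card {P \<in> X. P \<subseteq> ?L} = 1" by simp
    then have "?L \<in> lines_of W" using L lns_K by blast
    then show ?thesis by (rule line_isotropic) (simp_all add: vec.span_base)
  qed
  have h1: "h (?b x) (?b y) = 1" if "x \<in> S" "y \<in> S" "x \<noteq> y" for x y
  proof -
    have eq: "h (?b x) (?b y) = h (?b x) (?b z)" if "x \<in> S" "y \<in> S" "z \<in> S" "distinct [x, y, z]" for x y z
      using tangent[OF that] by (simp add: baer_vec_add)
    have "\<not> S \<subseteq> {x, y}" using S(1) card_mono[of "{x, y}" S] that(3) by auto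
    then obtain z where z: "z \<in> S" "z \<noteq> x" "z \<noteq> y" by blast
    \<comment> \<open>Passing around the triangle x, y, z, with a conjugation at each exchange of
      arguments, carries the product to its own conjugate.\<close>
    have "h (?b x) (?b y) = h (?b x) (?b z)" using eq[of x y z] that z by auto
    also have "\<dots> = (h (?b z) (?b x))\<^sup>2" by (rule h_sym)
    also have "\<dots> = (h (?b z) (?b y))\<^sup>2" using eq[of z x y] that z by auto
    also have "\<dots> = h (?b y) (?b z)" by (rule h_sym[symmetric])
    also have "\<dots> = h (?b y) (?b x)" using eq[of y z x] that z by auto
    also have "\<dots> = (h (?b x) (?b y))\<^sup>2" by (rule h_sym)
    finally show ?thesis using secant[OF that] square_fixed by metis
  qed
  define B where "B = ?b ` S"
  have inj: "inj_on ?b S" using inj_baer_vec[OF K] by (auto intro: inj_onI)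
  have "\<Sum>B = ?b (\<Sum>S)"
  proof -
    have "finite S" using S(1) card.infinite by fastforce
    then have "(\<Sum>x\<in>S. ?b x) = ?b (\<Sum>S)" by (induction S) (simp_all add: baer_vec_add)
    then show ?thesis unfolding B_def using inj by (simp add: sum.reindex)
  qed
  then have fB: "frame B"
    unfolding frame_def B_def using S(1,2) inj iso h1 inj_baer_vec[OF K] by (auto simp: card_image)
  moreover have XB: "X = frame_points B" unfolding frame_points_def B_def XS by (simp add: image_image)
  moreover have "points_of W = lattice_points B"
  proof -
    have "lattice B = range ?b"
    proof (intro equalityI subsetI)
      fix v assume v: "v \<in> lattice B"
      obtain a b' c d e where B: "B = {a, b', c, d, e}" "distinct [a, b', c, d, e]" using frame_obtain[OF fB] .
      have "h v a = 0 \<or> h v a = 1" using v B by (auto simp: lattice_def)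
      then have "v \<in> {0, a, b' + c, b' + d, b' + e, c + d, c + e, d + e} \<or> v \<in> {b', c, d, e, a + b', a + c, a + d, a + e}"
        using lattice_ortho_cases[of a b' c d e v] lattice_nonortho_cases[of a b' c d e v] fB B v by blast
      moreover have "0 \<in> range ?b" by (metis baer_vec_0 rangeI)
      moreover have "a \<in> range ?b" "b' \<in> range ?b" "c \<in> range ?b" "d \<in> range ?b" "e \<in> range ?b"
        using B(1) unfolding B_def by auto
      moreover have "u + v \<in> range ?b" if "u \<in> range ?b" "v \<in> range ?b" for u v
        using that by (auto simp: baer_vec_add[symmetric])
      ultimately show "v \<in> range ?b" by blast
    next
      fix v assume "v \<in> range ?b"
      then obtain x where x: "v = ?b x" by blast
      have BL: "?b y \<in> lattice B" if "y \<in> S" for y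
        using frame_subset_lattice[OF fB] that by (auto simp: B_def)
      show "v \<in> lattice B"
        using S(7)[rule_format, of x] BL lattice_add[of _ B] lattice_zero unfolding x by (auto simp: baer_vec_add)
    qed
    then show ?thesis unfolding pts_K baer_points_eq lattice_points_def
      using baer_vec_eq_0[OF K] by auto
  qed
  moreover have "lines_of W = {L \<in> joins (points_of W). card {P \<in> X. P \<subseteq> L} = 1}"
    using lns_K baer_lines_joins[OF K] pts_K by simp
  ultimately show ?thesis using that by blast
qed

section \<open>From a frame to a subquadrangle\<close>

text \<open>The Gram matrix is all ones minus the identity, so pairing with k gives the sum of the
  coefficients plus a k. Together with \<open>frame_sum_h\<close>, exactly the families of sum 0
  occur as values on B, and they serve as canonical coefficients.\<close>

lemma frame_combination:
  assumes "frame B" "k \<in> B" "(\<Sum>b\<in>B. a b) = 0"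
  shows "h (\<Sum>b\<in>B. a b *s b) k = a k"
proof -
  have "h (\<Sum>b\<in>B. a b *s b) k = (\<Sum>b\<in>B. a b * h b k)" by (simp add: h_sum_left)
  also have "\<dots> = (\<Sum>b\<in>B. a b + (if b = k then a k else 0))"
  proof (rule sum.cong)
    fix b assume "b \<in> B"
    then show "a b * h b k = a b + (if b = k then a k else 0)"
      by (simp add: frame_h[OF assms(1) _ assms(2)])
  qed simp
  also have "\<dots> = a k"
    using assms(2,3) by (simp only: sum.distrib sum.delta[OF frame_finite[OF assms(1)]]) simp
  finally show ?thesis .
qed

lemma sum_square: "(\<Sum>b\<in>B. (a b)\<^sup>2) = (\<Sum>b\<in>B. a b :: 'f)\<^sup>2"
  by (induction B rule: infinite_finite_induct) (auto simp: square_add)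

lemma frame_expansion:
  assumes "frame B"
  shows "(\<Sum>b\<in>B. h v b *s b) = v"
  by (rule frame_ext[OF assms]) (simp add: frame_combination[OF assms] frame_sum_h[OF assms])

text \<open>Conjugation of coefficients. Five vectors in dimension 4 do not have unique
  coefficients, so the values on B are used; their squares again have sum 0.\<close>

definition conj_frame :: "('f ^ 4) set \<Rightarrow> 'f ^ 4 \<Rightarrow> 'f ^ 4" where
  "conj_frame B v = (\<Sum>b\<in>B. (h v b)\<^sup>2 *s b)"

lemma h_conj_frame: "frame B \<Longrightarrow> b \<in> B \<Longrightarrow> h (conj_frame B v) b = (h v b)\<^sup>2"
  unfolding conj_frame_def by (rule frame_combination) (simp_all add: sum_square frame_sum_h)

lemma conj_frame_add:
  assumes "frame B"
  shows "conj_frame B (u + v) = conj_frame B u + conj_frame B v"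
  by (rule frame_ext[OF assms]) (simp add: h_conj_frame[OF assms] square_add)

lemma conj_frame_scale:
  assumes "frame B"
  shows "conj_frame B (c *s v) = c\<^sup>2 *s conj_frame B v"
  by (rule frame_ext[OF assms]) (simp add: h_conj_frame[OF assms] power_mult_distrib)

lemma conj_frame_involution:
  assumes "frame B"
  shows "conj_frame B (conj_frame B v) = v"
  by (rule frame_ext[OF assms]) (simp add: h_conj_frame[OF assms])

lemma conj_frame_fixed: "frame B \<Longrightarrow> conj_frame B v = v \<longleftrightarrow> v \<in> lattice B"
proof
  assume B: "frame B" and "conj_frame B v = v"
  then have "(h v b)\<^sup>2 = h v b" if "b \<in> B" for b using h_conj_frame[OF B that, of v] by simp
  then show "v \<in> lattice B" by (auto simp: lattice_def square_fixed)
next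
  assume B: "frame B" and v: "v \<in> lattice B"
  then show "conj_frame B v = v"
    by (intro frame_ext[OF B]) (auto simp: h_conj_frame lattice_def)
qed

text \<open>In terms of values the form is the ordinary dot product on words of sum 0. It is
  alternating there because a sum of squares is the square of the sum.\<close>

lemma h_conj_frame_right:
  assumes "frame B"
  shows "h u (conj_frame B v) = (\<Sum>b\<in>B. h u b * h v b)"
proof -
  have "h u (conj_frame B v) = h (\<Sum>b\<in>B. h u b *s b) (conj_frame B v)"
    by (simp only: frame_expansion[OF assms])
  also have "\<dots> = (\<Sum>b\<in>B. h u b * h b (conj_frame B v))"
    by (simp add: h_sum_left)
  also have "\<dots> = (\<Sum>b\<in>B. h u b * h v b)"
  proof (rule sum.cong)
    fix b assume "b \<in> B"
    then have "h b (conj_frame B v) = h v b"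
      using h_sym[of b "conj_frame B v"] h_conj_frame[OF assms, of b v] by simp
    then show "h u b * h b (conj_frame B v) = h u b * h v b" by simp
  qed simp
  finally show ?thesis .
qed

lemma conj_frame_form:
  assumes "frame B"
  shows "alternating_form (\<lambda>u v. h u (conj_frame B v))" "nondegenerate_form (\<lambda>u v. h u (conj_frame B v))"
    "h (conj_frame B u) (conj_frame B (conj_frame B v)) = (h u (conj_frame B v))\<^sup>2"
proof -
  have "bilinear_form (\<lambda>u v. h u (conj_frame B v))"
    by (rule bilinear_formI) (simp_all add: conj_frame_add[OF assms] conj_frame_scale[OF assms])
  moreover have "h v (conj_frame B v) = 0" for v
    using frame_sum_h[OF assms, of v] by (simp add: h_conj_frame_right[OF assms] power2_eq_square[symmetric] sum_square)
  ultimately show "alternating_form (\<lambda>u v. h u (conj_frame B v))" by (simp add: alternating_form_def)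
  show "nondegenerate_form (\<lambda>u v. h u (conj_frame B v))"
    unfolding nondegenerate_form_def
  proof (intro allI impI)
    fix v assume "\<forall>u. h u (conj_frame B v) = 0"
    then have "conj_frame B v = 0" using nondeg unfolding nondegenerate_form_def by blast
    then have "conj_frame B (conj_frame B v) = 0" by (simp add: conj_frame_def)
    then show "v = 0" by (simp add: conj_frame_involution[OF assms])
  qed
  show "h (conj_frame B u) (conj_frame B (conj_frame B v)) = (h u (conj_frame B v))\<^sup>2"
    by (simp add: h_conj_frame_right[OF assms] h_conj_frame[OF assms] power_mult_distrib[symmetric] sum_square)
qed

text \<open>The symplectic polarity is the composition of the unitary one with the conjugation fixing the
  lattice of the frame, so that both products of the two polarities are this conjugation.\<close>

lemma perp_conj_frame:
  assumes "frame B" "vec.subspace U"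
  defines "f \<equiv> \<lambda>u v. h u (conj_frame B v)"
  shows "perp f (perp h U) = conj_frame B ` U" "perp h (perp f U) = conj_frame B ` U"
proof -
  let ?s = "conj_frame B"
  note inv = conj_frame_involution[OF assms(1)]
  have img: "?s ` V = {v. ?s v \<in> V}" for V
  proof (intro equalityI subsetI)
    fix v assume "v \<in> {v. ?s v \<in> V}"
    then have "?s (?s v) \<in> ?s ` V" by blast
    then show "v \<in> ?s ` V" by (simp add: inv)
  qed (auto simp: inv)
  have h: "perp h V = ?s ` perp f V" for V
    unfolding img by (simp add: perp_def f_def inv)
  have f_s: "f (?s u) (?s v) = (f u v)\<^sup>2" for u v
    unfolding f_def by (rule conj_frame_form(3)[OF assms(1)])
  have pf_s: "perp f (?s ` V) = ?s ` perp f V" for V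
  proof -
    have "f (?s u) v = 0 \<longleftrightarrow> f u (?s v) = 0" for u v using f_s[of u "?s v"] inv by simp
    then show ?thesis unfolding img[of "perp f V"] by (simp add: perp_def)
  qed
  have pp: "perp f (perp f U) = U"
    unfolding f_def by (rule perp_perp[OF conj_frame_form(1,2)[OF assms(1)] assms(2)])
  show "perp f (perp h U) = ?s ` U" by (simp add: h pf_s pp)
  show "perp h (perp f U) = ?s ` U" by (simp add: h pp)
qed

lemma frame_semilinear_involution:
  assumes "frame B"
  shows "semilinear_involution (image (conj_frame B))"
    "{P \<in> pg_points. conj_frame B ` P = P} = lattice_points B"
proof -
  let ?s = "conj_frame B"
  note inv = conj_frame_involution[OF assms] and scale = conj_frame_scale[OF assms]
  have pt: "?s ` pt v = pt (?s v)" for v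
  proof -
    have "k *s ?s v \<in> ?s ` pt v" for k
    proof
      show "k *s ?s v = ?s (k\<^sup>2 *s v)" by (simp add: scale)
      show "k\<^sup>2 *s v \<in> pt v" by (simp add: vec.span_scale vec.span_base)
    qed
    then show ?thesis by (auto simp: vec.span_singleton scale)
  qed
  have fixed: "?s ` pt v = pt v \<longleftrightarrow> pt v \<in> lattice_points B" if v: "v \<noteq> 0" for v
  proof
    assume "?s ` pt v = pt v"
    then have "pt (?s v) = pt v" by (simp add: pt)
    moreover have "?s 0 = 0" by (simp add: conj_frame_def)
    then have "?s v \<noteq> 0" using v inv by metis
    ultimately obtain c where c: "c \<noteq> 0" "?s v = c *s v" using pt_eq_iff by blast
    \<comment> \<open>An instance of Hilbert 90: as c^2 has conjugate c, the image of c^2 *s v is c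
      *s (c *s v), so this multiple of v is fixed.\<close>
    let ?d = "c\<^sup>2"
    have "?s (?d *s v) = (c * c) *s v" by (simp add: scale c(2))
    then have "?d *s v \<in> lattice B" using conj_frame_fixed[OF assms, of "?d *s v"] by (simp add: power2_eq_square)
    moreover have "?d *s v \<noteq> 0" "pt (?d *s v) = pt v" using pt_eq_iff[of "?d *s v" v] c v by auto
    ultimately show "pt v \<in> lattice_points B" unfolding lattice_points_def by blast
  next
    assume "pt v \<in> lattice_points B"
    then obtain u where u: "pt v = pt u" "u \<in> lattice B" unfolding lattice_points_def by blast
    then have "?s u = u" using conj_frame_fixed[OF assms] by blast
    then show "?s ` pt v = pt v" using u(1) pt[of u] by simp
  qed
  show "{P \<in> pg_points. ?s ` P = P} = lattice_points B"
  proof (intro equalityI subsetI)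
    fix P assume P: "P \<in> {P \<in> pg_points. ?s ` P = P}"
    then obtain v where "P = pt v" "v \<noteq> 0" unfolding pg_points_eq by blast
    then show "P \<in> lattice_points B" using fixed[of v] P by simp
  next
    fix P assume P: "P \<in> lattice_points B"
    then obtain v where v: "P = pt v" "v \<noteq> 0" unfolding lattice_points_def by blast
    then have "P \<in> pg_points" unfolding pg_points_eq by blast
    then show "P \<in> {P \<in> pg_points. ?s ` P = P}" using fixed[of v] P v by simp
  qed
  show "semilinear_involution (image ?s)"
    unfolding semilinear_involution_def
  proof (intro conjI allI impI)
    show "\<exists>s \<theta>. bij s \<and> (\<forall>u v. s (u + v) = s u + s v) \<and> (\<forall>c v. s (c *s v) = \<theta> c *s s v) \<and> bij \<theta> \<and>
        (\<forall>a b. \<theta> (a + b) = \<theta> a + \<theta> b) \<and> (\<forall>a b. \<theta> (a * b) = \<theta> a * \<theta> b) \<and> (`) ?s = (`) s"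
    proof (intro exI conjI allI)
      show "bij ?s" by (rule o_bij[of ?s]) (simp_all add: fun_eq_iff inv)
      show "bij (\<lambda>c :: 'f. c\<^sup>2)" by (rule o_bij[of "\<lambda>c. c\<^sup>2"]) (simp_all add: fun_eq_iff)
    qed (simp_all add: conj_frame_add[OF assms] scale square_add power_mult_distrib)
    show "?s ` ?s ` U = U" for U by (simp add: image_image inv)
    show "\<exists>P\<in>pg_points. ?s ` P \<noteq> P"
    proof -
      obtain \<omega> where \<omega>: "\<omega> \<noteq> (0::'f)" "\<omega> \<noteq> 1" using ex_primitive by blast
      obtain a b c d e where B: "B = {a, b, c, d, e}" "distinct [a, b, c, d, e]" using frame_obtain[OF assms] .
      note f = frame_simps[OF assms[unfolded B(1)] B(2)]
      \<comment> \<open>Two values of this vector on B have ratio \<omega>, so no nonzero multiple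
        of it has all values in F_2.\<close>
      let ?v = "a + \<omega> *s b"
      have v: "h ?v a = \<omega>" "h ?v b = 1" "h ?v c = 1 + \<omega>" by (simp_all add: f)
      have "?v \<noteq> 0" using v by auto
      moreover have "pt ?v \<notin> lattice_points B"
      proof
        assume "pt ?v \<in> lattice_points B"
        then obtain u where u: "pt ?v = pt u" "u \<in> lattice B" unfolding lattice_points_def by blast
        then obtain k where k: "k \<noteq> 0" "?v = k *s u" using pt_eq_iff[OF \<open>?v \<noteq> 0\<close>] by blast
        then have "k * h u a = \<omega>" "k * h u b = 1" using v by simp_all
        moreover have "h u a = 0 \<or> h u a = 1" "h u b = 0 \<or> h u b = 1" using u(2) B(1) by (auto simp: lattice_def)
        ultimately show False using \<omega> by auto
      qed
      moreover have "pt ?v \<in> pg_points" unfolding pg_points_eq using \<open>?v \<noteq> 0\<close> by blast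
      ultimately show ?thesis using fixed[of ?v] by blast
    qed
  qed
qed

text \<open>Four frame vectors are the columns of M and the fifth is their sum. The form q is the
  second elementary symmetric polynomial: on a word of weight k it is k (k - 1) / 2 mod 2, which
  vanishes exactly for the weights 0, 1 and 4, that is at 0, the unit vectors and the all-ones
  word.\<close>

lemma frame_coordinates:
  assumes "frame B"
  obtains M f q where "invertible M" "range (baer_vec M) = lattice B"
    "bilinear_form f" "\<forall>x y. h (baer_vec M x) (baer_vec M y) = lift (f x y)"
    "\<forall>x y. q (x + y) = q x + q y + f x y" "\<forall>c x. q (c *s x) = c\<^sup>2 * q x"
    "\<forall>x. q x = 0 \<longleftrightarrow> baer_vec M x \<in> B \<or> x = 0"
proof -
  obtain a b c d e where B: "B = {a, b, c, d, e}" "distinct [a, b, c, d, e]" using frame_obtain[OF assms] .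
  note F = assms[unfolded B(1)]
  note fs = frame_simps[OF F B(2)]
  define M :: "'f ^ 4 ^ 4" where
    "M = (\<chi> i j. (if j = 1 then a else if j = 2 then b else if j = 3 then c else d) $ i)"
  have Mv: "M *v x = x $ 1 *s a + x $ 2 *s b + x $ 3 *s c + x $ 4 *s d" for x
    by (simp add: vec_eq_iff matrix_vector_mult_def sum_4 M_def mult.commute)
  have bv: "baer_vec M x = lift (x $ 1) *s a + lift (x $ 2) *s b + lift (x $ 3) *s c + lift (x $ 4) *s d" for x
    by (simp add: baer_vec_def Mv)
  have "inj ((*v) M)"
  proof (rule injI)
    fix x y assume xy: "M *v x = M *v y"
    have "h (M *v x) k = h (M *v y) k" for k by (simp add: xy)
    from this[of a] this[of b] this[of c] this[of d] this[of e]
    have eqs: "x $ 2 + (x $ 3 + x $ 4) = y $ 2 + (y $ 3 + y $ 4)" "x $ 1 + (x $ 3 + x $ 4) = y $ 1 + (y $ 3 + y $ 4)"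
      "x $ 1 + (x $ 2 + x $ 4) = y $ 1 + (y $ 2 + y $ 4)" "x $ 1 + (x $ 2 + x $ 3) = y $ 1 + (y $ 2 + y $ 3)"
      "x $ 1 + (x $ 2 + (x $ 3 + x $ 4)) = y $ 1 + (y $ 2 + (y $ 3 + y $ 4))"
      by (simp_all add: Mv fs add.assoc)
    have 1: "x $ 1 = y $ 1" using eqs(1,5) by simp
    have 2: "x $ 2 = y $ 2" using eqs(2,5) 1 by simp
    have 3: "x $ 3 = y $ 3" using eqs(3,5) 1 2 by simp
    have 4: "x $ 4 = y $ 4" using eqs(5) 1 2 3 by simp
    show "x = y" using 1 2 3 4 by (simp add: vec_eq_iff forall_4)
  qed
  then have M: "invertible M" by (simp add: invertible_left_inverse matrix_left_invertible_injective)
  define f :: "bit ^ 4 \<Rightarrow> bit ^ 4 \<Rightarrow> bit" where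
    "f x y = x $ 1 * (y $ 2 + y $ 3 + y $ 4) + x $ 2 * (y $ 1 + y $ 3 + y $ 4)
      + x $ 3 * (y $ 1 + y $ 2 + y $ 4) + x $ 4 * (y $ 1 + y $ 2 + y $ 3)" for x y
  define q :: "bit ^ 4 \<Rightarrow> bit" where
    "q x = x $ 1 * x $ 2 + x $ 1 * x $ 3 + x $ 1 * x $ 4 + x $ 2 * x $ 3 + x $ 2 * x $ 4 + x $ 3 * x $ 4" for x
  have e: "e = a + b + c + d" using fs(1) by (metis vadd_eq_0)
  have range: "range (baer_vec M) = lattice B"
  proof (intro equalityI subsetI)
    fix v assume "v \<in> range (baer_vec M)"
    then obtain x where x: "v = baer_vec M x" by blast
    have *: "lift t *s u \<in> lattice B" if "u \<in> B" for t u
      using frame_subset_lattice[OF assms] that by (cases t) (auto simp: lattice_zero)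
    have "a \<in> B" "b \<in> B" "c \<in> B" "d \<in> B" using B(1) by auto
    then show "v \<in> lattice B" unfolding x bv by (intro lattice_add *)
  next
    fix v assume v: "v \<in> lattice B"
    have "h v a = 0 \<or> h v a = 1" using v B by (auto simp: lattice_def)
    then have v_cases: "v \<in> {0, a, b + c, b + d, b + e, c + d, c + e, d + e} \<or> v \<in> {b, c, d, e, a + b, a + c, a + d, a + e}"
      using lattice_ortho_cases[OF F B(2), of v] lattice_nonortho_cases[OF F B(2), of v] v unfolding B(1) by blast
    have "baer_vec M 0 = 0" "baer_vec M (axis 1 1) = a" "baer_vec M (axis 2 1) = b"
      "baer_vec M (axis 3 1) = c" "baer_vec M (axis 4 1) = d"
      by (simp_all add: bv axis_def)
    then have mem: "0 \<in> range (baer_vec M)" "a \<in> range (baer_vec M)" "b \<in> range (baer_vec M)" "c \<in> range (baer_vec M)" "d \<in> range (baer_vec M)"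
      by (metis rangeI)+
    have add: "u + v \<in> range (baer_vec M)" if "u \<in> range (baer_vec M)" "v \<in> range (baer_vec M)" for u v
      using that by (auto simp: baer_vec_add[symmetric])
    have "e \<in> range (baer_vec M)" unfolding e by (intro add mem)
    then show "v \<in> range (baer_vec M)"
      using v_cases by (elim disjE insertE emptyE) (simp_all only: add mem)
  qed
  have "bilinear_form f"
    by (rule bilinear_formI) (simp_all add: f_def distrib_left distrib_right mult.commute mult.left_commute add.commute add.left_commute)
  moreover have "h (baer_vec M x) (baer_vec M y) = lift (f x y)" for x y
    by (simp add: bv fs f_def lift_add lift_mult distrib_left distrib_right mult.commute add.commute add.left_commute)
  moreover have "q (x + y) = q x + q y + f x y" for x y
    by (simp add: q_def f_def distrib_left distrib_right mult.commute add.commute add.left_commute)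
  moreover have "q (k *s x) = k\<^sup>2 * q x" for k x
    by (cases k) (simp_all add: q_def)
  moreover have "q x = 0 \<longleftrightarrow> baer_vec M x \<in> B \<or> x = 0" for x
  proof -
    have "x = 0 \<longleftrightarrow> x $ 1 = 0 \<and> x $ 2 = 0 \<and> x $ 3 = 0 \<and> x $ 4 = 0" by (simp add: vec_eq_iff forall_4)
    then show ?thesis unfolding B(1) bv q_def
      by (cases "x $ 1"; cases "x $ 2"; cases "x $ 3"; cases "x $ 4") (simp_all add: e fs frame_eq_iff[OF F])
  qed
  ultimately show ?thesis using that[of M f q] M range by blast
qed

lemma frame_subquadrangle:
  assumes "frame B"
  shows "\<exists>W. symplectic_subquadrangle (perp h) W \<and> elliptic_ovoid W (frame_points B)"
proof -
  obtain M f q where M: "invertible M" and range: "range (baer_vec M) = lattice B"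
    and b: "bilinear_form f" and hf: "\<forall>x y. h (baer_vec M x) (baer_vec M y) = lift (f x y)"
    and q_add: "\<forall>x y. q (x + y) = q x + q y + f x y" and q_scale: "\<forall>c x. q (c *s x) = c\<^sup>2 * q x"
    and q0: "\<forall>x. q x = 0 \<longleftrightarrow> baer_vec M x \<in> B \<or> x = 0"
    using frame_coordinates[OF assms] .
  note bs = bilinear_form_simps[OF b]
  let ?b = "baer_vec M"
  let ?f' = "\<lambda>u v. h u (conj_frame B v)"
  have q00: "q 0 = 0" using q0[rule_format, of 0] by simp
  have f_self: "f x x = 0" for x
  proof -
    have "q (x + x) = q x + q x + f x x" using q_add by blast
    then show ?thesis using q00 by simp
  qed
  have alt: "alternating_form f" using b f_self by (simp add: alternating_form_def)
  have nd: "nondegenerate_form f"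
    unfolding nondegenerate_form_def
  proof (intro allI impI)
    fix v assume v: "\<forall>u. f u v = 0"
    have "?b v = 0"
    proof (rule frame_ext[OF assms])
      fix k assume "k \<in> B"
      then have "k \<in> range ?b" using range frame_subset_lattice[OF assms] by blast
      then obtain u where "k = ?b u" by blast
      then have "h k (?b v) = 0" using hf v by simp
      then show "h (?b v) k = h 0 k" using h_zero_sym by simp
    qed
    then show "v = 0" using baer_vec_eq_0[OF M] by simp
  qed
  have bl: "?b x \<in> lattice B" for x using range by blast
  have pts: "baer_points M = lattice_points B"
    unfolding baer_points_eq lattice_points_def range[symmetric] using baer_vec_eq_0[OF M] by auto
  have f'_f: "?f' (?b x) (?b y) = lift (f x y)" for x y
    using conj_frame_fixed[OF assms, of "?b y"] bl hf by simp
  have f'_b: "bilinear_form ?f'" using conj_frame_form(1)[OF assms] by (simp add: alternating_form_def)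
  have ext: "perp ?f' (baer_embedding M U) = baer_embedding M (perp f U)" for U
  proof -
    obtain w where w: "w \<noteq> (0::'f)" "w \<noteq> 1" using ex_primitive by blast
    have sub: "vec.subspace (perp f U)" by (rule subspace_perp[OF b])
    have 1: "perp ?f' (baer_embedding M U) = perp ?f' (?b ` U)"
      unfolding baer_embedding_span by (rule perp_span[OF f'_b])
    \<comment> \<open>As 1 and w are independent over F_2, orthogonality to Baer vectors holds for
      the two components separately.\<close>
    have 2: "?b x + w *s ?b y \<in> perp ?f' (?b ` U) \<longleftrightarrow> x \<in> perp f U \<and> y \<in> perp f U" for x y
    proof -
      have "?f' (?b u) (?b x + w *s ?b y) = lift (f u x) + w * lift (f u y)" for u
        using bilinear_form_simps(3,4)[OF f'_b] f'_f by simp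
      moreover have "lift s + w * lift t = 0 \<longleftrightarrow> s = 0 \<and> t = 0" for s t
        using w by (cases s; cases t) auto
      ultimately show ?thesis by (auto simp: perp_def)
    qed
    show ?thesis unfolding 1 baer_embedding_eq[OF sub w]
    proof (intro equalityI subsetI)
      fix v assume v: "v \<in> perp ?f' (?b ` U)"
      obtain x y where xy: "v = ?b x + w *s ?b y" using baer_vec_coords_exist[OF M w] by blast
      then show "v \<in> {?b x + w *s ?b y |x y. x \<in> perp f U \<and> y \<in> perp f U}" using 2[of x y] v by blast
    next
      fix v assume "v \<in> {?b x + w *s ?b y |x y. x \<in> perp f U \<and> y \<in> perp f U}"
      then obtain x y where "v = ?b x + w *s ?b y" "x \<in> perp f U" "y \<in> perp f U" by blast
      then show "v \<in> perp ?f' (?b ` U)" using 2[of x y] by blast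
    qed
  qed
  define W where "W = symplectic_quadrangle M (perp f)"
  have "symplectic_subquadrangle (perp h) W"
    unfolding symplectic_subquadrangle_def
  proof (intro exI conjI allI impI)
    show "invertible M" by (rule M)
    show "symplectic_polarity (perp f)" unfolding symplectic_polarity_def using alt nd by blast
    show "W = symplectic_quadrangle M (perp f)" by (rule W_def)
    show "symplectic_polarity (perp ?f')"
      unfolding symplectic_polarity_def using conj_frame_form(1,2)[OF assms] by blast
    show "extends_polarity M (perp f) (perp ?f')" unfolding extends_polarity_def using ext by blast
    show "semilinear_involution (image (conj_frame B))" by (rule frame_semilinear_involution(1)[OF assms])
    show "{P \<in> pg_points. conj_frame B ` P = P} = baer_points M"
      unfolding pts by (rule frame_semilinear_involution(2)[OF assms])
    show "perp ?f' (perp h U) = conj_frame B ` U" if "vec.subspace U" for U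
      by (rule perp_conj_frame(1)[OF assms that])
    show "perp h (perp ?f' U) = conj_frame B ` U" if "vec.subspace U" for U
      by (rule perp_conj_frame(2)[OF assms that])
  qed
  define S where "S = {x. x \<noteq> 0 \<and> q x = 0}"
  have S_B: "x \<in> S \<longleftrightarrow> ?b x \<in> B" for x
  proof -
    have "0 \<notin> B" using frame_elem_nonzero[OF assms] by blast
    then show ?thesis unfolding S_def using q0[rule_format, of x] by (cases "x = 0") simp_all
  qed
  have S_f: "f x y = 1" if "x \<in> S" "y \<in> S" "x \<noteq> y" for x y
  proof -
    have "?b x \<noteq> ?b y" using inj_baer_vec[OF M] that by simp
    then have "h (?b x) (?b y) = 1" using frame_h[OF assms] S_B that by simp
    then show ?thesis using hf by simp
  qed
  have bS: "?b ` S = B"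
  proof (intro equalityI subsetI)
    fix v assume "v \<in> B"
    then have "v \<in> range ?b" using range frame_subset_lattice[OF assms] by blast
    then show "v \<in> ?b ` S" using S_B \<open>v \<in> B\<close> by blast
  qed (use S_B in blast)
  define Q where "Q = {P \<in> pg_points. \<forall>v\<in>P. q v = 0}"
  have Q: "Q = (\<lambda>x. vec.span {x}) ` S"
  proof -
    have "(\<forall>v\<in>vec.span {x}. q v = 0) \<longleftrightarrow> q x = 0" for x
      using q00 by (simp add: bit_span_singleton)
    then show ?thesis unfolding Q_def pg_points_eq S_def by auto
  qed
  have ell: "elliptic_quadric Q"
    unfolding elliptic_quadric_def
  proof (intro exI conjI)
    show "Q = {P \<in> pg_points. \<forall>v\<in>P. q v = 0}" by (rule Q_def)
    have polar: "q (u + v) - q u - q v = f u v" for u v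
      using q_add by (simp add: add.commute add.left_commute)
    show "nonsingular_quadratic_form q"
      unfolding nonsingular_quadratic_form_def quadratic_form_def polar
      using q_scale b nd unfolding nondegenerate_form_def by blast
    let ?D = "{vec.dim U | U. vec.subspace U \<and> (\<forall>v\<in>U. q v = 0)}"
    \<comment> \<open>Distinct nonzero singular vectors have product 1, so their sum is not
      singular.\<close>
    have le1: "vec.dim U \<le> 1" if U: "vec.subspace U" "\<forall>v\<in>U. q v = 0" for U
    proof -
      have "x = y" if "x \<in> U" "y \<in> U" "x \<noteq> 0" "y \<noteq> 0" for x y
      proof (rule ccontr)
        assume "x \<noteq> y"
        then have "f x y = 1" using S_f[of x y] that U(2) by (simp add: S_def)
        then have "q (x + y) = 1" using q_add U(2) that by simp
        then show False using U(2) vec.subspace_add[OF U(1) that(1,2)] by simp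
      qed
      then have "\<exists>x. U \<subseteq> {0, x}" by (cases "U \<subseteq> {0}") blast+
      then obtain x where "U \<subseteq> {0, x}" by blast
      then have "U \<subseteq> vec.span {x}" by (simp only: bit_span_singleton)
      then show ?thesis using vec.dim_le_card[of U "{x}"] by simp
    qed
    have "S \<noteq> {}" using bS frame_card[OF assms] by auto
    then obtain x where x: "x \<in> S" by blast
    then have "vec.dim (vec.span {x}) = 1" "\<forall>v\<in>vec.span {x}. q v = 0"
      using q00 by (simp_all add: vec.dim_insert S_def bit_span_singleton)
    then have "1 = vec.dim (vec.span {x}) \<and> vec.subspace (vec.span {x}) \<and> (\<forall>v\<in>vec.span {x}. q v = 0)"
      by (intro conjI) simp_all
    then have "1 \<in> ?D" by blast
    moreover have "finite ?D" using le1 by (intro finite_subset[of ?D "{..1}"]) auto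
    ultimately show "witt_index q = 1" unfolding witt_index_def using le1 by (intro Max_eqI) auto
  qed
  have XQ: "frame_points B = baer_embedding M ` Q"
    unfolding Q frame_points_def bS[symmetric] by (simp add: image_image baer_embedding_span_set)
  have pt_sub: "pt (?b x) \<subseteq> baer_embedding M U \<longleftrightarrow> x \<in> U" if "vec.subspace U" for x U
  proof -
    have "pt (?b x) \<subseteq> baer_embedding M U \<longleftrightarrow> ?b x \<in> baer_embedding M U"
      using vec.span_minimal[of "{?b x}" "baer_embedding M U"] vec.span_base[of "?b x" "{?b x}"]
      by (auto simp: baer_embedding_span)
    then show ?thesis using baer_embedding_mem[OF M that] by simp
  qed
  have inj_pt: "inj_on (\<lambda>x. pt (?b x)) S"
  proof (rule inj_onI)
    fix x y assume "x \<in> S" "y \<in> S" "pt (?b x) = pt (?b y)"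
    then have "?b x = ?b y" using pt_eq_lattice[OF assms, of "?b x" "?b y"] bl S_B frame_elem_nonzero[OF assms] by blast
    then show "x = y" using inj_baer_vec[OF M] by simp
  qed
  \<comment> \<open>The q-values of the three points of a line have sum f x y. If f x y = 1, the
    number of zeros is 0 or 2; if f x y = 0, it is 1 or 3, and 3 is impossible because distinct
    singular vectors have product 1.\<close>
  have tangent: "card {P \<in> frame_points B. P \<subseteq> baer_embedding M U} = 1 \<longleftrightarrow> U \<subseteq> perp f U"
    if line: "U \<in> pg_lines" for U
  proof -
    obtain x y where U: "U = vec.span {x, y}" and xy: "x \<noteq> 0" "y \<notin> vec.span {x}"
      using line unfolding pg_lines_eq by blast
    have y: "y \<noteq> 0" "y \<noteq> x" using xy(2) by (auto simp: bit_span_singleton)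
    have x_y: "x + y \<noteq> 0" "x + y \<noteq> x" "x + y \<noteq> y"
    proof -
      show "x + y \<noteq> 0"
      proof
        assume "x + y = 0"
        moreover have "y = x + (x + y)" by (simp add: add.assoc[symmetric])
        ultimately have "y = x" by (simp only: add_0_right)
        then show False using y(2) by blast
      qed
    qed (use xy y in auto)
    have U4: "U = {0, x, y, x + y}" unfolding U by (rule bit_span_pair)
    have "{P \<in> frame_points B. P \<subseteq> baer_embedding M U} = (\<lambda>x. pt (?b x)) ` {z \<in> S. z \<in> U}"
      unfolding frame_points_def bS[symmetric] using pt_sub[of U] by (auto simp: U)
    then have "card {P \<in> frame_points B. P \<subseteq> baer_embedding M U} = card {z \<in> S. z \<in> U}"
      using inj_pt by (simp add: card_image inj_on_subset)
    also have "{z \<in> S. z \<in> U} = (if q x = 0 then {x} else {}) \<union> (if q y = 0 then {y} else {}) \<union> (if q (x + y) = 0 then {x + y} else {})"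
      unfolding U4 S_def using xy y x_y by auto
    finally have card: "card {P \<in> frame_points B. P \<subseteq> baer_embedding M U} =
      card ((if q x = 0 then {x} else {}) \<union> (if q y = 0 then {y} else {}) \<union> (if q (x + y) = 0 then {x + y} else {}))" .
    have "f x y = f y x" using alternating_sym[OF alt, of x y] by simp
    have perp: "U \<subseteq> perp f U \<longleftrightarrow> f x y = 0"
    proof
      assume "U \<subseteq> perp f U"
      then have "y \<in> perp f U" "x \<in> U" unfolding U4 by auto
      then show "f x y = 0" by (simp add: perp_def)
    next
      assume "f x y = 0"
      then have "{x, y} \<subseteq> perp f {x, y}" using \<open>f x y = f y x\<close> f_self by (auto simp: perp_def)
      then show "U \<subseteq> perp f U" unfolding U perp_span[OF b] by (rule vec.span_minimal[OF _ subspace_perp[OF b]])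
    qed
    have "q x = 0 \<Longrightarrow> q y = 0 \<Longrightarrow> f x y = 1" using S_f[of x y] xy y by (simp add: S_def)
    moreover have "q (x + y) = q x + q y + f x y" using q_add by blast
    ultimately show ?thesis unfolding card perp using y x_y
      by (cases "q x"; cases "q y"; cases "f x y") (simp_all add: eq_commute[of x "x + y"] eq_commute[of y "x + y"])
  qed
  have "elliptic_ovoid W (frame_points B)"
    unfolding elliptic_ovoid_def
  proof (intro exI conjI)
    show "invertible M" by (rule M)
    show "points_of W = baer_points M" by (simp add: W_def symplectic_quadrangle_def)
    show "elliptic_quadric Q" by (rule ell)
    show "frame_points B = baer_embedding M ` Q" by (rule XQ)
    show "{L \<in> baer_lines M. card {P \<in> frame_points B. P \<subseteq> L} = 1} = lines_of W"
      unfolding baer_lines_def W_def symplectic_quadrangle_def isotropic_geometry_def totally_isotropic_def snd_conv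
      using tangent by blast
  qed
  with \<open>symplectic_subquadrangle (perp h) W\<close> show ?thesis by blast
qed

section \<open>The graph in terms of frames\<close>

text \<open>Writing b = c b *s v b, the products give c a * (c b)^2 = 1 and hence c a = c b, so
  frames with the same points differ by a single scalar. This makes the points of the subquadrangle
  depend on the ovoid alone.\<close>

lemma lattice_points_frame_points:
  assumes "frame B" "frame B'" "frame_points B = frame_points B'"
  shows "lattice_points B = lattice_points B'"
proof -
  have "\<exists>c v. c \<noteq> 0 \<and> v \<in> B' \<and> b = c *s v" if "b \<in> B" for b
  proof -
    have "pt b \<in> frame_points B'" using that assms(3) unfolding frame_points_def by blast
    then obtain v where "v \<in> B'" "pt b = pt v" unfolding frame_points_def by blast
    then show ?thesis using pt_eq_iff[OF frame_elem_nonzero[OF assms(1) that], of v] by blast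
  qed
  then obtain c v where cv: "\<And>b. b \<in> B \<Longrightarrow> c b \<noteq> 0 \<and> v b \<in> B' \<and> b = c b *s v b" by metis
  have c_eq: "c a = c b" if "a \<in> B" "b \<in> B" for a b
  proof (cases "a = b")
    case False
    have "v a \<noteq> v b"
    proof
      assume "v a = v b"
      then have "pt a = pt b" using cv[OF that(1)] cv[OF that(2)] pt_eq_iff[of a "v a"] pt_eq_iff[of b "v b"]
          frame_elem_nonzero[OF assms(1)] that by metis
      then show False
        using pt_eq_lattice[OF assms(1)] frame_subset_lattice[OF assms(1)] frame_elem_nonzero[OF assms(1)] that False by blast
    qed
    then have "h (v a) (v b) = 1" using frame_h[OF assms(2)] cv that by simp
    moreover have "h a b = 1" using frame_h[OF assms(1)] that False by simp
    moreover have "h a b = c a * ((c b)\<^sup>2 * h (v a) (v b))"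
      by (metis cv h_scale_left h_scale_right that)
    ultimately have "c a * (c b)\<^sup>2 = 1" by simp
    moreover have "c b * (c b)\<^sup>2 = 1" using cv[OF that(2)] by simp
    ultimately show ?thesis by (metis mult_right_cancel mult_zero_right zero_neq_one)
  qed simp
  obtain b0 where b0: "b0 \<in> B" using frame_card[OF assms(1)] by fastforce
  have "B \<subseteq> (*s) (c b0) ` B'"
  proof
    fix b assume "b \<in> B"
    then show "b \<in> (*s) (c b0) ` B'" using cv[of b] c_eq[OF \<open>b \<in> B\<close> b0] by (metis imageI)
  qed
  moreover have "frame ((*s) (c b0) ` B')" using frame_scale(1)[OF assms(2)] cv[OF b0] by blast
  ultimately have "B = (*s) (c b0) ` B'"
    using frame_card assms(1) frame_finite by (metis card_subset_eq)
  then show ?thesis using frame_scale(3)[OF assms(2), of "c b0"] cv[OF b0] by simp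
qed

lemma Gamma_vertices_frames: "X \<in> Gamma_vertices (perp h) \<longleftrightarrow> (\<exists>B. frame B \<and> X = frame_points B)"
proof
  assume "X \<in> Gamma_vertices (perp h)"
  then obtain W where W: "symplectic_subquadrangle (perp h) W" "elliptic_ovoid W X"
    unfolding Gamma_vertices_def by blast
  obtain B where "frame B" "X = frame_points B" using subquadrangle_frame[OF W] .
  then show "\<exists>B. frame B \<and> X = frame_points B" by blast
next
  assume "\<exists>B. frame B \<and> X = frame_points B"
  then show "X \<in> Gamma_vertices (perp h)"
    unfolding Gamma_vertices_def using frame_subquadrangle by blast
qed

text \<open>The description operator asks for uniqueness of the whole pair: the points do not depend
  on the frame chosen, and the lines are the joins of these points that are tangent to the
  ovoid.\<close>

lemma points_of_subquadrangle_of: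
  assumes "frame B"
  shows "points_of (subquadrangle_of (perp h) (frame_points B)) = lattice_points B"
proof -
  have W: "points_of W = lattice_points B \<and>
      lines_of W = {L \<in> joins (lattice_points B). card {P \<in> frame_points B. P \<subseteq> L} = 1}"
    if subq: "symplectic_subquadrangle (perp h) W \<and> elliptic_ovoid W (frame_points B)" for W
  proof -
    obtain B' where B': "frame B'" "frame_points B = frame_points B'" "points_of W = lattice_points B'"
      "lines_of W = {L \<in> joins (points_of W). card {P \<in> frame_points B. P \<subseteq> L} = 1}"
      using subquadrangle_frame[OF subq[THEN conjunct1] subq[THEN conjunct2]] .
    then show ?thesis using lattice_points_frame_points[OF assms B'(1,2)] by simp
  qed
  obtain W0 where W0: "symplectic_subquadrangle (perp h) W0 \<and> elliptic_ovoid W0 (frame_points B)"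
    using frame_subquadrangle[OF assms] by blast
  have "subquadrangle_of (perp h) (frame_points B) = W0"
    unfolding subquadrangle_of_def
  proof (rule the_equality)
    show "symplectic_subquadrangle (perp h) W0 \<and> elliptic_ovoid W0 (frame_points B)" by (rule W0)
    fix W assume "symplectic_subquadrangle (perp h) W \<and> elliptic_ovoid W (frame_points B)"
    from W[OF this] W[OF W0] show "W = W0" by (simp add: prod_eq_iff)
  qed
  then show ?thesis using W[OF W0] by simp
qed

lemma Gamma_adjacent_frames:
  assumes "frame B" "frame B'"
  shows "Gamma_adjacent (perp h) (frame_points B) (frame_points B') \<longleftrightarrow> adjacent_frames B B'"
  by (simp add: Gamma_adjacent_def adjacent_frames_def points_of_subquadrangle_of assms)

end

theorem lemma4p1:
  fixes p :: "('f::field ^ 4) set \<Rightarrow> ('f ^ 4) set"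
    and C :: "('f ^ 4) set set set"
  assumes "CARD('f) = 4"
    and "unitary_polarity_4 p"
    and "maximal_clique (Gamma_vertices p) (Gamma_adjacent p) C"
  shows "card C = 3"
proof -
  obtain h where h: "hermitian_form_4 h" "nondegenerate_form h" "p = perp h"
    using assms(2) unfolding unitary_polarity_4_def by blast
  interpret hermitian_space h
    by unfold_locales (use assms(1) h in auto)
  show ?thesis
    using card_maximal_clique_frames[OF Gamma_vertices_frames Gamma_adjacent_frames] assms(3) h(3) by blast
qed

end
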